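(* Let $n=2$, $S=\mathbb{R}\times(0,1)$, $k\in\mathbb{R}$ with $k\notin\mathcal{K}$, $D=I\times(0,1)$ with $I\subset\mathbb{R}$ of finite measure, and let $V\in L^\infty(S)$ be supported in $D$. If the problem $-\Delta u=(k+V)u$ in $S$, $u=0$ on $\partial S$, has a nontrivial admissible solution, then $$c\,\|V\|_\infty\ge1,\qquad\text{where } c=\max\left\{\frac{|D|}{2\delta_-},\ \min\left\{\frac{|D|}{2\delta_+},\frac{1}{\delta_+^2}\right\}\right\}.$$
   Context: Points of $S$ are written $(x,y)$ with $x\in\mathbb{R}$, $y\in(0,1)$. $|D|$ denotes Lebesgue measure. $\mathcal{K}=\{m^2\pi^2:m=1,2,\dots\}$. For $m=1,2,\dots$ let $k_m=\sqrt{k-m^2\pi^2}$ if $m^2\pi^2<k$ and $k_m=i\sqrt{m^2\pi^2-k}$ if $m^2\pi^2\ge k$. Let $\delta_+=\min\{|k_m|:m^2\pi^2>k\}$ and $\delta_-=\min\{|k_m|:m^2\pi^2<k\}$, with $\delta_-=\infty$ (so $1/\delta_-=0$) when $k<\pi^2$. For $u\in H^1_{\rm loc}(S)$ put $u_m(x)=2\int_0^1u(x,y)\sin(m\pi y)\,dy$. A weak solution $u\in H^1_{\rm loc}(S)$ of $-\Delta u=(k+V)u$ in $S$, $u=0$ on $\partial S$, is called admissible (here $n=2$) if: (1) for every $m$ with $m^2\pi^2<k$, as $r=|x|\to\infty$, $u_m(x)=O(1)$ and $\left(\frac{\partial}{\partial r}-ik_m\right)u_m(x)=o(1)$, where $\frac{\partial}{\partial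 r}=\frac{x}{|x|}\frac{d}{dx}$; and (2) $u_m\in H^1(\mathbb{R})$ for every $m$ with $m^2\pi^2\ge k$.
   Formalization: When I is unbounded, the formal theorem additionally assumes that u is square integrable over D (for bounded I nothing is added); without this the claim fails, e.g. for complex V and a solution growing along infinitely many thin pieces of D. *)

theory Defs
  imports "HOL-Analysis.Analysis" "HOL-Library.Landau_Symbols"
    "HOL-Probability.Essential_Supremum"
begin

section \<open>Sobolev spaces\<close>

text \<open>All functions are complex valued and stand for their classes modulo equality almost
  everywhere on the set under consideration; values outside that set play no role.\<close>

primrec C_k :: "nat \<Rightarrow> ('a::euclidean_space \<Rightarrow> complex) \<Rightarrow> bool" where
  "C_k 0 f \<longleftrightarrow> continuous_on UNIV f"
| "C_k (Suc n) f \<longleftrightarrow>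
     (\<forall>x. f differentiable (at x)) \<and> (\<forall>v. C_k n (\<lambda>x. frechet_derivative f (at x) v))"

definition test_functions :: "'a::euclidean_space set \<Rightarrow> ('a \<Rightarrow> complex) set" where
  "test_functions \<Omega> = {\<phi>. (\<forall>n. C_k n \<phi>) \<and>
     compact (closure {x. \<phi> x \<noteq> 0}) \<and> closure {x. \<phi> x \<noteq> 0} \<subseteq> \<Omega>}"

definition partial_deriv :: "'a::euclidean_space \<Rightarrow> ('a \<Rightarrow> complex) \<Rightarrow> 'a \<Rightarrow> complex" where
  "partial_deriv b \<phi> x = frechet_derivative \<phi> (at x) b"

definition L2_on :: "'a::euclidean_space set \<Rightarrow> ('a \<Rightarrow> complex) set" where
  "L2_on \<Omega> = {u \<in> borel_measurable (lebesgue_on \<Omega>).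
     integrable (lebesgue_on \<Omega>) (\<lambda>x. (norm (u x))\<^sup>2)}"

text \<open>\<open>u \<in> H\<^sup>1(\<Omega>)\<close> with weak partial derivatives \<open>g b\<close> in the coordinate directions \<open>b \<in> Basis\<close>.\<close>

definition H1_grad :: "'a::euclidean_space set \<Rightarrow> ('a \<Rightarrow> complex) \<Rightarrow> ('a \<Rightarrow> 'a \<Rightarrow> complex) \<Rightarrow> bool" where
  "H1_grad \<Omega> u g \<longleftrightarrow> u \<in> L2_on \<Omega> \<and>
     (\<forall>b\<in>Basis. g b \<in> L2_on \<Omega> \<and>
        (\<forall>\<phi>\<in>test_functions \<Omega>.
           (\<integral>x. u x * partial_deriv b \<phi> x \<partial>lebesgue_on \<Omega>) = - (\<integral>x. g b x * \<phi> x \<partial>lebesgue_on \<Omega>)))"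

definition H1_on :: "'a::euclidean_space set \<Rightarrow> ('a \<Rightarrow> complex) set" where
  "H1_on \<Omega> = {u. \<exists>g. H1_grad \<Omega> u g}"

text \<open>\<open>H\<^sup>1\<^sub>0(\<Omega>)\<close>: the closure of the test functions in the norm of \<open>H\<^sup>1(\<Omega>)\<close>.\<close>

definition H1_zero_on :: "'a::euclidean_space set \<Rightarrow> ('a \<Rightarrow> complex) set" where
  "H1_zero_on \<Omega> = {u. \<exists>g \<phi>. H1_grad \<Omega> u g \<and> (\<forall>n::nat. \<phi> n \<in> test_functions \<Omega>) \<and>
     (\<lambda>n. \<integral>x. (norm (\<phi> n x - u x))\<^sup>2 \<partial>lebesgue_on \<Omega>) \<longlonglongrightarrow> 0 \<and>
     (\<forall>b\<in>Basis. (\<lambda>n. \<integral>x. (norm (partial_deriv b (\<phi> n) x - g b x))\<^sup>2 \<partial>lebesgue_on \<Omega>) \<longlonglongrightarrow> 0)}"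

definition Linf_norm :: "'a::euclidean_space set \<Rightarrow> ('a \<Rightarrow> complex) \<Rightarrow> ereal" where
  "Linf_norm \<Omega> V = esssup (lebesgue_on \<Omega>) (\<lambda>x. ereal (norm (V x)))"

definition Linf_on :: "'a::euclidean_space set \<Rightarrow> ('a \<Rightarrow> complex) set" where
  "Linf_on \<Omega> = {V \<in> borel_measurable (lebesgue_on \<Omega>). Linf_norm \<Omega> V < \<infinity>}"


section \<open>The Dirichlet problem in the strip\<close>

definition strip :: "(real \<times> real) set" where
  "strip = UNIV \<times> {0<..<1}"

definition slab :: "real \<Rightarrow> (real \<times> real) set" where
  "slab R = {-R<..<R} \<times> {0<..<1}"

text \<open>The space \<open>H\<^sup>1\<^sub>l\<^sub>o\<^sub>c\<close> of the strip is local only in the unbounded direction, i.e. \<open>u\<close> is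
  \<open>H\<^sup>1\<close> up to the boundary on every bounded piece of the strip, so that \<open>u = 0\<close> on the boundary
  makes sense. The boundary condition is the usual one: after cutting off in the \<open>x\<close> direction,
  \<open>u\<close> belongs to \<open>H\<^sup>1\<^sub>0\<close> of the strip.\<close>

definition weak_solution :: "real \<Rightarrow> (real \<times> real \<Rightarrow> complex) \<Rightarrow> (real \<times> real \<Rightarrow> complex) \<Rightarrow> bool" where
  "weak_solution k V u \<longleftrightarrow>
     (\<exists>g. (\<forall>R>0. H1_grad (slab R) u g) \<and>
        (\<forall>\<phi>\<in>test_functions strip.
           (\<integral>p. (\<Sum>b\<in>Basis. g b p * partial_deriv b \<phi> p) \<partial>lebesgue_on strip) =
           (\<integral>p. (of_real k + V p) * u p * \<phi> p \<partial>lebesgue_on strip))) \<and>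
     (\<forall>\<psi>\<in>test_functions (UNIV :: real set). (\<lambda>(x, y). \<psi> x * u (x, y)) \<in> H1_zero_on strip)"


section \<open>Modes and admissibility\<close>

definition thresholds :: "real set" where
  "thresholds = {(real m)\<^sup>2 * pi\<^sup>2 | m. m \<ge> 1}"

definition mode_k :: "real \<Rightarrow> nat \<Rightarrow> complex" where
  "mode_k k m = (if (real m)\<^sup>2 * pi\<^sup>2 < k then complex_of_real (sqrt (k - (real m)\<^sup>2 * pi\<^sup>2))
                 else \<i> * complex_of_real (sqrt ((real m)\<^sup>2 * pi\<^sup>2 - k)))"

definition mode_coeff :: "(real \<times> real \<Rightarrow> complex) \<Rightarrow> nat \<Rightarrow> real \<Rightarrow> complex" where
  "mode_coeff u m x =
     2 * (\<integral>y. u (x, y) * complex_of_real (sin (real m * pi * y)) \<partial>lebesgue_on {0<..<1})"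

text \<open>The coefficient of a propagating mode is determined by \<open>u\<close> only almost everywhere; the
  pointwise conditions at infinity refer to its differentiable representative \<open>w\<close>, which is unique
  and, by the equation and elliptic regularity, always exists for bounded \<open>V\<close>. On the real line
  \<open>at_infinity\<close> is the filter \<open>|x| \<rightarrow> \<infinity>\<close>, and \<open>sgn x * w' x\<close> is the radial derivative.\<close>

definition outgoing :: "complex \<Rightarrow> (real \<Rightarrow> complex) \<Rightarrow> bool" where
  "outgoing \<kappa> f \<longleftrightarrow>
     (\<exists>w w'. (AE x in lebesgue. w x = f x) \<and>
        (\<forall>x. (w has_vector_derivative w' x) (at x)) \<and>
        w \<in> O[at_infinity](\<lambda>_. 1) \<and>
        (\<lambda>x. complex_of_real (sgn x) * w' x - \<i> * \<kappa> * w x) \<in> o[at_infinity](\<lambda>_. 1))"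

definition admissible :: "real \<Rightarrow> (real \<times> real \<Rightarrow> complex) \<Rightarrow> (real \<times> real \<Rightarrow> complex) \<Rightarrow> bool" where
  "admissible k V u \<longleftrightarrow> weak_solution k V u \<and>
     (\<forall>m\<ge>1. (real m)\<^sup>2 * pi\<^sup>2 < k \<longrightarrow> outgoing (mode_k k m) (mode_coeff u m)) \<and>
     (\<forall>m\<ge>1. (real m)\<^sup>2 * pi\<^sup>2 \<ge> k \<longrightarrow> mode_coeff u m \<in> H1_on UNIV)"


section \<open>The constant\<close>

text \<open>Both minima are taken in the extended reals as infima (they are attained whenever the set is
  nonempty), so that \<open>delta_minus k = \<infinity>\<close>, and hence \<open>1 / delta_minus k = 0\<close>, for \<open>k < pi\<^sup>2\<close>.\<close>

definition delta_plus :: "real \<Rightarrow> ereal" where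
  "delta_plus k = Inf {ereal (norm (mode_k k m)) | m. m \<ge> 1 \<and> (real m)\<^sup>2 * pi\<^sup>2 > k}"

definition delta_minus :: "real \<Rightarrow> ereal" where
  "delta_minus k = Inf {ereal (norm (mode_k k m)) | m. m \<ge> 1 \<and> (real m)\<^sup>2 * pi\<^sup>2 < k}"

definition bound_const :: "real \<Rightarrow> (real \<times> real) set \<Rightarrow> ereal" where
  "bound_const k D =
     max (ereal (measure lebesgue D) / (2 * delta_minus k))
         (min (ereal (measure lebesgue D) / (2 * delta_plus k)) (1 / (delta_plus k)\<^sup>2))"

end

theory Submission
  imports Defs
begin

text \<open>Expand \<open>u\<close> in the Dirichlet eigenfunctions \<open>sin (m \<pi> y)\<close>. Each mode solves
  \<open>u\<^sub>m'' + k\<^sub>m\<^sup>2 u\<^sub>m = - f\<^sub>m\<close> on the line, where \<open>f = V u\<close> lives on \<open>I\<close>, and the condition at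
  infinity forces \<open>u\<^sub>m = G\<^sub>m * f\<^sub>m\<close> with the Green's function
  \<open>G\<^sub>m(x) = \<i> exp(\<i> k\<^sub>m |x|) / (2 k\<^sub>m)\<close>. Since \<open>|G\<^sub>m| \<le> 1 / (2 |k\<^sub>m|)\<close>, and the \<open>L\<^sup>1\<close> norm of \<open>G\<^sub>m\<close>
  is \<open>1 / |k\<^sub>m|\<^sup>2\<close> for an evanescent mode, the norm of \<open>u\<^sub>m\<close> in \<open>L\<^sup>2(I)\<close> is at most \<open>c\<close> times that of
  \<open>f\<^sub>m\<close>. Summing over the modes by Parseval gives \<open>\<parallel>u\<parallel> \<le> c \<parallel>V u\<parallel> \<le> c \<parallel>V\<parallel>\<^sub>\<infinity> \<parallel>u\<parallel>\<close> in \<open>L\<^sup>2(D)\<close>. If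
  \<open>c \<parallel>V\<parallel>\<^sub>\<infinity> < 1\<close>, then \<open>u\<close> vanishes on \<open>D\<close>, so \<open>f = 0\<close>, all modes vanish and \<open>u = 0\<close>.\<close>

section \<open>Smooth functions\<close>

text \<open>A mode is not known to be twice differentiable and a propagating one does not decay, so
  the convolution formula is proved by duality: the weak equation for \<open>u\<^sub>m\<close> is
  tested with a plateau times G * \<open>\<psi>\<close>. All that separates this from the formula
  are commutator terms living in two layers of unit width that move to infinity. For evanescent
  modes square integrability removes them; for propagating modes they are rewritten as a Wronskian
  of two outgoing functions. A second obstacle is that sin(m pi y) is not a test function of the
  strip. Cutting it off near the boundary is harmless, since it vanishes there, but one integration
  by parts turns it into a cosine, which does not. At that point the Dirichlet condition enters,
  through the approximation by test functions. The shape of c: a propagating mode has only the sup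
  bound of its kernel, while an evanescent one may use the better of two bounds. The length of I
  becomes |D| because the strip has height one. Absorbing the norm of u on D needs that norm to be
  finite, which local regularity does not give when I is unbounded.\<close>

lemma C_k_Suc_imp: "C_k (Suc n) f \<Longrightarrow> C_k n f"
proof (induction n arbitrary: f)
  case 0
  then show ?case
    by (simp add: differentiable_imp_continuous_on differentiable_on_def
        differentiable_at_withinI)
next
  case (Suc n)
  then show ?case by (metis C_k.simps(2))
qed

lemma C_k_continuous_on: "C_k n f \<Longrightarrow> continuous_on S f"
proof (induction n arbitrary: f)
  case 0
  then show ?case using continuous_on_subset by fastforce
next
  case (Suc n)
  then show ?case using C_k_Suc_imp by blast
qed

lemma C_k_SucI:
  fixes f :: "'a::euclidean_space \<Rightarrow> complex"
  assumes "\<And>x. (f has_derivative D x) (at x)" "\<And>v. C_k n (\<lambda>x. D x v)"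
  shows "C_k (Suc n) f"
proof -
  have "frechet_derivative f (at x) = D x" for x
    using assms(1) frechet_derivative_at by metis
  then show ?thesis
    using assms by (auto simp: differentiable_def)
qed

lemma C_k_SucD:
  assumes "C_k (Suc n) f"
  shows "(f has_derivative frechet_derivative f (at x)) (at x)"
    "C_k n (\<lambda>x. frechet_derivative f (at x) v)"
  using assms by (auto simp: frechet_derivative_works)

lemma C_k_const: "C_k n (\<lambda>x::'a::euclidean_space. c)"
proof (induction n arbitrary: c)
  case (Suc n)
  then show ?case
    by (intro C_k_SucI[where D = "\<lambda>_ _. 0"]) auto
qed auto

lemma C_k_add: "C_k n f \<Longrightarrow> C_k n g \<Longrightarrow> C_k n (\<lambda>x. f x + g x)"
proof (induction n arbitrary: f g)
  case (Suc n)
  show ?case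
    by (rule C_k_SucI[where D = "\<lambda>x v. frechet_derivative f (at x) v + frechet_derivative g (at x) v"])
      (intro has_derivative_add C_k_SucD(1)[OF Suc.prems(1)] C_k_SucD(1)[OF Suc.prems(2)]
        Suc.IH C_k_SucD(2)[OF Suc.prems(1)] C_k_SucD(2)[OF Suc.prems(2)])+
qed (auto intro: continuous_intros)

lemma C_k_mult: "C_k n f \<Longrightarrow> C_k n g \<Longrightarrow> C_k n (\<lambda>x. f x * g x)"
proof (induction n arbitrary: f g)
  case (Suc n)
  have "C_k n (\<lambda>x. f x * frechet_derivative g (at x) v + frechet_derivative f (at x) v * g x)" for v
    using Suc C_k_SucD(2) C_k_Suc_imp by (intro C_k_add) blast+
  then show ?case
    by (intro C_k_SucI[OF has_derivative_mult[OF C_k_SucD(1)[OF Suc.prems(1)] C_k_SucD(1)[OF Suc.prems(2)]]])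
qed (auto intro: continuous_intros)

lemma C_k_affine:
  fixes L :: "'a::euclidean_space \<Rightarrow> 'b::euclidean_space" and f :: "'b \<Rightarrow> complex"
  assumes "bounded_linear L" "C_k n f"
  shows "C_k n (\<lambda>x. f (L x + b))"
  using assms(2)
proof (induction n arbitrary: f)
  case 0
  have "continuous_on UNIV (\<lambda>x. L x + b)"
    using assms(1) by (intro continuous_intros linear_continuous_on)
  then show ?case
    using 0 by (auto intro: continuous_on_compose2)
next
  case (Suc n)
  have "(f \<circ> (\<lambda>x. L x + b) has_derivative frechet_derivative f (at (L x + b)) \<circ> (\<lambda>v. L v + 0)) (at x)" for x
    using assms(1) C_k_SucD(1)[OF Suc.prems]
    by (intro diff_chain_at has_derivative_add bounded_linear_imp_has_derivative has_derivative_const)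
  moreover have "C_k n (\<lambda>x. frechet_derivative f (at (L x + b)) (L v))" for v
    using C_k_SucD(2)[OF Suc.prems] by (rule Suc.IH)
  ultimately show ?case
    by (intro C_k_SucI[where D = "\<lambda>x. frechet_derivative f (at (L x + b)) \<circ> L"]) (auto simp: o_def)
qed

lemma C_k_SucI_real:
  fixes f :: "real \<Rightarrow> complex"
  assumes "\<And>x. (f has_vector_derivative f' x) (at x)" "C_k n f'"
  shows "C_k (Suc n) f"
proof (rule C_k_SucI)
  show "(f has_derivative (\<lambda>v. v *\<^sub>R f' x)) (at x)" for x
    using assms(1) by (simp add: has_vector_derivative_def)
  show "C_k n (\<lambda>x. v *\<^sub>R f' x)" for v
    unfolding scaleR_conv_of_real by (intro C_k_mult C_k_const assms)
qed

lemma vector_derivative_conv_frechet: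
  fixes f :: "real \<Rightarrow> complex"
  shows "f differentiable at x \<Longrightarrow> vector_derivative f (at x) = frechet_derivative f (at x) 1"
  by (metis frechet_derivative_works has_vector_derivative_def scaleR_one
      vector_derivative_works frechet_derivative_at)

definition smooth :: "('a::euclidean_space \<Rightarrow> complex) \<Rightarrow> bool" where
  "smooth f \<longleftrightarrow> (\<forall>n. C_k n f)"

lemma smoothD: "smooth f \<Longrightarrow> C_k n f"
  by (simp add: smooth_def)

lemma smooth_continuous_on: "smooth f \<Longrightarrow> continuous_on S f"
  using C_k_continuous_on smooth_def by blast

lemma smooth_const [intro]: "smooth (\<lambda>_. c)"
  and smooth_add [intro]: "smooth f \<Longrightarrow> smooth g \<Longrightarrow> smooth (\<lambda>x. f x + g x)"
  and smooth_mult [intro]: "smooth f \<Longrightarrow> smooth g \<Longrightarrow> smooth (\<lambda>x. f x * g x)"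
  by (auto simp: smooth_def intro: C_k_const C_k_add C_k_mult)

lemma smooth_uminus [intro]: "smooth f \<Longrightarrow> smooth (\<lambda>x. - f x)"
  using smooth_mult[OF smooth_const[of "-1"], of f] by simp

lemma smooth_diff [intro]: "smooth f \<Longrightarrow> smooth g \<Longrightarrow> smooth (\<lambda>x. f x - g x)"
  using smooth_add[of f "\<lambda>x. - g x"] by auto

lemma smooth_affine:
  assumes "bounded_linear L" "smooth f"
  shows "smooth (\<lambda>x. f (L x + b))"
  using assms by (auto simp: smooth_def intro: C_k_affine)

lemma smooth_affine_real: "smooth f \<Longrightarrow> smooth (\<lambda>x. f (a * x + b))" for a b :: real
  by (rule smooth_affine) (auto simp: bounded_linear_mult_right)

lemma smooth_fst: "smooth f \<Longrightarrow> smooth (\<lambda>p. f (fst p))" for f :: "real \<Rightarrow> complex"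
  using smooth_affine[OF bounded_linear_fst, of f 0] by simp

lemma smooth_snd: "smooth f \<Longrightarrow> smooth (\<lambda>p. f (snd p))" for f :: "real \<Rightarrow> complex"
  using smooth_affine[OF bounded_linear_snd, of f 0] by simp

text \<open>Differentiation shifts the order by one, and smoothness asks for all orders. One
  equivalence thus serves derivatives of cutoffs as well as primitives, without a new induction for
  each.\<close>

lemma smooth_real_iff:
  fixes f :: "real \<Rightarrow> complex"
  assumes "\<And>x. (f has_vector_derivative f' x) (at x)"
  shows "smooth f \<longleftrightarrow> smooth f'"
proof
  assume f: "smooth f"
  have "f' x = frechet_derivative f (at x) 1" for x
    using assms vector_derivative_conv_frechet
    by (metis differentiableI_vector vector_derivative_at)
  then have "f' = (\<lambda>x. frechet_derivative f (at x) 1)" by blast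
  then show "smooth f'"
    using C_k_SucD(2)[OF smoothD[OF f], of _ 1] by (auto simp: smooth_def)
next
  assume "smooth f'"
  then show "smooth f"
    using C_k_SucI_real[OF assms] by (metis C_k_Suc_imp smooth_def)
qed

lemma smooth_has_vector_derivative:
  fixes f :: "real \<Rightarrow> complex"
  assumes "smooth f"
  shows "(f has_vector_derivative vector_derivative f (at x)) (at x)"
  using smoothD[OF assms, of "Suc 0"] by (simp add: vector_derivative_works)

lemma smooth_of_real_has_derivative:
  assumes "\<And>x. (f has_real_derivative f' x) (at x)"
  shows "((\<lambda>x. complex_of_real (f x)) has_vector_derivative of_real (f' x)) (at x)"
  using assms has_vector_derivative_of_real has_real_derivative_iff_has_vector_derivative by blast

lemma smooth_exp: "smooth (\<lambda>x::real. exp (c * of_real x) :: complex)"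
proof -
  have der: "((\<lambda>x::real. exp (c * of_real x) :: complex) has_vector_derivative c * exp (c * of_real x)) (at x)" for x
    by (auto intro!: derivative_eq_intros has_vector_derivative_real_field simp: )
  have "C_k n (\<lambda>x::real. exp (c * of_real x) :: complex)" for n
  proof (induction n)
    case 0
    then show ?case by (auto intro!: continuous_intros)
  next
    case (Suc n)
    then show ?case
      by (intro C_k_SucI_real[OF der] C_k_mult C_k_const)
  qed
  then show ?thesis by (simp add: smooth_def)
qed

lemma smooth_sin: "smooth (\<lambda>x::real. complex_of_real (sin (a * x)))"
proof -
  have "complex_of_real (sin (a * x)) =
    (1 / (2 * \<i>)) * (exp (\<i> * of_real a * of_real x) - exp (- (\<i> * of_real a) * of_real x))" for x
    by (simp add: sin_of_real[symmetric] sin_exp_eq field_simps)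
  then show ?thesis
    by (simp only:) (intro smooth_mult smooth_const smooth_diff smooth_exp)
qed

text \<open>The polynomial factor makes the family closed under differentiation.\<close>
definition exp_flat :: "real poly \<Rightarrow> real \<Rightarrow> real" where
  "exp_flat p x = (if x > 0 then poly p (1 / x) * exp (- 1 / x) else 0)"

lemma poly_exp_tendsto: "((\<lambda>x. poly p x * exp (- x)) \<longlongrightarrow> (0::real)) at_top"
proof -
  have "((\<lambda>x. \<Sum>i\<le>degree p. coeff p i * (x ^ i / exp x)) \<longlongrightarrow> (\<Sum>i\<le>degree p. coeff p i * 0)) at_top"
    by (intro tendsto_sum tendsto_mult tendsto_const tendsto_power_div_exp_0)
  then show ?thesis
    by (simp add: poly_altdef sum_distrib_right exp_minus divide_inverse mult.assoc)
qed

lemma exp_flat_tendsto: "((\<lambda>x. exp_flat p x) \<longlongrightarrow> 0) (at_right 0)"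
proof -
  have "((\<lambda>x. poly p (inverse x) * exp (- inverse x)) \<longlongrightarrow> 0) (at_right 0)"
    using poly_exp_tendsto filterlim_inverse_at_top_right by (rule filterlim_compose)
  then show ?thesis
    by (rule Lim_transform_eventually)
      (auto simp: eventually_at_filter exp_flat_def field_simps)
qed

text \<open>For x > 0 the chain rule gives x^(-2) (p - p')(1/x) exp(-1/x), which is the origin of
  the polynomial X^2 (p - p'). At 0 both one-sided difference quotients tend to 0.\<close>

lemma exp_flat_has_derivative:
  "(exp_flat p has_real_derivative exp_flat (monom 1 2 * (p - pderiv p)) x) (at x)"
proof -
  consider "x > 0" | "x < 0" | "x = 0" by linarith
  then show ?thesis
  proof cases
    case 1
    have "((\<lambda>x. poly p (1 / x) * exp (- 1 / x)) has_real_derivative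
        exp_flat (monom 1 2 * (p - pderiv p)) x) (at x)"
      using 1 by (auto intro!: derivative_eq_intros poly_DERIV[THEN DERIV_chain2]
          simp: exp_flat_def poly_monom field_simps power2_eq_square)
    then show ?thesis
      by (rule has_field_derivative_transform_within_open[where S = "{0<..}"])
        (use 1 in \<open>auto simp: exp_flat_def\<close>)
  next
    case 2
    have "((\<lambda>x. 0) has_real_derivative 0) (at x)" by simp
    then show ?thesis
      by (rule has_field_derivative_transform_within_open[where S = "{..<0}", THEN DERIV_cong])
        (use 2 in \<open>auto simp: exp_flat_def\<close>)
  next
    case 3
    \<comment> \<open>Division by h > 0 multiplies the polynomial by X, so the difference quotient
      is again a function of the family.\<close>
    have "((\<lambda>h. exp_flat p h / h) \<longlongrightarrow> 0) (at_right 0)"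
      by (rule Lim_transform_eventually[OF exp_flat_tendsto[of "monom 1 1 * p"]])
        (auto simp: eventually_at_filter exp_flat_def poly_monom field_simps)
    moreover have "((\<lambda>h. exp_flat p h / h) \<longlongrightarrow> 0) (at_left 0)"
      by (rule Lim_transform_eventually[OF tendsto_const])
        (auto simp: eventually_at_filter exp_flat_def)
    ultimately show ?thesis
      using 3 by (simp add: DERIV_def filterlim_split_at exp_flat_def)
  qed
qed

lemma smooth_exp_flat: "smooth (\<lambda>x. complex_of_real (exp_flat p x))"
proof -
  have "C_k n (\<lambda>x. complex_of_real (exp_flat p x))" for n
  proof (induction n arbitrary: p)
    case 0
    have "continuous_on UNIV (exp_flat p)"
      using exp_flat_has_derivative by (meson DERIV_atLeastAtMost_imp_continuous_on DERIV_isCont continuous_at_imp_continuous_on)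
    then show ?case by (auto intro: continuous_intros)
  next
    case (Suc n)
    show ?case
      by (intro C_k_SucI_real[OF smooth_of_real_has_derivative[OF exp_flat_has_derivative]] Suc)
  qed
  then show ?thesis by (simp add: smooth_def)
qed

section \<open>Smooth bumps, steps and plateaus on the line\<close>

definition bump :: "real \<Rightarrow> real" where
  "bump x = exp_flat 1 x * exp_flat 1 (1 - x)"

lemma smooth_bump: "smooth (\<lambda>x. complex_of_real (bump x))"
  unfolding bump_def of_real_mult
  using smooth_affine_real[OF smooth_exp_flat[of 1], of "-1" 1]
  by (intro smooth_mult smooth_exp_flat) simp

lemma bump_nonneg: "bump x \<ge> 0"
  and bump_pos: "0 < x \<Longrightarrow> x < 1 \<Longrightarrow> bump x > 0"
  and bump_eq_0: "x \<le> 0 \<or> x \<ge> 1 \<Longrightarrow> bump x = 0"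
  by (auto simp: bump_def exp_flat_def)

lemma continuous_on_bump: "continuous_on S bump"
  using smooth_continuous_on[OF smooth_bump, of S] by (rule continuous_on_of_real_o_iff[THEN iffD1, unfolded o_def])

definition bump_int :: real where
  "bump_int = integral {0..1} bump"

lemma bump_int_pos: "bump_int > 0"
proof -
  have "bump_int \<ge> 0"
    unfolding bump_int_def by (intro integral_nonneg integrable_continuous_real continuous_on_bump bump_nonneg)
  moreover have "bump_int \<noteq> 0"
  proof
    assume "bump_int = 0"
    then have "\<And>x. x \<in> {0..1} \<Longrightarrow> bump x = 0"
      unfolding bump_int_def
      using integral_eq_0_iff[OF continuous_on_bump, of 0 1] bump_nonneg by auto
    from this[of "1/2"] show False using bump_pos[of "1/2"] by simp
  qed
  ultimately show ?thesis by simp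
qed

text \<open>A smooth transition from 0 on the negative axis to 1 beyond x = 1. Starting the integral
  at -1 makes 0 an interior point of the range where the fundamental theorem applies; the part over
  [-1, 0] contributes nothing.\<close>

definition step :: "real \<Rightarrow> real" where
  "step x = integral {-1..x} bump / bump_int"

definition dstep :: "real \<Rightarrow> real" where
  "dstep x = bump x / bump_int"

lemma step_has_derivative: "(step has_real_derivative dstep x) (at x)"
proof (cases "x > -1")
  case True
  have "((\<lambda>x. integral {-1..x} bump) has_real_derivative bump x) (at x within {-1..x+1})"
    using True by (intro integral_has_real_derivative continuous_on_bump) auto
  then have "((\<lambda>x. integral {-1..x} bump) has_real_derivative bump x) (at x)"
    using True by (subst (asm) at_within_interior) (auto simp: interior_atLeastAtMost_real)
  then show ?thesis
    unfolding step_def dstep_def by (rule DERIV_cdivide)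
next
  case False
  have *: "step y = 0" if "y < 0" for y
  proof -
    show ?thesis
      using that unfolding step_def
      by (subst integral_unique[OF has_integral_is_0]) (auto simp: bump_eq_0)
  qed
  have "((\<lambda>x. 0) has_real_derivative 0) (at x)" by simp
  then have "(step has_real_derivative 0) (at x)"
    by (rule has_field_derivative_transform_within_open[where S = "{..<0}"])
      (use False * in auto)
  then show ?thesis using False by (simp add: dstep_def bump_eq_0)
qed

lemma step_0: "x \<le> 0 \<Longrightarrow> step x = 0"
  unfolding step_def by (subst integral_unique[OF has_integral_is_0]) (auto simp: bump_eq_0)

lemma step_mono: "x \<le> y \<Longrightarrow> step x \<le> step y"
  using DERIV_nonneg_imp_nondecreasing[of x y step] step_has_derivative bump_nonneg bump_int_pos
  by (metis dstep_def divide_nonneg_pos)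

lemma step_1: "x \<ge> 1 \<Longrightarrow> step x = 1"
proof -
  assume x: "x \<ge> 1"
  have i: "bump integrable_on {a..b}" for a b
    by (intro integrable_continuous_real continuous_on_bump)
  have "integral {-1..x} bump = integral {-1..0} bump + integral {0..1} bump + integral {1..x} bump"
    using x by (simp add: i Henstock_Kurzweil_Integration.integral_combine)
  moreover have "integral {-1..0} bump = 0"
    by (rule integral_unique[OF has_integral_is_0]) (auto simp: bump_eq_0)
  moreover have "integral {1..x} bump = 0"
    by (rule integral_unique[OF has_integral_is_0]) (auto simp: bump_eq_0)
  ultimately show ?thesis
    using bump_int_pos by (simp add: step_def bump_int_def)
qed

lemma step_bounds: "0 \<le> step x" "step x \<le> 1"
  using step_mono[of "min 0 x" x] step_mono[of x "max 1 x"] by (auto simp: step_0 step_1)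

lemma smooth_dstep: "smooth (\<lambda>x. complex_of_real (dstep x))"
proof -
  have "smooth (\<lambda>x. complex_of_real (1 / bump_int) * complex_of_real (bump x))"
    by (intro smooth_mult smooth_const smooth_bump)
  then show ?thesis by (simp add: dstep_def)
qed

lemma smooth_step: "smooth (\<lambda>x. complex_of_real (step x))"
  using smooth_real_iff[OF smooth_of_real_has_derivative[OF step_has_derivative]] smooth_dstep by simp

lemma dstep_eq_0: "x \<le> 0 \<or> x \<ge> 1 \<Longrightarrow> dstep x = 0"
  by (simp add: dstep_def bump_eq_0)

lemma continuous_on_dstep: "continuous_on S dstep"
  unfolding dstep_def using bump_int_pos by (intro continuous_intros continuous_on_bump) auto

text \<open>The product rule applied to \<open>bump\<close>, where
  \<open>exp_flat (monom 1 2)\<close> is the derivative of \<open>exp_flat 1\<close>.\<close>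

definition ddstep :: "real \<Rightarrow> real" where
  "ddstep x = (exp_flat (monom 1 2) x * exp_flat 1 (1 - x) - exp_flat 1 x * exp_flat (monom 1 2) (1 - x)) / bump_int"

lemma dstep_has_derivative: "(dstep has_real_derivative ddstep x) (at x)"
proof -
  have e: "(exp_flat 1 has_real_derivative exp_flat (monom 1 2) x) (at x)" for x
    using exp_flat_has_derivative[of 1 x] by simp
  show ?thesis
    unfolding dstep_def bump_def ddstep_def using bump_int_pos
    by (auto intro!: derivative_eq_intros e[THEN DERIV_chain2] e)
qed

lemma ddstep_eq_0: "x \<le> 0 \<or> x \<ge> 1 \<Longrightarrow> ddstep x = 0"
  by (auto simp: ddstep_def exp_flat_def)

lemma smooth_ddstep: "smooth (\<lambda>x. complex_of_real (ddstep x))"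
  using smooth_real_iff[OF smooth_of_real_has_derivative[OF dstep_has_derivative]] smooth_dstep by simp

lemma continuous_on_ddstep: "continuous_on S ddstep"
  using smooth_continuous_on[OF smooth_ddstep, of S] by (rule continuous_on_of_real_o_iff[THEN iffD1, unfolded o_def])

text \<open>The transition layers have width 1 for every \<open>R\<close>, so the first two
  derivatives are bounded independently of \<open>R\<close>. The estimates at infinity rest on this
  uniformity.\<close>

definition plateau :: "real \<Rightarrow> real \<Rightarrow> real" where
  "plateau R x = step (x + R + 1) * step (R + 1 - x)"

definition dplateau :: "real \<Rightarrow> real \<Rightarrow> real" where
  "dplateau R x = dstep (x + R + 1) * step (R + 1 - x) - step (x + R + 1) * dstep (R + 1 - x)"

definition ddplateau :: "real \<Rightarrow> real \<Rightarrow> real" where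
  "ddplateau R x = ddstep (x + R + 1) * step (R + 1 - x) - 2 * dstep (x + R + 1) * dstep (R + 1 - x)
     + step (x + R + 1) * ddstep (R + 1 - x)"

lemma plateau_has_derivative: "(plateau R has_real_derivative dplateau R x) (at x)"
  unfolding plateau_def dplateau_def
  by (auto intro!: derivative_eq_intros step_has_derivative[THEN DERIV_chain2] simp: algebra_simps)

lemma dplateau_has_derivative: "(dplateau R has_real_derivative ddplateau R x) (at x)"
  unfolding dplateau_def ddplateau_def
  by (auto intro!: derivative_eq_intros step_has_derivative[THEN DERIV_chain2]
      dstep_has_derivative[THEN DERIV_chain2] simp: algebra_simps)

lemma smooth_plateau: "smooth (\<lambda>x. complex_of_real (plateau R x))"
proof -
  have "smooth (\<lambda>x. complex_of_real (step (1 * x + (R + 1))) * complex_of_real (step ((-1) * x + (R + 1))))"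
    by (intro smooth_mult smooth_affine_real[OF smooth_step])
  then show ?thesis by (simp add: plateau_def algebra_simps)
qed

lemma smooth_dplateau: "smooth (\<lambda>x. complex_of_real (dplateau R x))"
  using smooth_real_iff[OF smooth_of_real_has_derivative[OF plateau_has_derivative]] smooth_plateau by simp

lemma smooth_ddplateau: "smooth (\<lambda>x. complex_of_real (ddplateau R x))"
  using smooth_real_iff[OF smooth_of_real_has_derivative[OF dplateau_has_derivative]] smooth_dplateau by simp

lemma plateau_eq_1: "\<bar>x\<bar> \<le> R \<Longrightarrow> plateau R x = 1"
  by (simp add: plateau_def step_1)

lemma plateau_eq_0: "\<bar>x\<bar> > R + 1 \<Longrightarrow> plateau R x = 0"
  by (cases "x > 0") (auto simp: plateau_def step_0)

lemma abs_plateau_le: "\<bar>plateau R x\<bar> \<le> 1"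
  using step_bounds by (auto simp: plateau_def abs_mult intro!: mult_le_one)

lemma dplateau_eq_0:
  assumes "R \<ge> 0" "\<bar>x\<bar> \<le> R \<or> \<bar>x\<bar> \<ge> R + 1"
  shows "dplateau R x = 0" "ddplateau R x = 0"
proof -
  consider "\<bar>x\<bar> \<le> R" | "x \<ge> R + 1" | "x \<le> - R - 1" using assms by linarith
  then have "dplateau R x = 0 \<and> ddplateau R x = 0"
  proof cases
    case 1
    then have "x + R + 1 \<ge> 1" "R + 1 - x \<ge> 1" by linarith+
    then show ?thesis by (simp add: dplateau_def ddplateau_def dstep_eq_0 ddstep_eq_0)
  next
    case 2
    then have "R + 1 - x \<le> 0" by linarith
    then show ?thesis by (simp add: dplateau_def ddplateau_def step_0 dstep_eq_0 ddstep_eq_0)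
  next
    case 3
    then have "x + R + 1 \<le> 0" by linarith
    then show ?thesis by (simp add: dplateau_def ddplateau_def step_0 dstep_eq_0 ddstep_eq_0)
  qed
  then show "dplateau R x = 0" "ddplateau R x = 0" by simp_all
qed

lemma compact_support_bounded:
  fixes f :: "real \<Rightarrow> 'a::real_normed_vector"
  assumes "continuous_on UNIV f" "\<And>x. \<bar>x\<bar> > a \<Longrightarrow> f x = 0"
  obtains C where "C > 0" "\<And>x. norm (f x) \<le> C"
proof -
  have "bounded (f ` {-a..a})"
    using assms(1) by (intro compact_imp_bounded compact_continuous_image) (auto intro: continuous_on_subset)
  then obtain C where "C > 0" "\<And>x. x \<in> {-a..a} \<Longrightarrow> norm (f x) \<le> C"
    by (auto simp: bounded_pos)
  then show ?thesis
    using assms(2) by (intro that[of C]) (metis abs_le_iff atLeastAtMost_iff linorder_not_less minus_le_iff norm_zero less_imp_le)+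
qed

section \<open>Integration preliminaries\<close>

lemma cauchy_schwarz_integral:
  fixes f g :: "'a \<Rightarrow> complex"
  assumes [measurable]: "f \<in> borel_measurable M" "g \<in> borel_measurable M"
    and f: "integrable M (\<lambda>x. (norm (f x))\<^sup>2)" and g: "integrable M (\<lambda>x. (norm (g x))\<^sup>2)"
  shows "integrable M (\<lambda>x. f x * g x)"
    and "(norm (\<integral>x. f x * g x \<partial>M))\<^sup>2 \<le> (\<integral>x. (norm (f x))\<^sup>2 \<partial>M) * (\<integral>x. (norm (g x))\<^sup>2 \<partial>M)"
proof -
  have F: "(\<integral>\<^sup>+x. (ennreal (norm (f x)))\<^sup>2 \<partial>M) = ennreal (\<integral>x. (norm (f x))\<^sup>2 \<partial>M)"
    using nn_integral_eq_integral[OF f] by (simp add: ennreal_power)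
  have G: "(\<integral>\<^sup>+x. (ennreal (norm (g x)))\<^sup>2 \<partial>M) = ennreal (\<integral>x. (norm (g x))\<^sup>2 \<partial>M)"
    using nn_integral_eq_integral[OF g] by (simp add: ennreal_power)
  have CS: "(\<integral>\<^sup>+x. ennreal (norm (f x * g x)) \<partial>M)\<^sup>2 \<le> ennreal ((\<integral>x. (norm (f x))\<^sup>2 \<partial>M) * (\<integral>x. (norm (g x))\<^sup>2 \<partial>M))"
    using Cauchy_Schwarz_nn_integral[of "\<lambda>x. ennreal (norm (f x))" M "\<lambda>x. ennreal (norm (g x))"]
    by (simp add: F G norm_mult ennreal_mult)
  then have "(\<integral>\<^sup>+x. ennreal (norm (f x * g x)) \<partial>M) < \<infinity>"
    using le_less_trans[OF CS ennreal_less_top] by (simp add: power_less_top_ennreal)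
  then show i: "integrable M (\<lambda>x. f x * g x)"
    by (intro integrableI_bounded) auto
  have "ennreal ((\<integral>x. norm (f x * g x) \<partial>M)\<^sup>2) \<le> ennreal ((\<integral>x. (norm (f x))\<^sup>2 \<partial>M) * (\<integral>x. (norm (g x))\<^sup>2 \<partial>M))"
    using CS nn_integral_eq_integral[OF integrable_norm[OF i]] by (simp add: ennreal_power)
  then have "(\<integral>x. norm (f x * g x) \<partial>M)\<^sup>2 \<le> (\<integral>x. (norm (f x))\<^sup>2 \<partial>M) * (\<integral>x. (norm (g x))\<^sup>2 \<partial>M)"
    by (subst (asm) ennreal_le_iff) auto
  moreover have "(norm (\<integral>x. f x * g x \<partial>M))\<^sup>2 \<le> (\<integral>x. norm (f x * g x) \<partial>M)\<^sup>2"
    by (intro power_mono integral_norm_bound) auto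
  ultimately show "(norm (\<integral>x. f x * g x \<partial>M))\<^sup>2 \<le> (\<integral>x. (norm (f x))\<^sup>2 \<partial>M) * (\<integral>x. (norm (g x))\<^sup>2 \<partial>M)"
    by linarith
qed

text \<open>Cauchy-Schwarz applied to the difference. It carries identities for test functions over
  to their limits in the \<open>H1_zero_on\<close> sense.\<close>

lemma tendsto_integral_mult_L2:
  fixes f :: "nat \<Rightarrow> 'a \<Rightarrow> complex"
  assumes [measurable]: "\<And>n. f n \<in> borel_measurable M" "g \<in> borel_measurable M" "h \<in> borel_measurable M"
    and fg: "\<And>n. integrable M (\<lambda>x. (norm (f n x - g x))\<^sup>2)" 
    and g: "integrable M (\<lambda>x. (norm (g x))\<^sup>2)" and h: "integrable M (\<lambda>x. (norm (h x))\<^sup>2)"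
    and lim: "(\<lambda>n. \<integral>x. (norm (f n x - g x))\<^sup>2 \<partial>M) \<longlonglongrightarrow> 0"
  shows "(\<lambda>n. \<integral>x. f n x * h x \<partial>M) \<longlonglongrightarrow> (\<integral>x. g x * h x \<partial>M)"
proof -
  have i1: "integrable M (\<lambda>x. (f n x - g x) * h x)" for n
    by (intro cauchy_schwarz_integral fg h) auto
  have i2: "integrable M (\<lambda>x. g x * h x)"
    by (intro cauchy_schwarz_integral g h) auto
  have eq: "(\<integral>x. f n x * h x \<partial>M) = (\<integral>x. (f n x - g x) * h x \<partial>M) + (\<integral>x. g x * h x \<partial>M)" for n
    by (subst Bochner_Integration.integral_add[OF i1 i2, symmetric]) (simp add: algebra_simps)
  have "(\<lambda>n. (norm (\<integral>x. (f n x - g x) * h x \<partial>M))\<^sup>2) \<longlonglongrightarrow> 0"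
  proof (rule Lim_null_comparison)
    show "\<forall>\<^sub>F n in sequentially. norm ((norm (\<integral>x. (f n x - g x) * h x \<partial>M))\<^sup>2) \<le>
        (\<integral>x. (norm (f n x - g x))\<^sup>2 \<partial>M) * (\<integral>x. (norm (h x))\<^sup>2 \<partial>M)"
      using cauchy_schwarz_integral(2)[OF _ _ fg h] by simp
    show "(\<lambda>n. (\<integral>x. (norm (f n x - g x))\<^sup>2 \<partial>M) * (\<integral>x. (norm (h x))\<^sup>2 \<partial>M)) \<longlonglongrightarrow> 0"
      using tendsto_mult[OF lim tendsto_const] by simp
  qed
  then have "(\<lambda>n. \<integral>x. (f n x - g x) * h x \<partial>M) \<longlonglongrightarrow> 0"
    using tendsto_real_sqrt[of "\<lambda>n. (norm (\<integral>x. (f n x - g x) * h x \<partial>M))\<^sup>2" 0]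
    by (simp add: tendsto_norm_zero_iff)
  from tendsto_add[OF this tendsto_const[of "\<integral>x. g x * h x \<partial>M"]] show ?thesis
    unfolding eq by simp
qed

lemma integral_lebesgue_on_mono_set:
  fixes f :: "'a::euclidean_space \<Rightarrow> 'b::{banach, second_countable_topology}"
  assumes "S \<subseteq> T" "S \<in> sets lebesgue" "T \<in> sets lebesgue" "\<And>x. x \<in> T - S \<Longrightarrow> f x = 0"
  shows "integrable (lebesgue_on S) f \<longleftrightarrow> integrable (lebesgue_on T) f"
    and "integral\<^sup>L (lebesgue_on S) f = integral\<^sup>L (lebesgue_on T) f"
proof -
  have "indicator S x *\<^sub>R f x = indicator T x *\<^sub>R f x" for x
    using assms(1,4) by (auto simp: indicator_def)
  then show "integrable (lebesgue_on S) f \<longleftrightarrow> integrable (lebesgue_on T) f"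
    and "integral\<^sup>L (lebesgue_on S) f = integral\<^sup>L (lebesgue_on T) f"
    using assms(2,3) by (simp_all only: integrable_restrict_space integral_restrict_space sets.Int_space_eq2)
qed

lemma integrable_bounded_mult:
  fixes f g :: "'a \<Rightarrow> complex"
  assumes "integrable M f" "g \<in> borel_measurable M" "\<And>x. x \<in> space M \<Longrightarrow> norm (g x) \<le> C"
  shows "integrable M (\<lambda>x. f x * g x)"
proof (rule Bochner_Integration.integrable_bound[of _ "\<lambda>x. C * norm (f x)"])
  show "integrable M (\<lambda>x. C * norm (f x))" using assms(1) by auto
  show "AE x in M. norm (f x * g x) \<le> norm (C * norm (f x))"
  proof (rule AE_I2)
    fix x assume "x \<in> space M"
    then have "norm (g x) \<le> C" by (rule assms(3))
    then have "norm (f x) * norm (g x) \<le> norm (f x) * C" and "C \<ge> 0"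
      by (rule mult_left_mono[OF _ norm_ge_zero], rule order_trans[OF norm_ge_zero])
    then show "norm (f x * g x) \<le> norm (C * norm (f x))"
      by (simp add: norm_mult abs_mult mult.commute)
  qed
qed (use assms in auto)

lemma square_sum_le: "(a + b)\<^sup>2 \<le> 2 * a\<^sup>2 + 2 * b\<^sup>2" for a b :: real
  using zero_le_power2[of "a - b"] by (simp add: power2_diff power2_sum)

lemma le_one_plus_square: "r \<le> 1 + r\<^sup>2" for r :: real
  using self_le_power[of r 2] zero_le_power2[of r] by (cases "r \<le> 1") (linarith, simp)

lemma L2_on_imp_integrable:
  assumes "S \<in> lmeasurable" "u \<in> L2_on S"
  shows "integrable (lebesgue_on S) u"
proof (rule Bochner_Integration.integrable_bound[of _ "\<lambda>x. 1 + (norm (u x))\<^sup>2"])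
  have "finite_measure (lebesgue_on S)"
    using assms(1) by (intro finite_measure_lebesgue_on)
  then show "integrable (lebesgue_on S) (\<lambda>x. 1 + (norm (u x))\<^sup>2)"
    using assms(2) by (auto simp: L2_on_def finite_measure.integrable_const)
  show "AE x in lebesgue_on S. norm (u x) \<le> norm (1 + (norm (u x))\<^sup>2)"
    using le_one_plus_square by simp
qed (use assms in \<open>auto simp: L2_on_def\<close>)

lemma continuous_imp_measurable_lebesgue_on:
  fixes f :: "'a::euclidean_space \<Rightarrow> 'b::euclidean_space"
  assumes "continuous_on UNIV f"
  shows "f \<in> borel_measurable (lebesgue_on S)"
  using borel_measurable_continuous_onI[OF assms]
  by (simp add: measurable_completion measurable_restrict_space1)

lemma slab_lmeasurable: "slab R \<in> lmeasurable"
proof -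
  have "slab R = box (-R, 0) (R, 1)"
    by (auto simp: slab_def box_def Basis_prod_def)
  then show ?thesis by simp
qed

lemma strip_lebesgue: "strip \<in> sets lebesgue" and strip_borel: "strip \<in> sets borel"
proof -
  have "open strip" by (auto simp: strip_def intro: open_Times)
  then show "strip \<in> sets lebesgue" "strip \<in> sets borel" by (auto intro: borel_open)
qed

lemma slab_subset_strip: "slab R \<subseteq> strip"
  by (auto simp: slab_def strip_def)

section \<open>Test functions in the strip\<close>

lemma has_vector_derivative_vanishing:
  fixes f f' :: "real \<Rightarrow> 'a::real_normed_vector"
  assumes "\<And>x. (f has_vector_derivative f' x) (at x)" "\<And>x. \<bar>x\<bar> > r \<Longrightarrow> f x = 0" "\<bar>x\<bar> > r"
  shows "f' x = 0"
proof -
  have "((\<lambda>_. 0) has_vector_derivative (0::'a)) (at x)" by simp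
  moreover have "open {x. \<bar>x\<bar> > r}" by (auto intro!: open_Collect_less continuous_intros)
  ultimately have "(f has_vector_derivative 0) (at x)"
    by (rule has_vector_derivative_transform_within_open) (use assms in auto)
  then show ?thesis using assms(1) vector_derivative_at by metis
qed

lemma test_functions_iff:
  "\<phi> \<in> test_functions \<Omega> \<longleftrightarrow> smooth \<phi> \<and> compact (closure {x. \<phi> x \<noteq> 0}) \<and> closure {x. \<phi> x \<noteq> 0} \<subseteq> \<Omega>"
  by (simp add: test_functions_def smooth_def)

lemma test_functionsI:
  assumes "smooth \<phi>" "compact K" "K \<subseteq> \<Omega>" "\<And>x. x \<notin> K \<Longrightarrow> \<phi> x = 0"
  shows "\<phi> \<in> test_functions \<Omega>"
proof -
  have "closure {x. \<phi> x \<noteq> 0} \<subseteq> K"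
    using assms(2,4) by (intro closure_minimal compact_imp_closed) auto
  then show ?thesis
    using assms compact_Int_closed[OF assms(2) closed_closure, of "{x. \<phi> x \<noteq> 0}"]
    by (auto simp: test_functions_iff Int_absorb1 inf_commute)
qed

lemma test_functionsD:
  assumes "\<phi> \<in> test_functions \<Omega>"
  shows "smooth \<phi>" "x \<notin> \<Omega> \<Longrightarrow> \<phi> x = 0" "bounded {x. \<phi> x \<noteq> 0}"
  using assms closure_subset[of "{x. \<phi> x \<noteq> 0}"]
  by (auto simp: test_functions_iff dest: compact_imp_bounded intro: bounded_subset)

lemma tensor_test_function:
  fixes a b :: "real \<Rightarrow> complex"
  assumes "smooth a" "smooth b" "\<And>x. \<bar>x\<bar> > r \<Longrightarrow> a x = 0" "r < R"
    and "\<And>y. y \<notin> {c..d} \<Longrightarrow> b y = 0" "0 < c" "d < 1"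
  shows "(\<lambda>p. a (fst p) * b (snd p)) \<in> test_functions (slab R)"
    and "(\<lambda>p. a (fst p) * b (snd p)) \<in> test_functions strip"
proof -
  have "(\<lambda>p. a (fst p) * b (snd p)) \<in> test_functions \<Omega>" if "{-r..r} \<times> {c..d} \<subseteq> \<Omega>" for \<Omega>
  proof (rule test_functionsI[where K = "{-r..r} \<times> {c..d}"])
    show "a (fst x) * b (snd x) = 0" if "x \<notin> {-r..r} \<times> {c..d}" for x
      using that assms(3)[of "fst x"] assms(5)[of "snd x"] by (cases x) auto
  qed (use that assms in \<open>auto intro!: compact_Times smooth_mult smooth_fst smooth_snd\<close>)
  then show "(\<lambda>p. a (fst p) * b (snd p)) \<in> test_functions (slab R)"
    and "(\<lambda>p. a (fst p) * b (snd p)) \<in> test_functions strip"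
    using assms(4,6,7) by (simp_all add: slab_def strip_def subset_iff)
qed

lemma partial_deriv_tensor:
  fixes a b :: "real \<Rightarrow> complex"
  assumes "(a has_vector_derivative a') (at (fst p))" "(b has_vector_derivative b') (at (snd p))"
  shows "partial_deriv (1, 0) (\<lambda>p. a (fst p) * b (snd p)) p = a' * b (snd p)"
    and "partial_deriv (0, 1) (\<lambda>p. a (fst p) * b (snd p)) p = a (fst p) * b'"
proof -
  have "(a has_derivative (\<lambda>v. v *\<^sub>R a')) (at (fst p))" "(b has_derivative (\<lambda>v. v *\<^sub>R b')) (at (snd p))"
    using assms by (auto simp: has_vector_derivative_def)
  then have "((\<lambda>p. a (fst p)) has_derivative (\<lambda>v. fst v *\<^sub>R a')) (at p)"
       "((\<lambda>p. b (snd p)) has_derivative (\<lambda>v. snd v *\<^sub>R b')) (at p)"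
    using has_derivative_compose[of fst fst p UNIV a] has_derivative_compose[of snd snd p UNIV b]
    by (auto simp: bounded_linear_fst bounded_linear_snd bounded_linear_imp_has_derivative)
  then have "((\<lambda>p. a (fst p) * b (snd p)) has_derivative
      (\<lambda>v. a (fst p) * (snd v *\<^sub>R b') + (fst v *\<^sub>R a') * b (snd p))) (at p)"
    by (rule has_derivative_mult)
  then have "frechet_derivative (\<lambda>p. a (fst p) * b (snd p)) (at p) =
      (\<lambda>v. a (fst p) * (snd v *\<^sub>R b') + (fst v *\<^sub>R a') * b (snd p))"
    by (rule frechet_derivative_at[symmetric])
  then show "partial_deriv (1, 0) (\<lambda>p. a (fst p) * b (snd p)) p = a' * b (snd p)"
    and "partial_deriv (0, 1) (\<lambda>p. a (fst p) * b (snd p)) p = a (fst p) * b'"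
    by (simp_all add: partial_deriv_def fun_eq_iff)
qed

lemma continuous_on_partial_deriv:
  assumes "smooth \<phi>"
  shows "continuous_on UNIV (partial_deriv b \<phi>)"
  using C_k_SucD(2)[OF smoothD[OF assms], of 0 b] by (simp add: partial_deriv_def[abs_def])

lemma partial_deriv_eq_0:
  assumes "p \<notin> closure {p. \<phi> p \<noteq> 0}"
  shows "partial_deriv b \<phi> p = 0"
proof -
  have "((\<lambda>_. 0) has_derivative (\<lambda>_. 0)) (at p)" by simp
  then have "(\<phi> has_derivative (\<lambda>_. 0)) (at p)"
    by (rule has_derivative_transform_within_open[where s = "- closure {p. \<phi> p \<noteq> 0}"])
      (use assms closure_subset[of "{p. \<phi> p \<noteq> 0}"] in auto)
  then have "frechet_derivative \<phi> (at p) = (\<lambda>_. 0)"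
    by (rule frechet_derivative_at[symmetric])
  then show ?thesis by (simp add: partial_deriv_def)
qed

text \<open>By Fubini the second variable is integrated first, and the inner integral is a
  difference of two values of \<open>\<Psi>\<close> outside its support. Applied to a product it is
  integration by parts.\<close>

lemma integral_partial_deriv_snd:
  assumes "\<Psi> \<in> test_functions (UNIV :: (real \<times> real) set)"
  shows "(\<integral>p. partial_deriv (0, 1) \<Psi> p \<partial>lborel) = 0"
proof -
  note sm = test_functionsD(1)[OF assms]
  have der: "(\<Psi> has_derivative frechet_derivative \<Psi> (at p)) (at p)" for p
    using C_k_SucD(1)[OF smoothD[OF sm]] .
  obtain a where a: "a > 0" "\<And>p. norm p > a \<Longrightarrow> \<Psi> p = 0"
    using test_functionsD(3)[OF assms] by (force simp: bounded_pos)
  have vd: "((\<lambda>y. \<Psi> (x, y)) has_vector_derivative partial_deriv (0, 1) \<Psi> (x, y)) (at y)" for x y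
  proof -
    have "((\<lambda>y. (x, y)) has_derivative (\<lambda>v. (0, v))) (at y)"
      by (auto intro!: derivative_eq_intros)
    then have "((\<lambda>y. \<Psi> (x, y)) has_derivative (\<lambda>v. frechet_derivative \<Psi> (at (x, y)) (0, v))) (at y)"
      using has_derivative_compose der by blast
    moreover have "frechet_derivative \<Psi> (at (x, y)) (0, v) = v *\<^sub>R partial_deriv (0, 1) \<Psi> (x, y)" for v
      using linear_scale[OF has_derivative_linear[OF der[of "(x, y)"]], of v "(0, 1)"]
      by (simp add: partial_deriv_def)
    ultimately show ?thesis by (simp add: has_vector_derivative_def)
  qed
  have van: "partial_deriv (0, 1) \<Psi> p = 0" if "norm p > a" for p
  proof (rule partial_deriv_eq_0)
    have "closure {p. \<Psi> p \<noteq> 0} \<subseteq> cball 0 a"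
      using a(2) by (intro closure_minimal) (auto simp: not_less[symmetric])
    then show "p \<notin> closure {p. \<Psi> p \<noteq> 0}" using that by auto
  qed
  note cont = continuous_on_partial_deriv[OF sm, of "(0, 1)"]
  have "integrable lborel (\<lambda>p. indicator (cball 0 a) p *\<^sub>R partial_deriv (0, 1) \<Psi> p)"
    by (intro borel_integrable_compact continuous_on_subset[OF cont]) auto
  moreover have "(\<lambda>p. indicator (cball 0 a) p *\<^sub>R partial_deriv (0, 1) \<Psi> p) = partial_deriv (0, 1) \<Psi>"
    using van by (auto simp: indicator_def fun_eq_iff)
  ultimately have int: "integrable (lborel \<Otimes>\<^sub>M lborel) (partial_deriv (0, 1) \<Psi>)"
    by (simp add: lborel_prod)
  have inner: "(\<integral>y. partial_deriv (0, 1) \<Psi> (x, y) \<partial>lborel) = 0" for x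
  proof -
    have n: "norm (x, y) > a" if "\<bar>y\<bar> > a" for y
      using that norm_snd_le[of y x] by simp
    have "((\<lambda>y. partial_deriv (0, 1) \<Psi> (x, y)) has_integral \<Psi> (x, a + 1) - \<Psi> (x, - (a + 1))) {-(a+1)..a+1}"
      using a(1) by (intro fundamental_theorem_of_calculus has_vector_derivative_at_within[OF vd]) auto
    then have hi: "((\<lambda>y. partial_deriv (0, 1) \<Psi> (x, y)) has_integral 0) {-(a+1)..a+1}"
      using n a by simp
    have c: "continuous_on UNIV (\<lambda>y. partial_deriv (0, 1) \<Psi> (x, y))"
      by (rule continuous_on_compose2[OF cont]) (auto intro!: continuous_intros)
    have "set_integrable lborel {-(a+1)..a+1} (\<lambda>y. partial_deriv (0, 1) \<Psi> (x, y))"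
      unfolding set_integrable_def
      by (intro borel_integrable_compact continuous_on_subset[OF c]) auto
    then have "(LINT y:{-(a+1)..a+1}|lborel. partial_deriv (0, 1) \<Psi> (x, y)) = 0"
      using set_borel_integral_eq_integral(2) hi integral_unique by metis
    moreover have "indicator {-(a+1)..a+1} y *\<^sub>R partial_deriv (0, 1) \<Psi> (x, y) = partial_deriv (0, 1) \<Psi> (x, y)" for y
      using van[OF n[of y]] by (auto simp: indicator_def)
    ultimately show ?thesis by (simp add: set_lebesgue_integral_def)
  qed
  have "(\<integral>p. partial_deriv (0, 1) \<Psi> p \<partial>lborel) = (\<integral>x. \<integral>y. partial_deriv (0, 1) \<Psi> (x, y) \<partial>lborel \<partial>lborel)"
    using lborel_pair.integral_fst'[OF int] by (simp only: lborel_prod)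
  then show ?thesis by (simp add: inner)
qed

section \<open>The equation for the modes\<close>

text \<open>The shift by -1 makes the function vanish within distance 1/n of both end points, so
  that tensor products with it have compact support in the open strip. From distance 2/n on it
  equals 1.\<close>

definition cutoff :: "nat \<Rightarrow> real \<Rightarrow> real" where
  "cutoff n y = step (real n * y - 1) * step (real n * (1 - y) - 1)"

definition dcutoff :: "nat \<Rightarrow> real \<Rightarrow> real" where
  "dcutoff n y = real n * dstep (real n * y - 1) * step (real n * (1 - y) - 1)
     - real n * step (real n * y - 1) * dstep (real n * (1 - y) - 1)"

lemma cutoff_has_derivative: "(cutoff n has_real_derivative dcutoff n y) (at y)"
  unfolding cutoff_def dcutoff_def
  by (auto intro!: derivative_eq_intros step_has_derivative[THEN DERIV_chain2] simp: algebra_simps)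

lemma smooth_cutoff: "smooth (\<lambda>y. complex_of_real (cutoff n y))"
proof -
  have "smooth (\<lambda>y. complex_of_real (step (real n * y + (-1))) * complex_of_real (step ((- real n) * y + (real n - 1))))"
    by (intro smooth_mult smooth_affine_real[OF smooth_step])
  then show ?thesis by (simp add: cutoff_def algebra_simps)
qed

text \<open>Using 1/(n+1) in place of 1/n gives up a little but keeps n = 0 meaningful: the interval
  is then empty and the cutoff is identically 0.\<close>

lemma cutoff_eq_0: "y \<notin> {1 / (real n + 1)..1 - 1 / (real n + 1)} \<Longrightarrow> cutoff n y = 0"
proof -
  assume y: "y \<notin> {1 / (real n + 1)..1 - 1 / (real n + 1)}"
  then consider "y < 1 / (real n + 1)" | "1 - y < 1 / (real n + 1)" by (auto simp: algebra_simps)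
  moreover have "real n * z - 1 \<le> 0" if "z < 1 / (real n + 1)" for z
  proof (cases "z \<ge> 0")
    case True
    with that show ?thesis by (simp add: field_simps)
  next
    case False
    then have "real n * z \<le> 0" by (simp add: mult_nonneg_nonpos)
    then show ?thesis by simp
  qed
  ultimately show ?thesis by cases (auto simp: cutoff_def step_0)
qed

lemma abs_cutoff_le: "\<bar>cutoff n y\<bar> \<le> 1"
  using step_bounds by (auto simp: cutoff_def abs_mult intro!: mult_le_one)

lemma eventually_cutoff:
  assumes "0 < y" "y < 1"
  shows "\<forall>\<^sub>F n in sequentially. cutoff n y = 1" "\<forall>\<^sub>F n in sequentially. dcutoff n y = 0"
proof -
  have "filterlim (\<lambda>n. real n * z) at_top sequentially" if "z > 0" for z
    using that by (intro filterlim_tendsto_pos_mult_at_top_iff[THEN iffD2] filterlim_at_top_mult_tendsto_pos[OF tendsto_const] filterlim_real_sequentially) auto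
  then have "\<forall>\<^sub>F n in sequentially. real n * y \<ge> 2 \<and> real n * (1 - y) \<ge> 2"
    using assms by (auto simp: filterlim_at_top intro!: eventually_conj)
  then show "\<forall>\<^sub>F n in sequentially. cutoff n y = 1" "\<forall>\<^sub>F n in sequentially. dcutoff n y = 0"
    by (eventually_elim, simp add: cutoff_def dcutoff_def step_1 dstep_eq_0)+
qed

lemma dstep_bounded: obtains C where "C > 0" "\<And>x. \<bar>dstep x\<bar> \<le> C"
  using compact_support_bounded[of dstep 1] continuous_on_dstep dstep_eq_0
  by (metis abs_le_iff abs_of_nonneg linorder_le_cases linorder_not_less real_norm_def)

text \<open>The derivative of the cutoff has size \<open>n\<close>, but it lives at distance at most \<open>2/n\<close> from the
  end points of the interval, where the sine is of size \<open>1/n\<close>.\<close>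
lemma dcutoff_sin_bounded:
  obtains C where "\<And>n y. \<bar>dcutoff n y * sin (real m * pi * y)\<bar> \<le> C"
proof -
  obtain C where C: "C > 0" "\<And>x. \<bar>dstep x\<bar> \<le> C" by (rule dstep_bounded) blast
  \<comment> \<open>The reflection y -> 1 - y exchanges the two end points and changes the sine at
    most by a sign, because sin(m pi) = 0. Hence \<open>key\<close> covers both ends.\<close>
  have sin_symm: "\<bar>sin (real m * pi * (1 - y))\<bar> = \<bar>sin (real m * pi * y)\<bar>" for y
  proof -
    have "real m * pi * (1 - y) = real m * pi - real m * pi * y" by (simp add: algebra_simps)
    then show ?thesis by (simp add: sin_diff abs_mult mult.commute)
  qed
  have key: "\<bar>real n * dstep (real n * z - 1) * sin (real m * pi * z)\<bar> \<le> C * (2 * (real m * pi))" for n z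
  proof (cases "0 \<le> real n * z \<and> real n * z \<le> 2")
    case True
    have "real n * \<bar>sin (real m * pi * z)\<bar> \<le> real n * \<bar>real m * pi * z\<bar>"
      by (intro mult_left_mono abs_sin_x_le_abs_x) auto
    also have "\<dots> = (real m * pi) * \<bar>real n * z\<bar>" by (simp add: abs_mult)
    also have "\<dots> \<le> (real m * pi) * 2" using True by (intro mult_left_mono) auto
    finally have "\<bar>dstep (real n * z - 1)\<bar> * (real n * \<bar>sin (real m * pi * z)\<bar>) \<le> C * (real m * pi * 2)"
      using C by (intro mult_mono[OF C(2)]) (auto simp del: mult_le_cancel_right)
    then show ?thesis by (simp add: abs_mult algebra_simps)
  next
    case False
    then have "dstep (real n * z - 1) = 0" by (auto simp: dstep_eq_0)
    then show ?thesis using C by simp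
  qed
  have "\<bar>dcutoff n y * sin (real m * pi * y)\<bar> \<le> 2 * (C * (2 * (real m * pi)))" for n y
  proof -
    let ?a = "real n * dstep (real n * y - 1) * sin (real m * pi * y)"
    let ?b = "real n * dstep (real n * (1 - y) - 1) * sin (real m * pi * y)"
    have b: "\<bar>?b\<bar> \<le> C * (2 * (real m * pi))"
      using key[of n "1 - y"] by (simp only: abs_mult sin_symm)
    have "dcutoff n y * sin (real m * pi * y) = ?a * step (real n * (1 - y) - 1) - ?b * step (real n * y - 1)"
      by (simp add: dcutoff_def algebra_simps)
    also have "\<bar>\<dots>\<bar> \<le> \<bar>?a * step (real n * (1 - y) - 1)\<bar> + \<bar>?b * step (real n * y - 1)\<bar>" by (rule abs_triangle_ineq4)
    also have "\<dots> \<le> \<bar>?a\<bar> * 1 + \<bar>?b\<bar> * 1"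
      unfolding abs_mult[of ?a] abs_mult[of ?b]
      by (intro add_mono mult_left_mono) (auto simp: step_bounds abs_of_nonneg)
    finally show ?thesis using b key[of n y] by linarith
  qed
  then show ?thesis by (rule that)
qed

text \<open>Convergence is available only for 0 < y < 1, since the cutoffs vanish at the end points;
  integration over the strip sees nothing else, and the uniform bound on \<open>q\<close> provides
  the dominating function.\<close>

lemma integral_strip_tendsto:
  fixes w :: "real \<times> real \<Rightarrow> complex" and q :: "nat \<Rightarrow> real \<Rightarrow> complex"
  assumes w: "integrable (lebesgue_on strip) w"
    and q: "\<And>n. continuous_on UNIV (q n)" "\<And>n y. norm (q n y) \<le> C"
    and lim: "\<And>y. 0 < y \<Longrightarrow> y < 1 \<Longrightarrow> (\<lambda>n. q n y) \<longlonglongrightarrow> r y"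
    and r: "continuous_on UNIV r"
  shows "(\<lambda>n. \<integral>p. w p * q n (snd p) \<partial>lebesgue_on strip) \<longlonglongrightarrow> (\<integral>p. w p * r (snd p) \<partial>lebesgue_on strip)"
proof (rule integral_dominated_convergence[where w = "\<lambda>p. norm (w p) * C"])
  have meas: "(\<lambda>p. f (snd p)) \<in> borel_measurable (lebesgue_on strip)"
    if "continuous_on UNIV f" for f :: "real \<Rightarrow> complex"
    by (rule continuous_imp_measurable_lebesgue_on, rule continuous_on_compose2[OF that])
      (auto intro: continuous_intros)
  show "(\<lambda>p. w p * r (snd p)) \<in> borel_measurable (lebesgue_on strip)"
    using w meas[OF r] by auto
  show "(\<lambda>p. w p * q n (snd p)) \<in> borel_measurable (lebesgue_on strip)" for n
    using w meas[OF q(1)] by auto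
  show "integrable (lebesgue_on strip) (\<lambda>p. norm (w p) * C)"
    using w by auto
  show "AE p in lebesgue_on strip. (\<lambda>n. w p * q n (snd p)) \<longlonglongrightarrow> w p * r (snd p)"
    by (rule AE_I2) (auto simp: space_restrict_space strip_def intro!: tendsto_mult lim)
  show "AE p in lebesgue_on strip. norm (w p * q n (snd p)) \<le> norm (w p) * C" for n
    by (rule AE_I2) (auto simp: norm_mult intro!: mult_left_mono q)
qed

lemma integral_slab_eq_strip:
  fixes f :: "real \<times> real \<Rightarrow> 'b::{banach, second_countable_topology}"
  assumes "\<And>p. \<bar>fst p\<bar> \<ge> R \<Longrightarrow> f p = 0"
  shows "integrable (lebesgue_on (slab R)) f \<longleftrightarrow> integrable (lebesgue_on strip) f"
    and "integral\<^sup>L (lebesgue_on (slab R)) f = integral\<^sup>L (lebesgue_on strip) f"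
proof -
  have "f p = 0" if "p \<in> strip - slab R" for p
    using that assms[of p] by (cases p) (auto simp: strip_def slab_def)
  then show "integrable (lebesgue_on (slab R)) f \<longleftrightarrow> integrable (lebesgue_on strip) f"
    and "integral\<^sup>L (lebesgue_on (slab R)) f = integral\<^sup>L (lebesgue_on strip) f"
    using slab_lmeasurable
    by (intro integral_lebesgue_on_mono_set slab_subset_strip strip_lebesgue fmeasurableD; blast)+
qed

lemma integrable_strip_mult_fst:
  fixes a :: "real \<Rightarrow> complex"
  assumes w: "w \<in> L2_on (slab R)" and a: "continuous_on UNIV a" "\<And>x. \<bar>x\<bar> > r \<Longrightarrow> a x = 0" "r < R"
  shows "integrable (lebesgue_on strip) (\<lambda>p. w p * a (fst p))"
proof -
  obtain C where C: "\<And>x. norm (a x) \<le> C" using compact_support_bounded[OF a(1,2)] by blast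
  have "integrable (lebesgue_on (slab R)) (\<lambda>p. w p * a (fst p))"
    by (intro integrable_bounded_mult[OF _ _ C] L2_on_imp_integrable slab_lmeasurable w
        continuous_imp_measurable_lebesgue_on continuous_on_compose2[OF a(1)]) (auto intro: continuous_intros)
  then show ?thesis
    using a(2,3) by (subst integral_slab_eq_strip(1)[where R = R, symmetric]) auto
qed

lemma Basis_real_prod: "(Basis :: (real \<times> real) set) = {(1, 0), (0, 1)}"
  by (auto simp: Basis_prod_def)

text \<open>The compact support of \<open>\<phi>\<close> alone removes the boundary terms:
  \<open>\<phi>\<close> times the tensor product is a test function on the plane, and its partial
  derivative integrates to 0. So \<open>b\<close> may be nonzero at y = 0 and y = 1, as the cosine
  will be.\<close>

lemma integral_by_parts_snd:
  fixes a b b' :: "real \<Rightarrow> complex"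
  assumes \<phi>: "\<phi> \<in> test_functions strip" and a: "smooth a" and b: "smooth b"
    and b': "\<And>y. (b has_vector_derivative b' y) (at y)"
  shows "(\<integral>p. partial_deriv (0, 1) \<phi> p * (a (fst p) * b (snd p)) \<partial>lebesgue_on strip)
       = - (\<integral>p. \<phi> p * (a (fst p) * b' (snd p)) \<partial>lebesgue_on strip)"
proof -
  define h where "h = (\<lambda>p. a (fst p) * b (snd p))"
  define h' where "h' = (\<lambda>p. a (fst p) * b' (snd p))"
  note sm = test_functionsD(1)[OF \<phi>]
  have smb': "smooth b'" using smooth_real_iff[OF b'] b by simp
  have sh: "smooth h" "smooth h'" unfolding h_def h'_def
    using a b smb' by (auto intro!: smooth_mult smooth_fst smooth_snd)
  have \<psi>: "(\<lambda>p. \<phi> p * h p) \<in> test_functions UNIV"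
    using \<phi> by (intro test_functionsI[where K = "closure {p. \<phi> p \<noteq> 0}"])
      (use closure_subset[of "{p. \<phi> p \<noteq> 0}"] sh in \<open>auto simp: test_functions_iff\<close>)
  have hd: "(h has_derivative frechet_derivative h (at p)) (at p)" for p
    using C_k_SucD(1)[OF smoothD[OF sh(1)]] .
  have pd: "partial_deriv (0,1) (\<lambda>p. \<phi> p * h p) p = \<phi> p * h' p + partial_deriv (0,1) \<phi> p * h p" for p
  proof -
    have "partial_deriv (0,1) h p = h' p"
      unfolding h_def h'_def using partial_deriv_tensor(2)[OF smooth_has_vector_derivative[OF a] b'] by simp
    then show ?thesis
      using frechet_derivative_at[OF has_derivative_mult[OF C_k_SucD(1)[OF smoothD[OF sm]] hd], of p, symmetric]
      by (simp add: partial_deriv_def)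
  qed
  note cont = continuous_on_partial_deriv[OF sm, of "(0, 1)"]
  let ?K = "closure {p. \<phi> p \<noteq> 0}"
  have K: "compact ?K" "?K \<subseteq> strip" using \<phi> by (auto simp: test_functions_iff)
  have van: "\<phi> p = 0" if "p \<notin> ?K" for p
    using that closure_subset[of "{p. \<phi> p \<noteq> 0}"] by auto
  have int: "integrable lborel f" "(\<integral>p. f p \<partial>lebesgue_on strip) = (\<integral>p. f p \<partial>lborel)"
    if f: "continuous_on UNIV f" "\<And>p. p \<notin> ?K \<Longrightarrow> f p = 0" for f :: "real \<times> real \<Rightarrow> complex"
  proof -
    have "integrable lborel (\<lambda>p. indicator ?K p *\<^sub>R f p)"
      by (intro borel_integrable_compact K continuous_on_subset[OF f(1)]) auto
    moreover have "(\<lambda>p. indicator ?K p *\<^sub>R f p) = f"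
      using f(2) by (auto simp: indicator_def)
    ultimately show i: "integrable lborel f" by simp
    have "(\<integral>p. f p \<partial>lebesgue_on strip) = (\<integral>p. f p \<partial>lebesgue_on UNIV)"
      by (rule integral_lebesgue_on_mono_set) (use f(2) K strip_lebesgue in auto)
    also have "\<dots> = (\<integral>p. f p \<partial>lborel)"
      using borel_measurable_integrable[OF i] by (simp add: lebesgue_on_UNIV_eq integral_completion)
    finally show "(\<integral>p. f p \<partial>lebesgue_on strip) = (\<integral>p. f p \<partial>lborel)" .
  qed
  have 1: "continuous_on UNIV (\<lambda>p. \<phi> p * h' p)" "continuous_on UNIV (\<lambda>p. partial_deriv (0,1) \<phi> p * h p)"
    using smooth_continuous_on[OF sm] smooth_continuous_on[OF sh(1)] smooth_continuous_on[OF sh(2)] cont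
    by (auto intro!: continuous_intros)
  have van': "\<phi> p * h' p = 0" "partial_deriv (0,1) \<phi> p * h p = 0" if "p \<notin> ?K" for p
    using van[OF that] partial_deriv_eq_0[OF that] by simp_all
  have i1: "integrable lborel (\<lambda>p. \<phi> p * h' p)"
      "(\<integral>p. \<phi> p * h' p \<partial>lebesgue_on strip) = (\<integral>p. \<phi> p * h' p \<partial>lborel)"
    by (rule int[OF 1(1)], rule van'(1), assumption)+
  have i2: "integrable lborel (\<lambda>p. partial_deriv (0,1) \<phi> p * h p)"
      "(\<integral>p. partial_deriv (0,1) \<phi> p * h p \<partial>lebesgue_on strip) = (\<integral>p. partial_deriv (0,1) \<phi> p * h p \<partial>lborel)"
    by (rule int[OF 1(2)], rule van'(2), assumption)+
  have "0 = (\<integral>p. \<phi> p * h' p + partial_deriv (0,1) \<phi> p * h p \<partial>lborel)"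
    using integral_partial_deriv_snd[OF \<psi>] unfolding pd by simp
  also have "\<dots> = (\<integral>p. \<phi> p * h' p \<partial>lborel) + (\<integral>p. partial_deriv (0,1) \<phi> p * h p \<partial>lborel)"
    by (rule Bochner_Integration.integral_add[OF i1(1) i2(1)])
  also have "\<dots> = (\<integral>p. \<phi> p * h' p \<partial>lebesgue_on strip) + (\<integral>p. partial_deriv (0,1) \<phi> p * h p \<partial>lebesgue_on strip)"
    by (simp only: i1(2) i2(2))
  finally show ?thesis
    unfolding h_def h'_def by (simp add: eq_neg_iff_add_eq_0 add.commute)
qed

section \<open>Square integrable functions on the strip\<close>

lemma L2_on_subset:
  assumes "u \<in> L2_on T" "S \<subseteq> T" "S \<in> sets lebesgue" "T \<in> sets lebesgue"
  shows "u \<in> L2_on S"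
proof -
  have "lebesgue_on S = restrict_space (lebesgue_on T) S"
    using assms by (subst restrict_restrict_space) (auto simp: Int_absorb1)
  moreover have "S \<in> sets (lebesgue_on T)"
    using assms by (auto simp: sets_restrict_space_iff)
  moreover from this have "S \<inter> space (lebesgue_on T) \<in> sets (lebesgue_on T)" by auto
  ultimately show ?thesis
    using assms(1) integrable_mult_indicator[of S "lebesgue_on T" "\<lambda>x. (norm (u x))\<^sup>2"]
    unfolding L2_on_def by (auto simp: measurable_restrict_space1 integrable_restrict_space)
qed

lemma L2_on_diff:
  assumes "u \<in> L2_on S" "v \<in> L2_on S"
  shows "(\<lambda>x. u x - v x) \<in> L2_on S"
proof -
  have "(norm (a - b))\<^sup>2 \<le> 2 * (norm a)\<^sup>2 + 2 * (norm b)\<^sup>2" for a b :: complex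
  proof -
    have "(norm (a - b))\<^sup>2 \<le> (norm a + norm b)\<^sup>2"
      by (intro power_mono norm_triangle_ineq4) auto
    also have "\<dots> \<le> 2 * (norm a)\<^sup>2 + 2 * (norm b)\<^sup>2"
      by (rule square_sum_le)
    finally show ?thesis .
  qed
  note bd = this
  have [measurable]: "u \<in> borel_measurable (lebesgue_on S)" "v \<in> borel_measurable (lebesgue_on S)"
    and i: "integrable (lebesgue_on S) (\<lambda>x. (norm (u x))\<^sup>2)" "integrable (lebesgue_on S) (\<lambda>x. (norm (v x))\<^sup>2)"
    using assms by (simp_all add: L2_on_def)
  have "integrable (lebesgue_on S) (\<lambda>x. (norm (u x - v x))\<^sup>2)"
  proof (rule Bochner_Integration.integrable_bound[OF Bochner_Integration.integrable_add[OF
          integrable_mult_right[OF i(1), of 2] integrable_mult_right[OF i(2), of 2]]])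
    show "AE x in lebesgue_on S. norm ((norm (u x - v x))\<^sup>2) \<le> norm (2 * (norm (u x))\<^sup>2 + 2 * (norm (v x))\<^sup>2)"
      by (rule AE_I2) (simp add: bd)
  qed measurable
  then show ?thesis by (simp add: L2_on_def)
qed

lemma L2_on_strip_tensor:
  fixes a b :: "real \<Rightarrow> complex"
  assumes a: "continuous_on UNIV a" "\<And>x. \<bar>x\<bar> > r \<Longrightarrow> a x = 0" and b: "continuous_on UNIV b"
  shows "(\<lambda>p. a (fst p) * b (snd p)) \<in> L2_on strip"
proof -
  let ?h = "\<lambda>p. a (fst p) * b (snd p)"
  have c: "continuous_on UNIV ?h"
    by (rule continuous_on_mult; rule continuous_on_compose2[OF a(1)] continuous_on_compose2[OF b])
      (auto intro: continuous_intros)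
  have sub: "slab (r + 1) \<subseteq> cbox (- (r+1), 0) (r+1, 1)" by (auto simp: slab_def)
  have "bounded (?h ` cbox (- (r+1), 0) (r+1, 1))"
    by (intro compact_imp_bounded compact_continuous_image continuous_on_subset[OF c]) auto
  then obtain C where "\<forall>z \<in> ?h ` cbox (- (r+1), 0) (r+1, 1). norm z \<le> C"
    unfolding bounded_iff ..
  then have C: "norm (?h p) \<le> C" if "p \<in> slab (r + 1)" for p
    using sub that by blast
  have "integrable (lebesgue_on (slab (r + 1))) (\<lambda>p. (norm (?h p))\<^sup>2)"
  proof (rule Bochner_Integration.integrable_bound[of _ "\<lambda>_. C\<^sup>2"])
    show "integrable (lebesgue_on (slab (r + 1))) (\<lambda>_. C\<^sup>2)"
      using finite_measure_lebesgue_on[OF slab_lmeasurable] by (rule finite_measure.integrable_const)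
    show "AE p in lebesgue_on (slab (r + 1)). norm ((norm (?h p))\<^sup>2) \<le> norm (C\<^sup>2)"
    proof (rule AE_I2)
      fix p assume "p \<in> space (lebesgue_on (slab (r + 1)))"
      then have "(norm (?h p))\<^sup>2 \<le> C\<^sup>2"
        by (intro power_mono C) (simp_all add: space_restrict_space)
      then show "norm ((norm (?h p))\<^sup>2) \<le> norm (C\<^sup>2)" by simp
    qed
  qed (use continuous_imp_measurable_lebesgue_on[OF c, of "slab (r + 1)"] in measurable)
  then have "integrable (lebesgue_on strip) (\<lambda>p. (norm (?h p))\<^sup>2)"
    using a(2) by (subst (asm) integral_slab_eq_strip(1)) auto
  then show ?thesis
    using continuous_imp_measurable_lebesgue_on[OF c] by (simp add: L2_on_def)
qed

lemma test_function_L2_on: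
  assumes "continuous_on UNIV f" "bounded {p. f p \<noteq> 0}"
  shows "f \<in> L2_on strip"
proof -
  obtain r where r: "\<And>p. f p \<noteq> 0 \<Longrightarrow> norm p \<le> r" using assms(2) by (auto simp: bounded_iff)
  have "integrable lborel (\<lambda>p. indicator (cball 0 r) p *\<^sub>R (norm (f p))\<^sup>2)"
    by (rule borel_integrable_compact) (auto intro!: continuous_intros continuous_on_subset[OF assms(1)])
  moreover have "indicator (cball 0 r) p *\<^sub>R (norm (f p))\<^sup>2 = (norm (f p))\<^sup>2" for p
    using r[of p] by (cases "f p = 0") (auto simp: indicator_def)
  then have "(\<lambda>p. indicator (cball 0 r) p *\<^sub>R (norm (f p))\<^sup>2) = (\<lambda>p. (norm (f p))\<^sup>2)" by blast
  ultimately have "integrable lebesgue (\<lambda>p. (norm (f p))\<^sup>2)"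
    by (simp add: integrable_completion borel_measurable_integrable)
  then have "f \<in> L2_on UNIV"
    using continuous_imp_measurable_lebesgue_on[OF assms(1), of UNIV] by (simp add: L2_on_def lebesgue_on_UNIV_eq)
  then show ?thesis by (rule L2_on_subset) (auto simp: strip_lebesgue)
qed


text \<open>The equation is tested with \<open>\<psi>\<close>(x) times a cut-off sine, and the
  cutoff is removed in the limit. Three facts combine: the limit equation in terms of the weak
  gradient (\<open>A\<close>), integration by parts in x (\<open>Bx\<close>), and integration by
  parts in y against a cosine (\<open>Cy\<close>), which is where the boundary condition is
  needed.\<close>

lemma weak_mode_equation:
  fixes \<psi> \<psi>' \<psi>'' :: "real \<Rightarrow> complex" and m :: nat
  assumes sol: "weak_solution k V u"
    and Vm: "V \<in> borel_measurable (lebesgue_on strip)" and VB: "AE p in lebesgue_on strip. norm (V p) \<le> B"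
    and \<psi>: "smooth \<psi>" "\<And>x. \<bar>x\<bar> > r \<Longrightarrow> \<psi> x = 0" "r > 0"
    and \<psi>': "\<And>x. (\<psi> has_vector_derivative \<psi>' x) (at x)"
    and \<psi>'': "\<And>x. (\<psi>' has_vector_derivative \<psi>'' x) (at x)"
  defines "s \<equiv> \<lambda>y. complex_of_real (sin (real m * pi * y))"
  shows "(\<integral>p. u p * \<psi>'' (fst p) * s (snd p) \<partial>lebesgue_on strip)
     + of_real (k - (real m * pi)\<^sup>2) * (\<integral>p. u p * \<psi> (fst p) * s (snd p) \<partial>lebesgue_on strip)
     = - (\<integral>p. V p * u p * \<psi> (fst p) * s (snd p) \<partial>lebesgue_on strip)"
proof -
  let ?M = "lebesgue_on strip"
  define R where "R = r + 2"
  have rR: "r < R" "r + 1 < R" "R > 0" using \<psi>(3) by (auto simp: R_def)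
  obtain g where H: "\<And>R. R > 0 \<Longrightarrow> H1_grad (slab R) u g" and
    W: "\<And>\<phi>. \<phi> \<in> test_functions strip \<Longrightarrow> (\<integral>p. (\<Sum>b\<in>Basis. g b p * partial_deriv b \<phi> p) \<partial>?M) =
           (\<integral>p. (of_real k + V p) * u p * \<phi> p \<partial>?M)"
    using sol unfolding weak_solution_def by blast
  define gx where "gx = g (1, 0)"
  define gy where "gy = g (0, 1)"
  have u2: "u \<in> L2_on (slab R)" and g2: "gx \<in> L2_on (slab R)" "gy \<in> L2_on (slab R)"
    using H[OF rR(3)] by (auto simp: H1_grad_def Basis_real_prod gx_def gy_def)
  have Hx: "(\<integral>p. u p * partial_deriv (1, 0) \<phi> p \<partial>lebesgue_on (slab R)) = - (\<integral>p. gx p * \<phi> p \<partial>lebesgue_on (slab R))"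
    and Hy: "(\<integral>p. u p * partial_deriv (0, 1) \<phi> p \<partial>lebesgue_on (slab R)) = - (\<integral>p. gy p * \<phi> p \<partial>lebesgue_on (slab R))"
    if "\<phi> \<in> test_functions (slab R)" for \<phi>
    using H[OF rR(3)] that by (auto simp: H1_grad_def Basis_real_prod gx_def gy_def)
  have sm': "smooth \<psi>'" "smooth \<psi>''"
    using smooth_real_iff[OF \<psi>'] smooth_real_iff[OF \<psi>''] \<psi>(1) by auto
  note cont\<psi> = smooth_continuous_on[OF \<psi>(1)] smooth_continuous_on[OF sm'(1)] smooth_continuous_on[OF sm'(2)]
  have van': "\<psi>' x = 0" if "\<bar>x\<bar> > r" for x by (rule has_vector_derivative_vanishing[OF \<psi>' \<psi>(2) that])
  have van'': "\<psi>'' x = 0" if "\<bar>x\<bar> > r" for x by (rule has_vector_derivative_vanishing[OF \<psi>'' van' that])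
  define c where "c = (\<lambda>y. complex_of_real (real m * pi * cos (real m * pi * y)))"
  have s': "(s has_vector_derivative c y) (at y)" for y
    unfolding s_def c_def
    by (rule smooth_of_real_has_derivative) (auto intro!: derivative_eq_intros)
  have c': "(c has_vector_derivative - of_real ((real m * pi)\<^sup>2) * s y) (at y)" for y
  proof -
    have "(c has_vector_derivative of_real (- ((real m * pi)\<^sup>2 * sin (real m * pi * y)))) (at y)"
      unfolding c_def
      by (rule smooth_of_real_has_derivative) (auto intro!: derivative_eq_intros simp: power2_eq_square)
    then show ?thesis by (simp add: s_def)
  qed
  have sms: "smooth s" unfolding s_def by (rule smooth_sin)
  have smc: "smooth c" using smooth_real_iff[OF s'] sms by blast
  note conts = smooth_continuous_on[OF sms] smooth_continuous_on[OF smc]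
  define \<eta> where "\<eta> = (\<lambda>n y. complex_of_real (cutoff n y))"
  define d\<eta> where "d\<eta> = (\<lambda>n y. complex_of_real (dcutoff n y))"
  have \<eta>': "(\<eta> n has_vector_derivative d\<eta> n y) (at y)" for n y
    unfolding \<eta>_def d\<eta>_def by (rule smooth_of_real_has_derivative[OF cutoff_has_derivative])
  have sm\<eta>: "smooth (\<eta> n)" for n unfolding \<eta>_def by (rule smooth_cutoff)
  have smd\<eta>: "smooth (d\<eta> n)" for n using smooth_real_iff[OF \<eta>'] sm\<eta> by blast
  note cont\<eta> = smooth_continuous_on[OF sm\<eta>] smooth_continuous_on[OF smd\<eta>]
  have \<eta>1: "norm (\<eta> n y) \<le> 1" for n y using abs_cutoff_le by (simp add: \<eta>_def)
  have s1: "norm (s y) \<le> 1" for y by (simp add: s_def)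
  have c1: "norm (c y) \<le> real m * pi" for y
    using abs_cos_le_one[of "real m * pi * y"] by (simp add: c_def norm_mult abs_mult mult_left_le)
  have \<eta>_lim: "(\<lambda>n. \<eta> n y) \<longlonglongrightarrow> 1" "(\<lambda>n. d\<eta> n y) \<longlonglongrightarrow> 0" if "0 < y" "y < 1" for y
    using eventually_cutoff[OF that] unfolding \<eta>_def d\<eta>_def
    by (auto intro!: tendsto_eventually elim: eventually_mono)
  have \<eta>0: "\<eta> n y = 0" if "y \<notin> {1 / (real n + 1)..1 - 1 / (real n + 1)}" for n y
    using cutoff_eq_0[OF that] by (simp add: \<eta>_def)
  have \<eta>pos: "0 < 1 / (real n + 1)" "1 - 1 / (real n + 1) < 1" for n by auto
  have lim\<eta>: "(\<lambda>n. \<integral>p. w p * (\<eta> n (snd p) * q (snd p)) \<partial>?M) \<longlonglongrightarrow> (\<integral>p. w p * q (snd p) \<partial>?M)"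
    if w: "integrable ?M w" and q: "continuous_on UNIV q" "\<And>y. norm (q y) \<le> C" for w :: "real \<times> real \<Rightarrow> complex" and q C
  proof (rule integral_strip_tendsto[OF w _ _ _ q(1), where C = C])
    show "continuous_on UNIV (\<lambda>y. \<eta> n y * q y)" for n by (intro continuous_intros cont\<eta> q)
    show "norm (\<eta> n y * q y) \<le> C" for n y
      using mult_mono[OF \<eta>1[of n y] q(2)[of y]] by (simp add: norm_mult)
    show "(\<lambda>n. \<eta> n y * q y) \<longlonglongrightarrow> q y" if "0 < y" "y < 1" for y
      using tendsto_mult[OF \<eta>_lim(1)[OF that] tendsto_const[of "q y"]] by simp
  qed
  have tens: "(\<lambda>p. a (fst p) * (\<eta> n (snd p) * q (snd p))) \<in> test_functions (slab R)"
    "(\<lambda>p. a (fst p) * (\<eta> n (snd p) * q (snd p))) \<in> test_functions strip"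
    if a: "smooth a" "\<And>x. \<bar>x\<bar> > r \<Longrightarrow> a x = 0" and q: "smooth q" for a q n
    by (rule tensor_test_function[OF a(1) smooth_mult[OF sm\<eta> q] a(2) rR(1) _ \<eta>pos]; use \<eta>0 in auto)+
  have \<eta>q': "((\<lambda>y. \<eta> n y * q y) has_vector_derivative \<eta> n y * q' + d\<eta> n y * q y) (at y)"
    if "(q has_vector_derivative q') (at y)" for q q' n y
    by (rule has_vector_derivative_mult[OF \<eta>' that])
  have iw: "integrable ?M (\<lambda>p. w p * a (fst p))"
    if "w \<in> L2_on (slab R)" "continuous_on UNIV a" "\<And>x. \<bar>x\<bar> > r \<Longrightarrow> a x = 0" for w a
    using that by (rule integrable_strip_mult_fst[OF _ _ _ rR(1)])
  have isnd: "integrable ?M (\<lambda>p. w p * q (snd p))"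
    if "integrable ?M w" "continuous_on UNIV q" "\<And>y. norm (q y) \<le> C" for w :: "real \<times> real \<Rightarrow> complex" and q C
    by (rule integrable_bounded_mult[OF that(1), where C = C])
      (auto intro!: that(3) continuous_imp_measurable_lebesgue_on continuous_on_compose2[OF that(2)] continuous_intros)

  obtain D where D: "\<And>n y. \<bar>dcutoff n y * sin (real m * pi * y)\<bar> \<le> D"
    by (rule dcutoff_sin_bounded[of m]) blast
  have d\<eta>s: "norm (d\<eta> n y * s y) \<le> D" for n y
    using D[of n y] by (simp add: d\<eta>_def s_def norm_mult abs_mult)
  have \<eta>c: "norm (\<eta> n y * c y) \<le> real m * pi" for n y
    using mult_mono[OF \<eta>1[of n y] c1[of y]] by (simp add: norm_mult)
  have q: "norm (\<eta> n y * c y + d\<eta> n y * s y) \<le> real m * pi + D" for n y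
    using norm_triangle_ineq[of "\<eta> n y * c y" "d\<eta> n y * s y"] d\<eta>s[of n y] \<eta>c[of n y] by linarith

  define Iu where "Iu = (\<integral>p. u p * \<psi> (fst p) * s (snd p) \<partial>?M)"
  have iu: "integrable ?M (\<lambda>p. u p * \<psi> (fst p))" by (rule iw[OF u2 cont\<psi>(1) \<psi>(2)])
  have iV: "integrable ?M (\<lambda>p. V p * u p * \<psi> (fst p))"
  proof (rule Bochner_Integration.integrable_bound[of _ "\<lambda>p. B * norm (u p * \<psi> (fst p))"])
    show "integrable ?M (\<lambda>p. B * norm (u p * \<psi> (fst p)))" using iu by simp
    show "(\<lambda>p. V p * u p * \<psi> (fst p)) \<in> borel_measurable ?M"
      using borel_measurable_times[OF Vm borel_measurable_integrable[OF iu]] by (simp add: mult.assoc)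
    show "AE p in ?M. norm (V p * u p * \<psi> (fst p)) \<le> norm (B * norm (u p * \<psi> (fst p)))"
      using VB
    proof eventually_elim
      case (elim p)
      have "norm (V p) * norm (u p * \<psi> (fst p)) \<le> \<bar>B\<bar> * norm (u p * \<psi> (fst p))"
        using elim by (intro mult_right_mono) auto
      then show ?case by (simp add: norm_mult abs_mult mult.assoc)
    qed
  qed
  \<comment> \<open>The derivative of the cutoff is of size n, but multiplied by the sine it stays
    below \<open>D\<close> and tends to 0 pointwise, so its contribution disappears by dominated
    convergence.\<close>
  have A: "(\<integral>p. gx p * \<psi>' (fst p) * s (snd p) \<partial>?M) + (\<integral>p. gy p * \<psi> (fst p) * c (snd p) \<partial>?M)
      = of_real k * Iu + (\<integral>p. V p * u p * \<psi> (fst p) * s (snd p) \<partial>?M)"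
  proof -
    have 1: "integrable ?M (\<lambda>p. gx p * \<psi>' (fst p))" by (rule iw[OF g2(1) cont\<psi>(2) van'])
    have 2: "integrable ?M (\<lambda>p. gy p * \<psi> (fst p))" by (rule iw[OF g2(2) cont\<psi>(1) \<psi>(2)])
    have eq: "(\<integral>p. gx p * \<psi>' (fst p) * (\<eta> n (snd p) * s (snd p)) \<partial>?M) +
       (\<integral>p. gy p * \<psi> (fst p) * (\<eta> n (snd p) * c (snd p) + d\<eta> n (snd p) * s (snd p)) \<partial>?M)
       = of_real k * (\<integral>p. u p * \<psi> (fst p) * (\<eta> n (snd p) * s (snd p)) \<partial>?M)
        + (\<integral>p. V p * u p * \<psi> (fst p) * (\<eta> n (snd p) * s (snd p)) \<partial>?M)" (is "?A + ?B = _ * ?C + ?D") for n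
    proof -
      have \<eta>s: "norm (\<eta> n y * s y) \<le> 1" for y
        using mult_mono[OF \<eta>1[of n y] s1[of y]] by (simp add: norm_mult)
      have c1: "continuous_on UNIV (\<lambda>y. \<eta> n y * s y)"
        and c2: "continuous_on UNIV (\<lambda>y. \<eta> n y * c y + d\<eta> n y * s y)"
        by (intro continuous_intros cont\<eta> conts)+
      let ?\<phi> = "\<lambda>p. \<psi> (fst p) * (\<eta> n (snd p) * s (snd p))"
      have p: "partial_deriv (1, 0) ?\<phi> p = \<psi>' (fst p) * (\<eta> n (snd p) * s (snd p))"
         "partial_deriv (0, 1) ?\<phi> p = \<psi> (fst p) * (\<eta> n (snd p) * c (snd p) + d\<eta> n (snd p) * s (snd p))" for p
        using partial_deriv_tensor[where p = p, OF \<psi>' \<eta>q'[where n = n, OF s']] by auto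
      have "?A + ?B = (\<integral>p. gx p * \<psi>' (fst p) * (\<eta> n (snd p) * s (snd p)) +
          gy p * \<psi> (fst p) * (\<eta> n (snd p) * c (snd p) + d\<eta> n (snd p) * s (snd p)) \<partial>?M)"
        by (rule Bochner_Integration.integral_add[OF isnd[OF 1 c1 \<eta>s] isnd[OF 2 c2 q], symmetric])
      also have "\<dots> = (\<integral>p. (\<Sum>b\<in>Basis. g b p * partial_deriv b ?\<phi> p) \<partial>?M)"
        by (simp add: Basis_real_prod p gx_def gy_def mult.assoc)
      also have "\<dots> = (\<integral>p. (of_real k + V p) * u p * ?\<phi> p \<partial>?M)"
        by (rule W[OF tens(2)[OF \<psi>(1,2) sms]])
      also have "\<dots> = (\<integral>p. of_real k * (u p * \<psi> (fst p) * (\<eta> n (snd p) * s (snd p))) +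
           V p * u p * \<psi> (fst p) * (\<eta> n (snd p) * s (snd p)) \<partial>?M)"
        by (simp add: algebra_simps)
      also have "\<dots> = (\<integral>p. of_real k * (u p * \<psi> (fst p) * (\<eta> n (snd p) * s (snd p))) \<partial>?M) + ?D"
        by (rule Bochner_Integration.integral_add[OF integrable_mult_right[OF isnd[OF iu c1 \<eta>s]] isnd[OF iV c1 \<eta>s]])
      also have "\<dots> = of_real k * ?C + ?D" by simp
      finally show ?thesis .
    qed
    have L: "(\<lambda>n. (\<integral>p. gx p * \<psi>' (fst p) * (\<eta> n (snd p) * s (snd p)) \<partial>?M) +
       (\<integral>p. gy p * \<psi> (fst p) * (\<eta> n (snd p) * c (snd p) + d\<eta> n (snd p) * s (snd p)) \<partial>?M)) \<longlonglongrightarrow>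
       (\<integral>p. gx p * \<psi>' (fst p) * s (snd p) \<partial>?M) + (\<integral>p. gy p * \<psi> (fst p) * c (snd p) \<partial>?M)"
    proof (intro tendsto_add lim\<eta>[OF 1 conts(1) s1] integral_strip_tendsto[OF 2 _ q _ conts(2)])
      show "continuous_on UNIV (\<lambda>y. \<eta> n y * c y + d\<eta> n y * s y)" for n
        by (intro continuous_intros cont\<eta> conts)
      show "(\<lambda>n. \<eta> n y * c y + d\<eta> n y * s y) \<longlonglongrightarrow> c y" if "0 < y" "y < 1" for y
        using tendsto_add[OF tendsto_mult[OF \<eta>_lim(1)[OF that] tendsto_const[of "c y"]]
          tendsto_mult[OF \<eta>_lim(2)[OF that] tendsto_const[of "s y"]]] by simp
    qed
    show ?thesis
      using LIMSEQ_unique[OF L[unfolded eq] tendsto_add[OF tendsto_mult[OF tendsto_const lim\<eta>[OF iu conts(1) s1]]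
        lim\<eta>[OF iV conts(1) s1]]] by (simp add: Iu_def)
  qed

  \<comment> \<open>The cut-off sine does not depend on x, so the definition of the weak derivative
    \<open>gx\<close> moves one x-derivative onto \<open>\<psi>'\<close> before the cutoff is
    removed.\<close>
  have Bx: "(\<integral>p. u p * \<psi>'' (fst p) * s (snd p) \<partial>?M) = - (\<integral>p. gx p * \<psi>' (fst p) * s (snd p) \<partial>?M)"
  proof -
    have "(\<integral>p. u p * \<psi>'' (fst p) * (\<eta> n (snd p) * s (snd p)) \<partial>?M)
       = - (\<integral>p. gx p * \<psi>' (fst p) * (\<eta> n (snd p) * s (snd p)) \<partial>?M)" for n
    proof -
      let ?\<phi> = "\<lambda>p. \<psi>' (fst p) * (\<eta> n (snd p) * s (snd p))"
      have p: "partial_deriv (1, 0) ?\<phi> p = \<psi>'' (fst p) * (\<eta> n (snd p) * s (snd p))" for p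
        using partial_deriv_tensor(1)[where p = p, OF \<psi>'' \<eta>q'[where n = n, OF s']] by auto
      have "(\<integral>p. u p * (\<psi>'' (fst p) * (\<eta> n (snd p) * s (snd p))) \<partial>lebesgue_on (slab R))
        = - (\<integral>p. gx p * ?\<phi> p \<partial>lebesgue_on (slab R))"
        using Hx[OF tens(1)[OF sm'(1) van' sms], of n] unfolding p .
      also have "(\<integral>p. u p * (\<psi>'' (fst p) * (\<eta> n (snd p) * s (snd p))) \<partial>lebesgue_on (slab R)) =
         (\<integral>p. u p * (\<psi>'' (fst p) * (\<eta> n (snd p) * s (snd p))) \<partial>?M)"
        by (rule integral_slab_eq_strip) (use rR van'' in auto)
      also have "(\<integral>p. gx p * ?\<phi> p \<partial>lebesgue_on (slab R)) = (\<integral>p. gx p * ?\<phi> p \<partial>?M)"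
        by (rule integral_slab_eq_strip) (use rR van' in auto)
      finally show ?thesis by (simp add: mult.assoc)
    qed
    from LIMSEQ_unique[OF lim\<eta>[OF iw[OF u2 cont\<psi>(3) van''] conts(1) s1, unfolded this]
        tendsto_minus[OF lim\<eta>[OF iw[OF g2(1) cont\<psi>(2) van'] conts(1) s1]]]
    show ?thesis .
  qed

  \<comment> \<open>A cutoff cannot be removed from this integration by parts, since its derivative
    times the cosine \<open>c\<close> is not bounded in n. Instead \<open>u\<close> is replaced by
    test functions of the strip, for which no boundary term arises.\<close>
  have Cy: "(\<integral>p. gy p * \<psi> (fst p) * c (snd p) \<partial>?M) = of_real ((real m * pi)\<^sup>2) * Iu"
  proof -
    \<comment> \<open>\<open>\<omega>\<close> is 1 on the support of \<open>\<psi>\<close>, so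
      \<open>\<omega>\<close> u may stand for u wherever \<open>\<psi>\<close> is a factor, and it
      lies in \<open>H1_zero_on strip\<close>.\<close>
    define \<omega> where "\<omega> = (\<lambda>x. complex_of_real (plateau r x))"
    have \<omega>0: "\<omega> x = 0" if "\<bar>x\<bar> > r + 1" for x using plateau_eq_0[OF that] by (simp add: \<omega>_def)
    have \<omega>\<psi>: "\<omega> x * \<psi> x = \<psi> x" for x
      using plateau_eq_1[of x r] \<psi>(2)[of x] by (cases "\<bar>x\<bar> \<le> r") (auto simp: \<omega>_def)
    have "smooth \<omega>" unfolding \<omega>_def by (rule smooth_plateau)
    then have "\<omega> \<in> test_functions UNIV"
      by (rule test_functionsI[where K = "{-(r+1)..r+1}"]) (use \<omega>0 in auto)
    then have "(\<lambda>(x, y). \<omega> x * u (x, y)) \<in> H1_zero_on strip"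
      using sol unfolding weak_solution_def by blast
    moreover define v where "v = (\<lambda>p. \<omega> (fst p) * u p)"
    moreover have "(\<lambda>(x, y). \<omega> x * u (x, y)) = v" by (auto simp: v_def)
    ultimately obtain G \<phi> where G: "H1_grad strip v G" and \<phi>: "\<And>n::nat. \<phi> n \<in> test_functions strip"
      and l1: "(\<lambda>n. \<integral>x. (norm (\<phi> n x - v x))\<^sup>2 \<partial>?M) \<longlonglongrightarrow> 0"
      and l2: "\<forall>b\<in>Basis. (\<lambda>n. \<integral>x. (norm (partial_deriv b (\<phi> n) x - G b x))\<^sup>2 \<partial>?M) \<longlonglongrightarrow> 0"
      unfolding H1_zero_on_def by auto
    define Gy where "Gy = G (0, 1)"
    have v2: "v \<in> L2_on strip" and Gy2: "Gy \<in> L2_on strip"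
      using G by (auto simp: H1_grad_def Basis_real_prod Gy_def)
    have Gyw: "(\<integral>p. v p * partial_deriv (0, 1) \<phi> p \<partial>?M) = - (\<integral>p. Gy p * \<phi> p \<partial>?M)"
      if "\<phi> \<in> test_functions strip" for \<phi>
      using G that by (auto simp: H1_grad_def Basis_real_prod Gy_def)
    have l3: "(\<lambda>n. \<integral>x. (norm (partial_deriv (0, 1) (\<phi> n) x - Gy x))\<^sup>2 \<partial>?M) \<longlonglongrightarrow> 0"
      using l2 by (auto simp: Basis_real_prod Gy_def)
    have Gy2': "Gy \<in> L2_on (slab R)"
      by (rule L2_on_subset[OF Gy2 slab_subset_strip fmeasurableD[OF slab_lmeasurable] strip_lebesgue])
    \<comment> \<open>Exact for each approximating \<open>\<phi> n\<close>, with c' = -(m pi)^2 s;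
      both sides pass to the limit because \<open>\<phi> n\<close> and its y-derivative converge in
      L^2.\<close>
    have step1: "(\<integral>p. Gy p * (\<psi> (fst p) * c (snd p)) \<partial>?M)
        = - (\<integral>p. v p * (\<psi> (fst p) * (- of_real ((real m * pi)\<^sup>2) * s (snd p))) \<partial>?M)"
    proof -
      have p1: "\<phi> n \<in> L2_on strip" for n
        using test_functionsD(1,3)[OF \<phi>] smooth_continuous_on by (blast intro: test_function_L2_on)
      have d1: "(\<lambda>p. \<phi> n p - v p) \<in> L2_on strip" and m1: "\<phi> n \<in> borel_measurable ?M" for n
        using L2_on_diff[OF p1 v2] p1[of n] by (simp_all add: L2_on_def)
      have p2: "partial_deriv (0, 1) (\<phi> n) \<in> L2_on strip" for n
      proof (rule test_function_L2_on)
        show "continuous_on UNIV (partial_deriv (0, 1) (\<phi> n))"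
          by (rule continuous_on_partial_deriv[OF test_functionsD(1)[OF \<phi>]])
        have "{p. partial_deriv (0, 1) (\<phi> n) p \<noteq> 0} \<subseteq> closure {p. \<phi> n p \<noteq> 0}"
          using partial_deriv_eq_0 by blast
        then show "bounded {p. partial_deriv (0, 1) (\<phi> n) p \<noteq> 0}"
          using \<phi>[of n] by (auto simp: test_functions_iff intro: bounded_subset compact_imp_bounded)
      qed
      have d2: "(\<lambda>p. partial_deriv (0, 1) (\<phi> n) p - Gy p) \<in> L2_on strip"
        and m2: "partial_deriv (0, 1) (\<phi> n) \<in> borel_measurable ?M" for n
        using L2_on_diff[OF p2 Gy2] p2[of n] by (simp_all add: L2_on_def)
      let ?h = "\<lambda>p. \<psi> (fst p) * c (snd p)"
      let ?h' = "\<lambda>p. \<psi> (fst p) * (- of_real ((real m * pi)\<^sup>2) * s (snd p))"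
      have h2: "?h \<in> L2_on strip" by (rule L2_on_strip_tensor[OF cont\<psi>(1) \<psi>(2) conts(2)])
      have "continuous_on UNIV (\<lambda>y. - of_real ((real m * pi)\<^sup>2) * s y)"
        by (intro continuous_intros conts)
      from L2_on_strip_tensor[OF cont\<psi>(1) \<psi>(2) this] have h2': "?h' \<in> L2_on strip" .
      have L1: "(\<lambda>n. \<integral>p. partial_deriv (0, 1) (\<phi> n) p * ?h p \<partial>?M) \<longlonglongrightarrow> (\<integral>p. Gy p * ?h p \<partial>?M)"
        by (rule tendsto_integral_mult_L2[OF _ _ _ _ _ _ l3]) (use d2 m2 Gy2 h2 in \<open>simp_all add: L2_on_def\<close>)
      have L2: "(\<lambda>n. \<integral>p. \<phi> n p * ?h' p \<partial>?M) \<longlonglongrightarrow> (\<integral>p. v p * ?h' p \<partial>?M)"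
        by (rule tendsto_integral_mult_L2[OF _ _ _ _ _ _ l1]) (use d1 m1 v2 h2' in \<open>simp_all add: L2_on_def\<close>)
      have eq: "(\<integral>p. partial_deriv (0, 1) (\<phi> n) p * ?h p \<partial>?M) = - (\<integral>p. \<phi> n p * ?h' p \<partial>?M)" for n
        by (rule integral_by_parts_snd[OF \<phi> \<psi>(1) smc c'])
      show ?thesis
        by (rule LIMSEQ_unique[OF L1[unfolded eq] tendsto_minus[OF L2]])
    qed
    \<comment> \<open>\<open>Gy\<close> and \<open>gy\<close> are weak derivatives of two functions,
      v on the strip and u on the slab, which agree where \<open>\<psi>\<close> is nonzero. For
      fixed n the cut-off cosine is legitimate in both definitions, and the large derivative of the
      cutoff occurs equally on both sides.\<close>
    have step2: "(\<integral>p. Gy p * \<psi> (fst p) * (\<eta> n (snd p) * c (snd p)) \<partial>?M)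
        = (\<integral>p. gy p * \<psi> (fst p) * (\<eta> n (snd p) * c (snd p)) \<partial>?M)" for n
    proof -
      let ?q = "\<lambda>y. \<eta> n y * c y"
      let ?q' = "\<lambda>y. \<eta> n y * (- of_real ((real m * pi)\<^sup>2) * s y) + d\<eta> n y * c y"
      have p: "partial_deriv (0, 1) (\<lambda>p. \<psi> (fst p) * ?q (snd p)) p = \<psi> (fst p) * ?q' (snd p)" for p
        using partial_deriv_tensor(2)[where p = p, OF \<psi>' \<eta>q'[where n = n, OF c']] by auto
      have t: "(\<lambda>p. \<psi> (fst p) * ?q (snd p)) \<in> test_functions strip"
          "(\<lambda>p. \<psi> (fst p) * ?q (snd p)) \<in> test_functions (slab R)"
        using tens[OF \<psi>(1,2) smc] by auto
      have "(\<integral>p. Gy p * (\<psi> (fst p) * ?q (snd p)) \<partial>?M) = - (\<integral>p. v p * (\<psi> (fst p) * ?q' (snd p)) \<partial>?M)"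
        using Gyw[OF t(1)] unfolding p by simp
      also have "\<dots> = - (\<integral>p. u p * (\<psi> (fst p) * ?q' (snd p)) \<partial>?M)"
      proof -
        have "v p * (\<psi> (fst p) * z) = u p * (\<psi> (fst p) * z)" for p z
          using \<omega>\<psi>[of "fst p"] by (simp add: v_def algebra_simps)
        then show ?thesis by (simp only:)
      qed
      also have "\<dots> = - (\<integral>p. u p * (\<psi> (fst p) * ?q' (snd p)) \<partial>lebesgue_on (slab R))"
        by (subst integral_slab_eq_strip(2)) (use rR \<psi>(2) in auto)
      also have "\<dots> = (\<integral>p. gy p * (\<psi> (fst p) * ?q (snd p)) \<partial>lebesgue_on (slab R))"
        using Hy[OF t(2)] unfolding p by simp
      also have "\<dots> = (\<integral>p. gy p * (\<psi> (fst p) * ?q (snd p)) \<partial>?M)"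
        by (rule integral_slab_eq_strip(2)) (use rR \<psi>(2) in auto)
      finally show ?thesis by (simp add: mult.assoc)
    qed
    have e1: "(\<integral>p. Gy p * \<psi> (fst p) * c (snd p) \<partial>?M) = (\<integral>p. gy p * \<psi> (fst p) * c (snd p) \<partial>?M)"
      using LIMSEQ_unique[OF lim\<eta>[OF iw[OF Gy2' cont\<psi>(1) \<psi>(2)] conts(2) c1, unfolded step2]
        lim\<eta>[OF iw[OF g2(2) cont\<psi>(1) \<psi>(2)] conts(2) c1]] .
    have e2: "v p * (\<psi> (fst p) * (- of_real ((real m * pi)\<^sup>2) * s (snd p)))
        = - of_real ((real m * pi)\<^sup>2) * (u p * \<psi> (fst p) * s (snd p))" for p
      using \<omega>\<psi>[of "fst p"] by (auto simp: v_def algebra_simps)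
    have "(\<integral>p. Gy p * \<psi> (fst p) * c (snd p) \<partial>?M)
        = - (\<integral>p. - of_real ((real m * pi)\<^sup>2) * (u p * \<psi> (fst p) * s (snd p)) \<partial>?M)"
      using step1 unfolding e2 by (simp only: mult.assoc)
    also have "\<dots> = of_real ((real m * pi)\<^sup>2) * Iu"
      by (simp only: integral_mult_right_zero Iu_def minus_mult_left minus_minus)
    finally show ?thesis unfolding e1 .
  qed
  show ?thesis
    using A Bx Cy unfolding Iu_def[symmetric] by (simp add: algebra_simps)
qed

section \<open>The fundamental lemma of the calculus of variations on the line\<close>

lemma integrable_mult_compact_support:
  fixes u a :: "real \<Rightarrow> complex"
  assumes u: "\<And>R. set_integrable lborel {-R..R} u"
    and a: "continuous_on UNIV a" "\<And>x. \<bar>x\<bar> > r \<Longrightarrow> a x = 0"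
  shows "integrable lborel (\<lambda>x. u x * a x)"
proof -
  obtain C where C: "\<And>x. norm (a x) \<le> C" using compact_support_bounded[OF a] by blast
  have "integrable lborel (\<lambda>x. (indicator {-r..r} x *\<^sub>R u x) * a x)"
    using u[of r] C borel_measurable_continuous_onI[OF a(1)]
    by (intro integrable_bounded_mult[where C = C]) (auto simp: set_integrable_def)
  moreover have "(indicator {-r..r} x *\<^sub>R u x) * a x = u x * a x" for x
    using a(2)[of x] by (cases "\<bar>x\<bar> > r") (auto simp: indicator_def)
  ultimately show ?thesis by (simp only:)
qed

text \<open>Open intervals form an intersection-stable generator of the Borel sets, so the integrals
  over all Borel sets vanish by induction over the generated sigma-algebra.\<close>

lemma AE_zero_of_interval_integrals:
  fixes h :: "real \<Rightarrow> complex"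
  assumes h: "integrable lborel h"
    and zero: "\<And>a b. (\<integral>x. indicator {a<..<b} x *\<^sub>R h x \<partial>lborel) = 0"
  shows "AE x in lborel. h x = 0"
proof (rule sigma_finite_measure.density_zero[OF sigma_finite_lborel h])
  fix A :: "real set" assume "A \<in> sets lborel"
  have si: "set_integrable lborel B h" if "B \<in> sets borel" for B
    using integrable_mult_indicator[OF _ h, of B] that by (simp add: set_integrable_def)
  \<comment> \<open>Needed for complements: the integral over the whole line is the limit of the
    integrals over (-n, n).\<close>
  have whole: "(\<integral>x. h x \<partial>lborel) = 0"
  proof -
    have "(\<lambda>n. \<integral>x. indicator {- real n<..<real n} x *\<^sub>R h x \<partial>lborel) \<longlonglongrightarrow> (\<integral>x. h x \<partial>lborel)"
    proof (rule integral_dominated_convergence[where w = "\<lambda>x. norm (h x)"])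
      show "AE x in lborel. (\<lambda>n. indicator {- real n<..<real n} x *\<^sub>R h x) \<longlonglongrightarrow> h x"
      proof (rule AE_I2, rule tendsto_eventually)
        fix x :: real
        obtain N :: nat where "\<bar>x\<bar> < real N" using reals_Archimedean2 by blast
        then show "\<forall>\<^sub>F n in sequentially. indicator {- real n<..<real n} x *\<^sub>R h x = h x"
          by (intro eventually_sequentiallyI[of N]) (auto simp: indicator_def)
      qed
      show "AE x in lborel. norm (indicator {- real n<..<real n} x *\<^sub>R h x) \<le> norm (h x)" for n
        by (rule AE_I2) (auto simp: indicator_def)
    qed (use h in auto)
    then show ?thesis by (simp add: zero LIMSEQ_const_iff)
  qed
  have st: "Int_stable (range (\<lambda>(a, b). box a b :: real set))"
    by (auto simp: Int_stable_def box_Int_box)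
  have A: "A \<in> sigma_sets UNIV (range (\<lambda>(a, b). box a b :: real set))"
    using \<open>A \<in> sets lborel\<close> by (simp add: borel_eq_box)
  have "range (\<lambda>(a, b). box a b :: real set) \<subseteq> Pow UNIV" by simp
  note sub = this
  from st sub A show "set_lebesgue_integral lborel A h = 0"
  proof (induction rule: sigma_sets_induct_disjoint)
    case (compl A)
    then have A: "A \<in> sets borel" by (simp add: borel_eq_box)
    have "set_lebesgue_integral lborel (A \<union> (UNIV - A)) h =
       set_lebesgue_integral lborel A h + set_lebesgue_integral lborel (UNIV - A) h"
      using A by (intro set_integral_Un si) auto
    then show ?case using compl whole by (simp add: set_lebesgue_integral_def)
  next
    case (union A)
    then have A: "A i \<in> sets borel" for i by (auto simp: borel_eq_box)
    have "set_lebesgue_integral lborel (\<Union>i. A i) h = (\<Sum>i. set_lebesgue_integral lborel (A i) h)"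
      using union(1) A by (intro lebesgue_integral_countable_add si) (auto simp: disjoint_family_on_def)
    then show ?case using union by simp
  qed (use zero in \<open>auto simp: set_lebesgue_integral_def box_real\<close>)
qed

text \<open>Smooth functions bounded by 1 converge pointwise to the indicator of any open interval,
  which reduces the claim to interval integrals.\<close>

lemma AE_zero_of_test_integrals:
  fixes z :: "real \<Rightarrow> complex"
  assumes z: "\<And>R. set_integrable lborel {-R..R} z"
    and zero: "\<And>\<psi> r. smooth \<psi> \<Longrightarrow> r > 0 \<Longrightarrow> (\<And>x. \<bar>x\<bar> > r \<Longrightarrow> \<psi> x = 0) \<Longrightarrow> (\<integral>x. z x * \<psi> x \<partial>lborel) = 0"
  shows "AE x in lborel. z x = 0"
proof -
  have int0: "(\<integral>x. indicator {a<..<b} x *\<^sub>R z x \<partial>lborel) = 0" for a b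
  proof -
    \<comment> \<open>Both factors vanish outside (a, b), and each reaches 1 at distance 1/n from
      its end point, so at every point of (a, b) the value is eventually exactly 1.\<close>
    define \<psi> where "\<psi> = (\<lambda>n::nat. \<lambda>x. complex_of_real (step (real n * (x - a)) * step (real n * (b - x))))"
    define r where "r = \<bar>a\<bar> + \<bar>b\<bar> + 1"
    have sm: "smooth (\<psi> n)" for n
    proof -
      have "smooth (\<lambda>x. complex_of_real (step (real n * x + (- (real n * a)))) * complex_of_real (step ((- real n) * x + real n * b)))"
        by (intro smooth_mult smooth_affine_real[OF smooth_step])
      then show ?thesis by (simp add: \<psi>_def algebra_simps)
    qed
    have out: "\<psi> n x = 0" if "x \<notin> {a<..<b}" for n x
      using that by (auto simp: \<psi>_def step_0 mult_nonneg_nonpos not_less)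
    have le1: "norm (\<psi> n x) \<le> 1" for n x
      unfolding \<psi>_def norm_of_real using step_bounds by (auto simp: abs_mult intro!: mult_le_one)
    have lim: "(\<lambda>n. \<psi> n x) \<longlonglongrightarrow> 1" if x: "x \<in> {a<..<b}" for x
    proof (rule tendsto_eventually)
      have "filterlim (\<lambda>n. real n * w) at_top sequentially" if "w > 0" for w
        using that by (intro filterlim_at_top_mult_tendsto_pos[OF tendsto_const] filterlim_real_sequentially)
      then have "\<forall>\<^sub>F n in sequentially. real n * (x - a) \<ge> 1 \<and> real n * (b - x) \<ge> 1"
        using x by (auto simp: filterlim_at_top intro!: eventually_conj)
      then show "\<forall>\<^sub>F n in sequentially. \<psi> n x = 1"
        by eventually_elim (simp add: \<psi>_def step_1)
    qed
    have zr: "integrable lborel (\<lambda>x. indicator {-r..r} x *\<^sub>R z x)"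
      using z[of r] by (simp add: set_integrable_def)
    have eq: "z x * \<psi> n x = (indicator {-r..r} x *\<^sub>R z x) * \<psi> n x" for n x
    proof (cases "x \<in> {a<..<b}")
      case True
      then show ?thesis by (auto simp: indicator_def r_def)
    qed (use out[of x n] in auto)
    have "(\<lambda>n. \<integral>x. z x * \<psi> n x \<partial>lborel) \<longlonglongrightarrow> (\<integral>x. indicator {a<..<b} x *\<^sub>R z x \<partial>lborel)"
    proof (rule integral_dominated_convergence[where w = "\<lambda>x. norm (indicator {-r..r} x *\<^sub>R z x)"])
      have m: "\<psi> n \<in> borel_measurable lborel" for n
        using borel_measurable_continuous_onI[OF smooth_continuous_on[OF sm]] by simp
      show "(\<lambda>x. z x * \<psi> n x) \<in> borel_measurable lborel" for n
        unfolding eq by (rule borel_measurable_times[OF borel_measurable_integrable[OF zr] m])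
      have "(\<lambda>x. indicator {a<..<b} x *\<^sub>R (indicator {-r..r} x *\<^sub>R z x)) \<in> borel_measurable lborel"
        using zr by measurable
      moreover have "indicator {a<..<b} x *\<^sub>R (indicator {-r..r} x *\<^sub>R z x) = indicator {a<..<b} x *\<^sub>R z x" for x
        by (auto simp: indicator_def r_def)
      ultimately show "(\<lambda>x. indicator {a<..<b} x *\<^sub>R z x) \<in> borel_measurable lborel" by (simp only:)
      show "integrable lborel (\<lambda>x. norm (indicator {-r..r} x *\<^sub>R z x))"
        by (rule integrable_norm[OF zr])
      show "AE x in lborel. (\<lambda>n. z x * \<psi> n x) \<longlonglongrightarrow> indicator {a<..<b} x *\<^sub>R z x"
      proof (rule AE_I2)
        fix x show "(\<lambda>n. z x * \<psi> n x) \<longlonglongrightarrow> indicator {a<..<b} x *\<^sub>R z x"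
        proof (cases "x \<in> {a<..<b}")
          case True
          from tendsto_mult[OF tendsto_const lim[OF this], of "z x"] True show ?thesis by simp
        next
          case False
          then show ?thesis using out[OF False] by simp
        qed
      qed
      show "AE x in lborel. norm (z x * \<psi> n x) \<le> norm (indicator {-r..r} x *\<^sub>R z x)" for n
        unfolding eq norm_mult using le1 by (intro AE_I2 mult_left_le) auto
    qed
    moreover have "(\<integral>x. z x * \<psi> n x \<partial>lborel) = 0" for n
    proof (rule zero[OF sm])
      show "r > 0" by (simp add: r_def)
      show "\<psi> n x = 0" if "\<bar>x\<bar> > r" for x
        by (rule out) (use that in \<open>auto simp: r_def\<close>)
    qed
    ultimately show ?thesis by (simp add: LIMSEQ_const_iff)
  qed
  \<comment> \<open>\<open>z\<close> is only locally integrable, so the interval criterion is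
    applied to its restriction to (-n, n); the interval integrals of the restriction are again
    interval integrals of \<open>z\<close>.\<close>
  have "AE x in lborel. indicator {-real n<..<real n} x *\<^sub>R z x = 0" for n
  proof (rule AE_zero_of_interval_integrals)
    have "integrable lborel (\<lambda>x. indicator {-real n<..<real n} x *\<^sub>R (indicator {-real n..real n} x *\<^sub>R z x))"
      by (rule integrable_mult_indicator) (use z[of "real n"] in \<open>simp_all add: set_integrable_def\<close>)
    moreover have "indicator {-real n<..<real n} x *\<^sub>R (indicator {-real n..real n} x *\<^sub>R z x)
        = indicator {-real n<..<real n} x *\<^sub>R z x" for x
      by (auto simp: indicator_def)
    ultimately show "integrable lborel (\<lambda>x. indicator {-real n<..<real n} x *\<^sub>R z x)" by (simp only:)
    fix a b
    have "indicator {a<..<b} x *\<^sub>R (indicator {-real n<..<real n} x *\<^sub>R z x)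
        = indicator {max a (-real n)<..<min b (real n)} x *\<^sub>R z x" for x
      by (auto simp: indicator_def)
    then show "(\<integral>x. indicator {a<..<b} x *\<^sub>R (indicator {-real n<..<real n} x *\<^sub>R z x) \<partial>lborel) = 0"
      by (simp only: int0)
  qed
  then have "AE x in lborel. \<forall>n. indicator {-real n<..<real n} x *\<^sub>R z x = 0"
    unfolding AE_all_countable by blast
  then show ?thesis
  proof eventually_elim
    case (elim x)
    obtain N :: nat where "\<bar>x\<bar> < real N" using reals_Archimedean2 by blast
    then show ?case using elim[rule_format, of N] by (auto simp: indicator_def)
  qed
qed

section \<open>Green's function of the one-dimensional Helmholtz operator\<close>

definition green :: "complex \<Rightarrow> real \<Rightarrow> complex" where
  "green \<kappa> x = \<i> / (2 * \<kappa>) * exp (\<i> * \<kappa> * of_real \<bar>x\<bar>)"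

lemma norm_green: "norm (green \<kappa> x) = exp (- Im \<kappa> * \<bar>x\<bar>) / (2 * norm \<kappa>)"
  by (simp add: green_def norm_mult norm_divide)

lemma norm_green_le: "Im \<kappa> \<ge> 0 \<Longrightarrow> norm (green \<kappa> x) \<le> 1 / (2 * norm \<kappa>)"
  unfolding norm_green by (intro divide_right_mono) (auto intro: mult_nonneg_nonneg)

lemma green_minus: "green \<kappa> (x - y) = green \<kappa> (y - x)"
  by (simp add: green_def abs_minus_commute)

lemma continuous_on_green: "continuous_on UNIV (green \<kappa>)"
  unfolding green_def by (intro continuous_intros)

lemma green_borel [measurable]: "green \<kappa> \<in> borel_measurable borel"
  using continuous_on_green by (rule borel_measurable_continuous_onI)

lemma continuous_antiderivative:
  fixes p :: "real \<Rightarrow> complex"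
  assumes "continuous_on UNIV p"
  obtains P where "\<And>x. (P has_vector_derivative p x) (at x)"
proof -
  have "\<exists>P. \<forall>x::real. - \<infinity> < ereal x \<longrightarrow> ereal x < \<infinity> \<longrightarrow> (P has_vector_derivative p x) (at x)"
    using assms by (intro einterval_antiderivative) (auto simp: continuous_on_eq_continuous_at)
  then show ?thesis using that by auto
qed

text \<open>The derivative is asked to vanish on the open interval only, because a function
  supported in [-r, r] is known to be zero just for |x| > r.\<close>

lemma zero_derivative_const:
  fixes P :: "real \<Rightarrow> complex"
  assumes "\<And>x. (P has_vector_derivative p x) (at x)" "\<And>x. a < x \<Longrightarrow> x < b \<Longrightarrow> p x = 0" "a \<le> b"
  shows "P a = P b"
proof -
  have "((\<lambda>x. p x) has_integral P b - P a) {a..b}"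
    using assms(3) by (intro fundamental_theorem_of_calculus has_vector_derivative_at_within[OF assms(1)])
  moreover have "(p has_integral 0) {a..b}"
  proof (rule has_integral_spike_finite[where S = "{a, b}" and f = "\<lambda>_. 0"])
    show "p x = 0" if "x \<in> {a..b} - {a, b}" for x using that assms(2)[of x] by auto
  qed auto
  ultimately have "P b - P a = 0" by (rule has_integral_unique)
  then show ?thesis by simp
qed

text \<open>Variation of constants with the two exponential solutions \<open>E\<close> and
  \<open>F\<close>: \<open>\<Phi>\<close> is c times E(x) times the integral of F
  \<open>\<psi>\<close> up to x, plus c times F(x) times the integral of E \<open>\<psi>\<close>
  from x on. Beyond the support of \<open>\<psi>\<close> only the outgoing exponential survives, so
  the radiation condition holds there exactly and not just asymptotically.\<close>

lemma green_potential:
  fixes \<psi> :: "real \<Rightarrow> complex"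
  assumes \<kappa>: "\<kappa> \<noteq> 0" and \<psi>: "smooth \<psi>" "\<And>x. \<bar>x\<bar> > r \<Longrightarrow> \<psi> x = 0" "r > 0"
  obtains \<Phi> \<Phi>' where "\<And>x. (\<Phi> has_vector_derivative \<Phi>' x) (at x)"
    "\<And>x. (\<Phi>' has_vector_derivative - \<kappa>\<^sup>2 * \<Phi> x - \<psi> x) (at x)" "smooth \<Phi>"
    "\<And>x. \<Phi> x = (\<integral>t. green \<kappa> (x - t) * \<psi> t \<partial>lborel)"
    "\<And>x. \<bar>x\<bar> \<ge> r \<Longrightarrow> \<Phi>' x = of_real (sgn x) * \<i> * \<kappa> * \<Phi> x"
proof -
  define E where "E = (\<lambda>x::real. exp (\<i> * \<kappa> * of_real x))"
  define F where "F = (\<lambda>x::real. exp (- (\<i> * \<kappa>) * of_real x))"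
  have smE: "smooth E" and smF: "smooth F" unfolding E_def F_def by (rule smooth_exp)+
  have EF: "E x * F x = 1" for x by (simp add: E_def F_def exp_add[symmetric])
  have E': "(E has_vector_derivative \<i> * \<kappa> * E x) (at x)" for x
    unfolding E_def by (auto intro!: derivative_eq_intros has_vector_derivative_real_field)
  have F': "(F has_vector_derivative - (\<i> * \<kappa>) * F x) (at x)" for x
    unfolding F_def by (auto intro!: derivative_eq_intros has_vector_derivative_real_field)
  have cF: "continuous_on UNIV (\<lambda>t. F t * \<psi> t)" "continuous_on UNIV (\<lambda>t. E t * \<psi> t)"
    by (intro continuous_intros smooth_continuous_on smE smF \<psi>)+
  obtain P where P: "\<And>x. (P has_vector_derivative F x * \<psi> x) (at x)"
    using continuous_antiderivative[OF cF(1)] by blast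
  obtain Q where Q: "\<And>x. (Q has_vector_derivative E x * \<psi> x) (at x)"
    using continuous_antiderivative[OF cF(2)] by blast
  have smP: "smooth P" using smooth_real_iff[OF P] smF \<psi>(1) by auto
  have smQ: "smooth Q" using smooth_real_iff[OF Q] smE \<psi>(1) by auto
  \<comment> \<open>The prefactor of Green's function. Since 2 c i \<open>\<kappa>\<close> = -1, the
    derivative of the kernel jumps by -1 at the diagonal, which produces the source term
    -\<open>\<psi>\<close>.\<close>
  define c where "c = \<i> / (2 * \<kappa>)"
  define \<Phi> where "\<Phi> = (\<lambda>x. c * (E x * (P x - P (-r)) + F x * (Q r - Q x)))"
  define \<Phi>' where "\<Phi>' = (\<lambda>x. - (1 / 2) * (E x * (P x - P (-r)) - F x * (Q r - Q x)))"
  have c: "c * (\<i> * \<kappa>) = - (1 / 2)" using \<kappa> by (simp add: c_def field_simps)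
  have c2: "- \<kappa>\<^sup>2 * c = - (1 / 2) * (\<i> * \<kappa>)" using \<kappa> by (simp add: c_def field_simps power2_eq_square)
  have d1: "(\<Phi> has_vector_derivative \<Phi>' x) (at x)" for x
  proof -
    have "(\<Phi> has_vector_derivative c * ((E x * (F x * \<psi> x - 0) + \<i> * \<kappa> * E x * (P x - P (-r)))
        + (F x * (0 - E x * \<psi> x) + (- (\<i> * \<kappa>) * F x) * (Q r - Q x)))) (at x)"
      unfolding \<Phi>_def
      by (intro has_vector_derivative_mult_right has_vector_derivative_add has_vector_derivative_mult
          has_vector_derivative_diff has_vector_derivative_const E' F' P Q)
    moreover have "c * ((E x * (F x * \<psi> x - 0) + \<i> * \<kappa> * E x * (P x - P (-r)))
        + (F x * (0 - E x * \<psi> x) + (- (\<i> * \<kappa>) * F x) * (Q r - Q x)))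
      = (c * (\<i> * \<kappa>)) * (E x * (P x - P (-r)) - F x * (Q r - Q x))"
      by (simp add: algebra_simps)
    ultimately show ?thesis by (simp only: c \<Phi>'_def)
  qed
  have d2: "(\<Phi>' has_vector_derivative - \<kappa>\<^sup>2 * \<Phi> x - \<psi> x) (at x)" for x
  proof -
    have "(\<Phi>' has_vector_derivative - (1/2) * ((E x * (F x * \<psi> x - 0) + \<i> * \<kappa> * E x * (P x - P (-r)))
        - (F x * (0 - E x * \<psi> x) + (- (\<i> * \<kappa>) * F x) * (Q r - Q x)))) (at x)"
      unfolding \<Phi>'_def
      by (intro has_vector_derivative_mult_right has_vector_derivative_add has_vector_derivative_mult
          has_vector_derivative_diff has_vector_derivative_const E' F' P Q)
    moreover have "- (1/2) * ((E x * (F x * \<psi> x - 0) + \<i> * \<kappa> * E x * (P x - P (-r)))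
        - (F x * (0 - E x * \<psi> x) + (- (\<i> * \<kappa>) * F x) * (Q r - Q x)))
      = (- (1/2) * (\<i> * \<kappa>)) * (E x * (P x - P (-r)) + F x * (Q r - Q x)) - (E x * F x) * \<psi> x"
      by (simp add: algebra_simps)
    moreover have "- \<kappa>\<^sup>2 * \<Phi> x = (- (1/2) * (\<i> * \<kappa>)) * (E x * (P x - P (-r)) + F x * (Q r - Q x))"
      unfolding \<Phi>_def c2[symmetric] by (simp add: algebra_simps)
    ultimately show ?thesis by (simp only: EF mult_1)
  qed
  have sm: "smooth \<Phi>" unfolding \<Phi>_def
    by (intro smooth_mult smooth_const smooth_add smooth_diff smE smF smP smQ)
  have PQr: "P x = P (-r)" if "x \<le> - r" for x
    using zero_derivative_const[OF P _ that] \<psi>(2) \<psi>(3) by force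
  have Pc: "P x = P r" if "r \<le> x" for x
    using zero_derivative_const[OF P _ that] \<psi>(2) \<psi>(3) by force
  have Qc: "Q x = Q r" if "r \<le> x" for x
    using zero_derivative_const[OF Q _ that] \<psi>(2) \<psi>(3) by force
  \<comment> \<open>For x >= r the \<open>Q\<close> part is 0 and \<open>\<Phi>\<close> is a
    multiple of \<open>E\<close>; for x <= -r the \<open>P\<close> part is 0 and
    \<open>\<Phi>\<close> is a multiple of \<open>F\<close>. The two logarithmic derivatives are i
    \<open>\<kappa>\<close> and -i \<open>\<kappa>\<close>.\<close>
  have rad: "\<Phi>' x = of_real (sgn x) * \<i> * \<kappa> * \<Phi> x" if "\<bar>x\<bar> \<ge> r" for x
  proof -
    have "(\<i> * \<kappa>) * \<Phi> x = (c * (\<i> * \<kappa>)) * (E x * (P x - P (-r)) + F x * (Q r - Q x))"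
      by (simp add: \<Phi>_def)
    then have *: "(\<i> * \<kappa>) * \<Phi> x = - (1 / 2) * (E x * (P x - P (-r)) + F x * (Q r - Q x))" by (simp only: c)
    show ?thesis
    proof (cases "x \<ge> r")
      case True
      then show ?thesis using * \<psi>(3) Qc[of x] by (simp add: \<Phi>'_def mult.assoc)
    next
      case False
      then show ?thesis using * \<psi>(3) PQr[of x] that by (simp add: \<Phi>'_def mult.assoc)
    qed
  qed
  have int: "\<Phi> x = (\<integral>t. green \<kappa> (x - t) * \<psi> t \<partial>lborel)" for x
  proof -
    \<comment> \<open>[-M, M] contains both the support of \<open>\<psi>\<close> and the point x,
      where the kernel has its kink and the integral is split.\<close>
    define M where "M = max r \<bar>x\<bar>"
    have M: "- M \<le> x" "x \<le> M" "r \<le> M" by (auto simp: M_def)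
    let ?h = "\<lambda>t. green \<kappa> (x - t) * \<psi> t"
    have g1: "green \<kappa> (x - t) = c * E x * F t" if "t \<le> x" for t
      using that by (simp add: green_def c_def E_def F_def exp_add[symmetric] right_diff_distrib)
    have g2: "green \<kappa> (x - t) = c * F x * E t" if "x \<le> t" for t
      using that by (simp add: green_def c_def E_def F_def exp_add[symmetric] right_diff_distrib)
    have h1: "((\<lambda>t. c * E x * (F t * \<psi> t)) has_integral c * E x * P x - c * E x * P (-M)) {-M..x}"
      by (intro fundamental_theorem_of_calculus M has_vector_derivative_at_within[OF has_vector_derivative_mult_right[OF P]])
    have h1': "(?h has_integral c * E x * P x - c * E x * P (-M)) {-M..x}"
      by (rule has_integral_eq[OF _ h1]) (simp add: g1)
    have h2: "((\<lambda>t. c * F x * (E t * \<psi> t)) has_integral c * F x * Q M - c * F x * Q x) {x..M}"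
      by (intro fundamental_theorem_of_calculus M has_vector_derivative_at_within[OF has_vector_derivative_mult_right[OF Q]])
    have h2': "(?h has_integral c * F x * Q M - c * F x * Q x) {x..M}"
      by (rule has_integral_eq[OF _ h2]) (simp add: g2)
    have "(?h has_integral (c * E x * P x - c * E x * P (-M)) + (c * F x * Q M - c * F x * Q x)) {-M..M}"
      by (rule has_integral_combine[OF M(1,2) h1' h2'])
    moreover have "P (-M) = P (-r)" "Q M = Q r" using PQr[of "-M"] Qc[of M] M by auto
    ultimately have hi: "(?h has_integral \<Phi> x) {-M..M}"
      by (simp add: \<Phi>_def algebra_simps)
    have ch: "continuous_on UNIV ?h"
      by (intro continuous_intros continuous_on_compose2[OF continuous_on_green] smooth_continuous_on \<psi>) auto
    have "set_integrable lborel {-M..M} ?h"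
      unfolding set_integrable_def
      by (intro borel_integrable_compact continuous_on_subset[OF ch]) auto
    then have "(LINT t:{-M..M}|lborel. ?h t) = \<Phi> x"
      using set_borel_integral_eq_integral(2) hi integral_unique by metis
    moreover have "indicator {-M..M} t *\<^sub>R ?h t = ?h t" for t
      using \<psi>(2)[of t] M by (cases "\<bar>t\<bar> > r") (auto simp: indicator_def)
    ultimately show ?thesis by (simp add: set_lebesgue_integral_def)
  qed
  show ?thesis by (rule that[OF d1 d2 sm int rad])
qed

section \<open>Boundary terms at infinity\<close>

lemma dplateau_bounded:
  obtains C where "C > 0" "\<And>R x. \<bar>dplateau R x\<bar> \<le> C" "\<And>R x. \<bar>ddplateau R x\<bar> \<le> C"
proof -
  obtain B where B: "B > 0" "\<And>x. \<bar>dstep x\<bar> \<le> B" by (rule dstep_bounded) blast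
  have "ddstep x = 0" if "\<bar>x\<bar> > 1" for x using that by (intro ddstep_eq_0) auto
  then obtain D where D: "D > 0" "\<And>x. \<bar>ddstep x\<bar> \<le> D"
    using compact_support_bounded[OF continuous_on_ddstep, of 1] by auto
  have s: "\<bar>step x\<bar> \<le> 1" for x using step_bounds[of x] by simp
  have b1: "\<bar>dplateau R x\<bar> \<le> B * 1 + 1 * B" for R x
    unfolding dplateau_def
    by (rule order_trans[OF abs_triangle_ineq4], unfold abs_mult)
      (intro add_mono mult_mono B s; use B in simp)
  have b2: "\<bar>ddplateau R x\<bar> \<le> (D * 1 + 2 * B * B) + 1 * D" for R x
    unfolding ddplateau_def
    by (rule order_trans[OF abs_triangle_ineq], rule add_mono, rule order_trans[OF abs_triangle_ineq4],
        unfold abs_mult)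
      (intro add_mono mult_mono B s D; use B D in simp)+
  show ?thesis
  proof (rule that[of "2 * B + 2 * D + 2 * B * B"])
    have "0 \<le> 2 * B * B" using B(1) by simp
    then show "2 * B + 2 * D + 2 * B * B > 0" "\<bar>dplateau R x\<bar> \<le> 2 * B + 2 * D + 2 * B * B"
      "\<bar>ddplateau R x\<bar> \<le> 2 * B + 2 * D + 2 * B * B" for R x
      using b1[of R x] b2[of R x] B(1) D(1) by linarith+
  qed
qed

text \<open>The weak equation is tested with p \<open>\<Phi>\<close> for a plateau p. Once p = 1 on
  the support of \<open>\<psi>\<close>, (p \<open>\<Phi>\<close>)'' +
  \<open>\<kappa>\<^sup>2\<close> p \<open>\<Phi>\<close> equals -\<open>\<psi>\<close> + 2 p'
  \<open>\<Phi>'\<close> + p'' \<open>\<Phi>\<close>. The last two terms are the commutator that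
  \<open>tail\<close> controls; in the source integral p is removed by dominated
  convergence.\<close>

lemma weak_solution_representation:
  fixes u f \<psi> \<Phi> \<Phi>' :: "real \<Rightarrow> complex"
  assumes u: "\<And>R. set_integrable lborel {-R..R} u" and f: "integrable lborel f"
    and E: "\<And>\<psi> \<psi>' \<psi>'' r. smooth \<psi> \<Longrightarrow> r > 0 \<Longrightarrow> (\<And>x. \<bar>x\<bar> > r \<Longrightarrow> \<psi> x = 0) \<Longrightarrow>
       (\<And>x. (\<psi> has_vector_derivative \<psi>' x) (at x)) \<Longrightarrow> (\<And>x. (\<psi>' has_vector_derivative \<psi>'' x) (at x)) \<Longrightarrow>
       (\<integral>x. u x * \<psi>'' x \<partial>lborel) + \<kappa>\<^sup>2 * (\<integral>x. u x * \<psi> x \<partial>lborel) = - (\<integral>x. f x * \<psi> x \<partial>lborel)"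
    and \<psi>: "smooth \<psi>" "\<And>x. \<bar>x\<bar> > r \<Longrightarrow> \<psi> x = 0" "r > 0"
    and \<Phi>': "\<And>x. (\<Phi> has_vector_derivative \<Phi>' x) (at x)"
    and \<Phi>'': "\<And>x. (\<Phi>' has_vector_derivative - \<kappa>\<^sup>2 * \<Phi> x - \<psi> x) (at x)"
    and sm: "smooth \<Phi>" and bd: "\<And>x. norm (\<Phi> x) \<le> C"
    and tail: "(\<lambda>n. \<integral>x. u x * (2 * of_real (dplateau (real n) x) * \<Phi>' x + of_real (ddplateau (real n) x) * \<Phi> x) \<partial>lborel) \<longlonglongrightarrow> 0"
  shows "(\<integral>x. u x * \<psi> x \<partial>lborel) = (\<integral>x. f x * \<Phi> x \<partial>lborel)"
proof -
  define p where "p = (\<lambda>n::nat. \<lambda>x. complex_of_real (plateau (real n) x))"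
  define dp where "dp = (\<lambda>n::nat. \<lambda>x. complex_of_real (dplateau (real n) x))"
  define ddp where "ddp = (\<lambda>n::nat. \<lambda>x. complex_of_real (ddplateau (real n) x))"
  have dp: "(p n has_vector_derivative dp n x) (at x)" for n x
    unfolding p_def dp_def by (rule smooth_of_real_has_derivative[OF plateau_has_derivative])
  have ddp: "(dp n has_vector_derivative ddp n x) (at x)" for n x
    unfolding ddp_def dp_def by (rule smooth_of_real_has_derivative[OF dplateau_has_derivative])
  have smp: "smooth (p n)" "smooth (dp n)" "smooth (ddp n)" for n
    unfolding p_def dp_def ddp_def by (rule smooth_plateau smooth_dplateau smooth_ddplateau)+
  have sm': "smooth \<Phi>'" using smooth_real_iff[OF \<Phi>'] sm by blast
  have pz: "p n x = 0" if "\<bar>x\<bar> > real n + 1" for n x using plateau_eq_0 that by (simp add: p_def)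
  have dpz: "dp n x = 0" "ddp n x = 0" if "\<bar>x\<bar> > real n + 1" for n x
    using dplateau_eq_0[of "real n" x] that by (simp_all add: dp_def ddp_def)
  have eq: "(\<integral>x. u x * \<psi> x \<partial>lborel) = (\<integral>x. u x * (2 * dp n x * \<Phi>' x + ddp n x * \<Phi> x) \<partial>lborel) + (\<integral>x. f x * (p n x * \<Phi> x) \<partial>lborel)"
    if n: "real n \<ge> r" for n
  proof -
    have p\<psi>: "p n x * \<psi> x = \<psi> x" for x
      using \<psi>(2)[of x] n plateau_eq_1[of x "real n"] by (cases "\<bar>x\<bar> > r") (auto simp: p_def)
    let ?a = "\<lambda>x. 2 * dp n x * \<Phi>' x + ddp n x * \<Phi> x"
    have 1: "((\<lambda>x. p n x * \<Phi> x) has_vector_derivative p n x * \<Phi>' x + dp n x * \<Phi> x) (at x)" for x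
      by (rule has_vector_derivative_mult[OF dp \<Phi>'])
    have 2: "((\<lambda>x. p n x * \<Phi>' x + dp n x * \<Phi> x) has_vector_derivative
        (?a x + (- \<kappa>\<^sup>2) * (p n x * \<Phi> x)) - \<psi> x) (at x)" for x
    proof -
      have "((\<lambda>x. p n x * \<Phi>' x + dp n x * \<Phi> x) has_vector_derivative
        (p n x * (- \<kappa>\<^sup>2 * \<Phi> x - \<psi> x) + dp n x * \<Phi>' x) + (dp n x * \<Phi>' x + ddp n x * \<Phi> x)) (at x)"
        by (rule has_vector_derivative_add[OF has_vector_derivative_mult[OF dp \<Phi>''] has_vector_derivative_mult[OF ddp \<Phi>']])
      moreover have "(p n x * (- \<kappa>\<^sup>2 * \<Phi> x - \<psi> x) + dp n x * \<Phi>' x) + (dp n x * \<Phi>' x + ddp n x * \<Phi> x)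
        = (?a x + (- \<kappa>\<^sup>2) * (p n x * \<Phi> x)) - p n x * \<psi> x"
        by (simp add: algebra_simps)
      ultimately show ?thesis by (simp only: p\<psi>)
    qed
    have smp\<Phi>: "smooth (\<lambda>x. p n x * \<Phi> x)" by (intro smooth_mult smp sm)
    have "(\<integral>x. u x * ((?a x + (- \<kappa>\<^sup>2) * (p n x * \<Phi> x)) - \<psi> x) \<partial>lborel) + \<kappa>\<^sup>2 * (\<integral>x. u x * (p n x * \<Phi> x) \<partial>lborel)
        = - (\<integral>x. f x * (p n x * \<Phi> x) \<partial>lborel)"
      by (rule E[OF smp\<Phi>, of "real n + 1", OF _ _ 1 2]) (use pz in auto)
    moreover have "(\<integral>x. u x * ((?a x + (- \<kappa>\<^sup>2) * (p n x * \<Phi> x)) - \<psi> x) \<partial>lborel) =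
       ((\<integral>x. u x * ?a x \<partial>lborel) + (- \<kappa>\<^sup>2) * (\<integral>x. u x * (p n x * \<Phi> x) \<partial>lborel)) - (\<integral>x. u x * \<psi> x \<partial>lborel)"
    proof -
      have c: "continuous_on UNIV ?a" "continuous_on UNIV (\<lambda>x. p n x * \<Phi> x)" "continuous_on UNIV \<psi>"
        by (intro continuous_intros smooth_continuous_on smp sm sm' \<psi>)+
      have i: "integrable lborel (\<lambda>x. u x * ?a x)" "integrable lborel (\<lambda>x. u x * (p n x * \<Phi> x))"
         "integrable lborel (\<lambda>x. u x * \<psi> x)"
        by (rule integrable_mult_compact_support[OF u c(1), of "real n + 1"], simp add: dpz,
          rule integrable_mult_compact_support[OF u c(2), of "real n + 1"], simp add: pz,
          rule integrable_mult_compact_support[OF u c(3) \<psi>(2)])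
      have "u x * ((?a x + (- \<kappa>\<^sup>2) * (p n x * \<Phi> x)) - \<psi> x) = (u x * ?a x + (- \<kappa>\<^sup>2) * (u x * (p n x * \<Phi> x))) - u x * \<psi> x" for x
        by (simp add: algebra_simps)
      then have "(\<integral>x. u x * ((?a x + (- \<kappa>\<^sup>2) * (p n x * \<Phi> x)) - \<psi> x) \<partial>lborel) =
        (\<integral>x. (u x * ?a x + (- \<kappa>\<^sup>2) * (u x * (p n x * \<Phi> x))) - u x * \<psi> x \<partial>lborel)" by (simp only:)
      also have "\<dots> = (\<integral>x. u x * ?a x + (- \<kappa>\<^sup>2) * (u x * (p n x * \<Phi> x)) \<partial>lborel) - (\<integral>x. u x * \<psi> x \<partial>lborel)"
        by (rule Bochner_Integration.integral_diff[OF Bochner_Integration.integrable_add[OF i(1) integrable_mult_right[OF i(2)]] i(3)])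
      also have "(\<integral>x. u x * ?a x + (- \<kappa>\<^sup>2) * (u x * (p n x * \<Phi> x)) \<partial>lborel)
        = (\<integral>x. u x * ?a x \<partial>lborel) + (\<integral>x. (- \<kappa>\<^sup>2) * (u x * (p n x * \<Phi> x)) \<partial>lborel)"
        by (rule Bochner_Integration.integral_add[OF i(1) integrable_mult_right[OF i(2)]])
      also have "(\<integral>x. (- \<kappa>\<^sup>2) * (u x * (p n x * \<Phi> x)) \<partial>lborel) = (- \<kappa>\<^sup>2) * (\<integral>x. u x * (p n x * \<Phi> x) \<partial>lborel)"
        by (rule integral_mult_right_zero)
      finally show ?thesis .
    qed
    ultimately show ?thesis by (simp add: algebra_simps)
  qed
  have lim: "(\<lambda>n. \<integral>x. f x * (p n x * \<Phi> x) \<partial>lborel) \<longlonglongrightarrow> (\<integral>x. f x * \<Phi> x \<partial>lborel)"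
  proof (rule integral_dominated_convergence[where w = "\<lambda>x. norm (f x) * C"])
    have m: "(\<lambda>x. p n x * \<Phi> x) \<in> borel_measurable lborel" "\<Phi> \<in> borel_measurable lborel" for n
      using borel_measurable_continuous_onI[OF smooth_continuous_on[OF smooth_mult[OF smp(1) sm]]]
        borel_measurable_continuous_onI[OF smooth_continuous_on[OF sm]] by auto
    show "(\<lambda>x. f x * (p n x * \<Phi> x)) \<in> borel_measurable lborel" for n
      by (rule borel_measurable_times[OF borel_measurable_integrable[OF f] m(1)])
    show "(\<lambda>x. f x * \<Phi> x) \<in> borel_measurable lborel"
      by (rule borel_measurable_times[OF borel_measurable_integrable[OF f] m(2)])
    show "integrable lborel (\<lambda>x. norm (f x) * C)" using f by auto
    show "AE x in lborel. (\<lambda>n. f x * (p n x * \<Phi> x)) \<longlonglongrightarrow> f x * \<Phi> x"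
    proof (rule AE_I2, rule tendsto_eventually)
      fix x :: real
      obtain N :: nat where "\<bar>x\<bar> < real N" using reals_Archimedean2 by blast
      then show "\<forall>\<^sub>F n in sequentially. f x * (p n x * \<Phi> x) = f x * \<Phi> x"
        by (intro eventually_sequentiallyI[of N]) (simp add: p_def plateau_eq_1)
    qed
    show "AE x in lborel. norm (f x * (p n x * \<Phi> x)) \<le> norm (f x) * C" for n
    proof (rule AE_I2)
      fix x
      have "norm (p n x) * norm (\<Phi> x) \<le> 1 * C"
        using abs_plateau_le[of "real n" x] bd[of x] by (intro mult_mono) (auto simp: p_def)
      then show "norm (f x * (p n x * \<Phi> x)) \<le> norm (f x) * C"
        by (simp add: norm_mult mult_left_mono)
    qed
  qed
  have "(\<lambda>n. \<integral>x. u x * \<psi> x \<partial>lborel) \<longlonglongrightarrow> 0 + (\<integral>x. f x * \<Phi> x \<partial>lborel)"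
  proof (rule Lim_transform_eventually[OF tendsto_add[OF tail lim]])
    obtain N :: nat where "r \<le> real N" using real_arch_simple by blast
    show "\<forall>\<^sub>F n in sequentially. (\<integral>x. u x * (2 * of_real (dplateau (real n) x) * \<Phi>' x + of_real (ddplateau (real n) x) * \<Phi> x) \<partial>lborel)
        + (\<integral>x. f x * (p n x * \<Phi> x) \<partial>lborel) = (\<integral>x. u x * \<psi> x \<partial>lborel)"
    proof (intro eventually_sequentiallyI[of N])
      fix n assume "N \<le> n"
      then have "r \<le> real n" using \<open>r \<le> real N\<close> by linarith
      from eq[OF this, symmetric] show "(\<integral>x. u x * (2 * of_real (dplateau (real n) x) * \<Phi>' x + of_real (ddplateau (real n) x) * \<Phi> x) \<partial>lborel)
        + (\<integral>x. f x * (p n x * \<Phi> x) \<partial>lborel) = (\<integral>x. u x * \<psi> x \<partial>lborel)"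
        by (simp only: dp_def ddp_def)
    qed
  qed
  then show ?thesis by (simp add: LIMSEQ_const_iff)
qed

text \<open>The commutator is supported in two layers of unit width and bounded by a constant, so
  Cauchy-Schwarz leaves the L^2 norm of \<open>u\<close> over layers that move to infinity.\<close>

lemma tail_square_integrable:
  fixes u \<Phi> \<Phi>' :: "real \<Rightarrow> complex"
  assumes u: "u \<in> borel_measurable lborel" "integrable lborel (\<lambda>x. (norm (u x))\<^sup>2)"
    and \<Phi>: "continuous_on UNIV \<Phi>" "continuous_on UNIV \<Phi>'" "\<And>x. norm (\<Phi> x) \<le> C"
    and \<Phi>': "\<And>x. \<bar>x\<bar> \<ge> r \<Longrightarrow> \<Phi>' x = of_real (sgn x) * \<i> * \<kappa> * \<Phi> x"
  shows "(\<lambda>n. \<integral>x. u x * (2 * of_real (dplateau (real n) x) * \<Phi>' x + of_real (ddplateau (real n) x) * \<Phi> x) \<partial>lborel) \<longlonglongrightarrow> 0"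
proof -
  obtain B where B: "B > 0" "\<And>R x. \<bar>dplateau R x\<bar> \<le> B" "\<And>R x. \<bar>ddplateau R x\<bar> \<le> B"
    by (rule dplateau_bounded) blast
  define q where "q = (\<lambda>n::nat. \<lambda>x. 2 * of_real (dplateau (real n) x) * \<Phi>' x + of_real (ddplateau (real n) x) * \<Phi> x)"
  define S where "S = (\<lambda>n::nat. {- real n - 1..- real n} \<union> {real n..real n + 1})"
  \<comment> \<open>In layers beyond r the radiation identity gives |\<open>\<Phi>'\<close>| <=
    |\<open>\<kappa>\<close>| C, and \<open>B\<close> bounds both derivatives of the
    plateau.\<close>
  define K where "K = 2 * B * (norm \<kappa> * C) + B * C"
  have C0: "C \<ge> 0" using norm_ge_zero[of "\<Phi> 0"] \<Phi>(3)[of 0] by linarith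
  have cq: "continuous_on UNIV (q n)" for n
    unfolding q_def 
    by (intro continuous_on_add continuous_on_mult continuous_on_const
        smooth_continuous_on[OF smooth_dplateau] smooth_continuous_on[OF smooth_ddplateau] \<Phi>)
  then have mq [measurable]: "q n \<in> borel_measurable lborel" for n
    using borel_measurable_continuous_onI by auto
  have S: "x \<in> S n \<longleftrightarrow> real n \<le> \<bar>x\<bar> \<and> \<bar>x\<bar> \<le> real n + 1" for n x by (auto simp: S_def)
  have q0: "q n x = 0" if "x \<notin> S n" for n x
    using dplateau_eq_0[of "real n" x] that unfolding S q_def by auto
  have qb: "norm (q n x) \<le> K * indicator (S n) x" if "real n \<ge> r" for n x
  proof (cases "x \<in> S n")
    case True
    then have "\<bar>x\<bar> \<ge> r" using that by (simp add: S)
    then have "norm (\<Phi>' x) = \<bar>sgn x\<bar> * (norm \<kappa> * norm (\<Phi> x))" by (simp add: \<Phi>' norm_mult)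
    also have "\<dots> \<le> 1 * (norm \<kappa> * C)" using \<Phi>(3)[of x] C0 by (intro mult_mono) (auto simp: sgn_real_def)
    finally have d: "norm (\<Phi>' x) \<le> norm \<kappa> * C" by simp
    have "norm (q n x) \<le> norm (2 * of_real (dplateau (real n) x) * \<Phi>' x) + norm (of_real (ddplateau (real n) x) * \<Phi> x)"
      unfolding q_def by (rule norm_triangle_ineq)
    also have "\<dots> = 2 * \<bar>dplateau (real n) x\<bar> * norm (\<Phi>' x) + \<bar>ddplateau (real n) x\<bar> * norm (\<Phi> x)"
      by (simp add: norm_mult)
    also have "\<dots> \<le> 2 * B * (norm \<kappa> * C) + B * C"
      using B C0 by (intro add_mono mult_mono d \<Phi>) auto
    finally show ?thesis using True by (simp add: K_def)
  qed (simp add: q0)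
  have Sm [measurable]: "S n \<in> sets borel" for n by (simp add: S_def)
  define g where "g = (\<lambda>n x. indicator (S n) x *\<^sub>R u x)"
  have gm [measurable]: "g n \<in> borel_measurable lborel" for n unfolding g_def using u(1) by simp
  have gi: "integrable lborel (\<lambda>x. (norm (g n x))\<^sup>2)" for n
  proof (rule Bochner_Integration.integrable_bound[OF u(2)])
    show "(\<lambda>x. (norm (g n x))\<^sup>2) \<in> borel_measurable lborel" by measurable
    show "AE x in lborel. norm ((norm (g n x))\<^sup>2) \<le> norm ((norm (u x))\<^sup>2)"
      by (rule AE_I2) (simp add: g_def indicator_def)
  qed
  have gl: "(\<lambda>n. \<integral>x. (norm (g n x))\<^sup>2 \<partial>lborel) \<longlonglongrightarrow> (\<integral>x. 0 \<partial>(lborel :: real measure))"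
  proof (rule integral_dominated_convergence[where w = "\<lambda>x. (norm (u x))\<^sup>2"])
    show "AE x in lborel. (\<lambda>n. (norm (g n x))\<^sup>2) \<longlonglongrightarrow> 0"
    proof (rule AE_I2, rule tendsto_eventually)
      fix x :: real
      obtain N :: nat where "\<bar>x\<bar> < real N" using reals_Archimedean2 by blast
      then show "\<forall>\<^sub>F n in sequentially. (norm (g n x))\<^sup>2 = 0"
        by (intro eventually_sequentiallyI[of N]) (auto simp: g_def S)
    qed
    show "AE x in lborel. norm ((norm (g n x))\<^sup>2) \<le> (norm (u x))\<^sup>2" for n
      by (rule AE_I2) (auto simp: g_def indicator_def)
  qed (use u gm in auto)
  \<comment> \<open>The two layers have total length at most 2, whatever n is.\<close>
  have ni: "integrable lborel (\<lambda>x. K\<^sup>2 * indicator (S n) x)" "(\<integral>x. K\<^sup>2 * indicator (S n) x \<partial>lborel) \<le> K\<^sup>2 * 2" for n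
  proof -
    have b: "emeasure lborel (S n) \<le> 2"
    proof -
      have "emeasure lborel (S n) \<le> emeasure lborel {- real n - 1..- real n} + emeasure lborel {real n..real n + 1}"
        unfolding S_def by (rule emeasure_subadditive) auto
      then show ?thesis by (simp add: one_add_one[symmetric] del: one_add_one)
    qed
    then have fin: "emeasure lborel (S n) < \<infinity>" by (rule le_less_trans) simp
    then show "integrable lborel (\<lambda>x. K\<^sup>2 * indicator (S n) x)" by simp
    have "measure lborel (S n) \<le> 2"
      unfolding measure_def using enn2real_mono[OF b] by simp
    then show "(\<integral>x. K\<^sup>2 * indicator (S n) x \<partial>lborel) \<le> K\<^sup>2 * 2" by (simp add: mult_left_mono)
  qed
  have bound: "(norm (\<integral>x. u x * q n x \<partial>lborel))\<^sup>2 \<le> (\<integral>x. (norm (g n x))\<^sup>2 \<partial>lborel) * (K\<^sup>2 * 2)" if n: "real n \<ge> r" for n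
  proof -
    have qq: "(norm (q n x))\<^sup>2 \<le> K\<^sup>2 * indicator (S n) x" for x
      using power_mono[OF qb[OF n, of x], of 2] by (auto simp: indicator_def split: if_splits)
    have iq: "integrable lborel (\<lambda>x. (norm (q n x))\<^sup>2)"
      by (rule Bochner_Integration.integrable_bound[OF ni(1)[of n]]) (use qq order_trans[OF qq abs_ge_self] in auto)
    have "u x * q n x = g n x * q n x" for x using q0[of x n] by (auto simp: g_def indicator_def)
    then have "(norm (\<integral>x. u x * q n x \<partial>lborel))\<^sup>2 = (norm (\<integral>x. g n x * q n x \<partial>lborel))\<^sup>2" by (simp only:)
    also have "\<dots> \<le> (\<integral>x. (norm (g n x))\<^sup>2 \<partial>lborel) * (\<integral>x. (norm (q n x))\<^sup>2 \<partial>lborel)"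
      by (rule cauchy_schwarz_integral(2)[OF gm mq gi iq])
    also have "\<dots> \<le> (\<integral>x. (norm (g n x))\<^sup>2 \<partial>lborel) * (K\<^sup>2 * 2)"
      by (intro mult_left_mono order_trans[OF Bochner_Integration.integral_mono[OF iq ni(1) qq] ni(2)]) simp
    finally show ?thesis .
  qed
  have "(\<lambda>n. (norm (\<integral>x. u x * q n x \<partial>lborel))\<^sup>2) \<longlonglongrightarrow> 0"
  proof (rule Lim_null_comparison)
    obtain N :: nat where "r \<le> real N" using real_arch_simple by blast
    then show "\<forall>\<^sub>F n in sequentially. norm ((norm (\<integral>x. u x * q n x \<partial>lborel))\<^sup>2) \<le> (\<integral>x. (norm (g n x))\<^sup>2 \<partial>lborel) * (K\<^sup>2 * 2)"
      by (intro eventually_sequentiallyI[of N]) (simp add: bound)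
    show "(\<lambda>n. (\<integral>x. (norm (g n x))\<^sup>2 \<partial>lborel) * (K\<^sup>2 * 2)) \<longlonglongrightarrow> 0"
      using tendsto_mult[OF gl tendsto_const[of "K\<^sup>2 * 2"]] by simp
  qed
  then have "(\<lambda>n. \<integral>x. u x * q n x \<partial>lborel) \<longlonglongrightarrow> 0"
    using tendsto_real_sqrt[of "\<lambda>n. (norm (\<integral>x. u x * q n x \<partial>lborel))\<^sup>2" 0] by (simp add: tendsto_norm_zero_iff)
  then show ?thesis unfolding q_def .
qed

text \<open>Nothing decays here, so cancellation is needed. With p' the derivative of the plateau,
  the exact derivative of w p' \<open>\<Phi>\<close> is subtracted on each layer; it integrates to 0
  because p' vanishes at the ends of the layer. What remains is p' (w \<open>\<Phi>'\<close> - w'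
  \<open>\<Phi>\<close>), a Wronskian of two functions with the same radiation relation at infinity,
  hence o(1).\<close>

lemma tail_outgoing:
  fixes u w w' \<Phi> \<Phi>' :: "real \<Rightarrow> complex"
  assumes u: "\<And>R. set_integrable lborel {-R..R} u" and wu: "AE x in lborel. w x = u x"
    and w': "\<And>x. (w has_vector_derivative w' x) (at x)"
    and rad: "(\<lambda>x. complex_of_real (sgn x) * w' x - \<i> * \<kappa> * w x) \<in> o[at_infinity](\<lambda>_. 1)"
    and \<Phi>: "\<And>x. (\<Phi> has_vector_derivative \<Phi>' x) (at x)" "smooth \<Phi>" "\<And>x. norm (\<Phi> x) \<le> C"
    and \<Phi>': "\<And>x. \<bar>x\<bar> \<ge> r \<Longrightarrow> \<Phi>' x = of_real (sgn x) * \<i> * \<kappa> * \<Phi> x"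
  shows "(\<lambda>n. \<integral>x. u x * (2 * of_real (dplateau (real n) x) * \<Phi>' x + of_real (ddplateau (real n) x) * \<Phi> x) \<partial>lborel) \<longlonglongrightarrow> 0"
proof -
  obtain B where B: "B > 0" "\<And>R x. \<bar>dplateau R x\<bar> \<le> B"
    by (rule dplateau_bounded) blast
  define q where "q = (\<lambda>n::nat. \<lambda>x. 2 * of_real (dplateau (real n) x) * \<Phi>' x + of_real (ddplateau (real n) x) * \<Phi> x)"
  have C0: "C \<ge> 0" using norm_ge_zero[of "\<Phi> 0"] \<Phi>(3)[of 0] by linarith
  have sm\<Phi>': "smooth \<Phi>'" using smooth_real_iff[OF \<Phi>(1)] \<Phi>(2) by blast
  have cq: "continuous_on UNIV (q n)" for n
    unfolding q_def
    by (intro smooth_continuous_on smooth_add smooth_mult smooth_const smooth_dplateau smooth_ddplateau \<Phi>(2) sm\<Phi>')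
  have cw: "continuous_on UNIV w"
    using w' by (auto simp: continuous_on_eq_continuous_at intro: has_vector_derivative_continuous)
  have q0: "q n x = 0" if "\<bar>x\<bar> \<le> real n \<or> \<bar>x\<bar> \<ge> real n + 1" for n x
    using dplateau_eq_0[of "real n" x] that unfolding q_def by auto
  have eqw: "(\<integral>x. u x * q n x \<partial>lborel) = (\<integral>x. w x * q n x \<partial>lborel)" for n
  proof (rule integral_cong_AE)
    have "integrable lborel (\<lambda>x. u x * q n x)"
      by (rule integrable_mult_compact_support[OF u cq, of "real n + 1"]) (use q0 in auto)
    then show "(\<lambda>x. u x * q n x) \<in> borel_measurable lborel" by auto
    show "(\<lambda>x. w x * q n x) \<in> borel_measurable lborel"
      using borel_measurable_continuous_onI[OF continuous_on_mult[OF cw cq]] by simp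
    show "AE x in lborel. u x * q n x = w x * q n x" using wu by eventually_elim simp
  qed
  have piece: "norm (LINT x:{a..b}|lborel. w x * q n x) \<le> e * (B * C)"
    if ab: "b = a + 1" and a: "dplateau (real n) a = 0" "dplateau (real n) b = 0"
      and e: "\<And>x. x \<in> {a..b} \<Longrightarrow> \<bar>x\<bar> \<ge> r \<and> \<bar>x\<bar> > 0 \<and> norm (complex_of_real (sgn x) * w' x - \<i> * \<kappa> * w x) \<le> e"
    for a b n e
  proof -
    define d where "d = (\<lambda>x. complex_of_real (dplateau (real n) x))"
    define d' where "d' = (\<lambda>x. complex_of_real (ddplateau (real n) x))"
    have dd: "(d has_vector_derivative d' x) (at x)" for x
      unfolding d_def d'_def by (rule smooth_of_real_has_derivative[OF dplateau_has_derivative])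
    have "((\<lambda>x. w x * (d x * \<Phi> x)) has_vector_derivative w x * (d x * \<Phi>' x + d' x * \<Phi> x) + w' x * (d x * \<Phi> x)) (at x)" for x
      by (rule has_vector_derivative_mult[OF w' has_vector_derivative_mult[OF dd \<Phi>(1)]])
    \<comment> \<open>\<open>w'\<close> is just a derivative, with no continuity or Lebesgue
      integrability assumed. The gauge integral integrates every derivative, which is why this part
      is stated with \<open>has_integral\<close>.\<close>
    then have "((\<lambda>x. w x * (d x * \<Phi>' x + d' x * \<Phi> x) + w' x * (d x * \<Phi> x)) has_integral
        (w b * (d b * \<Phi> b) - w a * (d a * \<Phi> a))) {a..b}"
      using ab by (intro fundamental_theorem_of_calculus) (auto intro: has_vector_derivative_at_within)
    then have F: "((\<lambda>x. w x * (d x * \<Phi>' x + d' x * \<Phi> x) + w' x * (d x * \<Phi> x)) has_integral 0) {a..b}"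
      using a by (simp add: d_def)
    have "set_integrable lborel {a..b} (\<lambda>x. w x * q n x)"
      unfolding set_integrable_def
      by (rule borel_integrable_compact[OF compact_Icc continuous_on_subset[OF continuous_on_mult[OF cw cq] subset_UNIV]])
    then have I: "((\<lambda>x. w x * q n x) has_integral (LINT x:{a..b}|lborel. w x * q n x)) {a..b}"
      using set_borel_integral_eq_integral integrable_integral by fastforce
    \<comment> \<open>Here \<open>d\<close> and \<open>d'\<close> are the first and second
      derivatives of the plateau; one of the two terms d \<open>\<Phi>'\<close> and all of d'
      \<open>\<Phi>\<close> cancel.\<close>
    have eqn: "w x * q n x - (w x * (d x * \<Phi>' x + d' x * \<Phi> x) + w' x * (d x * \<Phi> x)) = d x * (w x * \<Phi>' x - w' x * \<Phi> x)" for x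
      by (simp add: q_def d_def d'_def algebra_simps)
    have "((\<lambda>x. d x * (w x * \<Phi>' x - w' x * \<Phi> x)) has_integral (LINT x:{a..b}|lborel. w x * q n x) - 0) (cbox a b)"
      using has_integral_diff[OF I F] unfolding eqn cbox_interval .
    then have "norm ((LINT x:{a..b}|lborel. w x * q n x) - 0) \<le> (e * (B * C)) * measure lborel (cbox a b)"
    proof (rule has_integral_bound[rotated])
      have "norm (complex_of_real (sgn a) * w' a - \<i> * \<kappa> * w a) \<le> e" using e[of a] ab by simp
      then have "0 \<le> e" by (rule order_trans[OF norm_ge_zero])
      then show "0 \<le> e * (B * C)" using B C0 by simp
      fix x assume x: "x \<in> cbox a b"
      then have x: "\<bar>x\<bar> \<ge> r" "\<bar>x\<bar> > 0" and ex: "norm (complex_of_real (sgn x) * w' x - \<i> * \<kappa> * w x) \<le> e" using e[of x] by auto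
      have sg: "complex_of_real (sgn x) * complex_of_real (sgn x) = 1" using x(2) by (simp add: sgn_real_def)
      \<comment> \<open>Inserting the relation for \<open>\<Phi>'\<close> leaves the radiation
        residual of w times -sgn(x) \<open>\<Phi>\<close>. The second summand is 0 because sgn(x)^2
        = 1 away from the origin.\<close>
      have "w x * \<Phi>' x - w' x * \<Phi> x = - (complex_of_real (sgn x) * (complex_of_real (sgn x) * w' x - \<i> * \<kappa> * w x)) * \<Phi> x
        + (complex_of_real (sgn x) * complex_of_real (sgn x) - 1) * w' x * \<Phi> x"
        using \<Phi>'[OF x(1)] by (simp add: algebra_simps)
      then have "norm (w x * \<Phi>' x - w' x * \<Phi> x) = norm (complex_of_real (sgn x) * w' x - \<i> * \<kappa> * w x) * norm (\<Phi> x)"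
        using x(2) unfolding sg by (simp add: norm_mult sgn_real_def)
      also have "\<dots> \<le> e * C" using ex \<Phi>(3)[of x] \<open>0 \<le> e\<close> by (intro mult_mono) auto
      finally have "\<bar>dplateau (real n) x\<bar> * norm (w x * \<Phi>' x - w' x * \<Phi> x) \<le> B * (e * C)"
        using B(1) by (intro mult_mono B) auto
      then show "norm (d x * (w x * \<Phi>' x - w' x * \<Phi> x)) \<le> e * (B * C)"
        by (simp add: d_def norm_mult mult_ac)
    qed
    then show ?thesis using ab by simp
  qed
  have "(\<lambda>n. \<integral>x. w x * q n x \<partial>lborel) \<longlonglongrightarrow> 0"
  proof (rule LIMSEQ_I)
    fix \<epsilon> :: real assume \<epsilon>: "\<epsilon> > 0"
    \<comment> \<open>C + 1 instead of C keeps the divisor positive when C = 0. With e =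
      \<open>\<epsilon>\<close> / (4 X) each of the two layers contributes at most
      \<open>\<epsilon>\<close> / 4.\<close>
    define X where "X = B * (C + 1)"
    have BC: "X > 0" using B C0 by (simp add: X_def)
    define e where "e = \<epsilon> / (4 * X)"
    have e: "e > 0" using \<epsilon> BC by (simp add: e_def)
    have e2: "e * (B * C) \<le> \<epsilon> / 4"
    proof -
      have "e * (B * C) \<le> e * X" unfolding X_def using e B by (intro mult_left_mono) auto
      also have "\<dots> = \<epsilon> / 4" using BC by (simp add: e_def)
      finally show ?thesis .
    qed
    have "\<forall>\<^sub>F x in at_infinity. norm (complex_of_real (sgn x) * w' x - \<i> * \<kappa> * w x) \<le> e * norm (1::real)"
      using landau_o.smallD[OF rad e] by simp
    then obtain b where b: "\<And>x. \<bar>x\<bar> \<ge> b \<Longrightarrow> norm (complex_of_real (sgn x) * w' x - \<i> * \<kappa> * w x) \<le> e"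
      by (auto simp: eventually_at_infinity)
    \<comment> \<open>Being at least 1 keeps the layers away from the origin, where sgn is
      0.\<close>
    obtain N :: nat where N: "max (max b r) 1 \<le> real N" using real_arch_simple by blast
    show "\<exists>N. \<forall>n\<ge>N. norm ((\<integral>x. w x * q n x \<partial>lborel) - 0) < \<epsilon>"
    proof (intro exI[of _ N] allI impI)
      fix n assume "N \<le> n"
      then have n: "b \<le> real n" "r \<le> real n" "1 \<le> real n" using N by auto
      have h: "w x * q n x = indicator {real n..real n + 1} x *\<^sub>R (w x * q n x) + indicator {- real n - 1..- real n} x *\<^sub>R (w x * q n x)" for x
      proof (cases "\<bar>x\<bar> \<le> real n \<or> \<bar>x\<bar> \<ge> real n + 1")
        case True
        then have "q n x = 0" by (rule q0)
        then show ?thesis by simp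
      next
        case False
        then show ?thesis using n by (auto simp: indicator_def abs_if split: if_splits)
      qed
      have si: "integrable lborel (\<lambda>x. indicator {c..d} x *\<^sub>R (w x * q n x))" for c d
        by (rule borel_integrable_compact[OF compact_Icc continuous_on_subset[OF continuous_on_mult[OF cw cq] subset_UNIV]])
      have "(\<integral>x. w x * q n x \<partial>lborel) = (LINT x:{real n..real n + 1}|lborel. w x * q n x) + (LINT x:{- real n - 1..- real n}|lborel. w x * q n x)"
        unfolding set_lebesgue_integral_def
        by (subst Bochner_Integration.integral_add[OF si si, symmetric]) (simp only: h[symmetric])
      also have "norm \<dots> \<le> norm (LINT x:{real n..real n + 1}|lborel. w x * q n x) + norm (LINT x:{- real n - 1..- real n}|lborel. w x * q n x)"
        by (rule norm_triangle_ineq)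
      also have "\<dots> \<le> e * (B * C) + e * (B * C)"
        using n by (intro add_mono piece b conjI dplateau_eq_0) auto
      also have "\<dots> < \<epsilon>" using e2 \<epsilon> by linarith
      finally show "norm ((\<integral>x. w x * q n x \<partial>lborel) - 0) < \<epsilon>" by simp
    qed
  qed
  then show ?thesis unfolding eqw[symmetric] unfolding q_def .
qed

section \<open>Convolution with Green's function\<close>

definition green_conv :: "complex \<Rightarrow> (real \<Rightarrow> complex) \<Rightarrow> real \<Rightarrow> complex" where
  "green_conv \<kappa> f t = (\<integral>x. green \<kappa> (t - x) * f x \<partial>lborel)"

lemma green_conv_borel [measurable]:
  assumes [measurable]: "f \<in> borel_measurable borel"
  shows "green_conv \<kappa> f \<in> borel_measurable borel"
proof -
  have "(\<lambda>t. \<integral>x. green \<kappa> (t - x) * f x \<partial>lborel) \<in> borel_measurable lborel"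
    by (rule lborel.borel_measurable_lebesgue_integral) measurable
  then show ?thesis by (simp add: green_conv_def[abs_def])
qed

lemma green_mult_integrable:
  assumes "Im \<kappa> \<ge> 0" "integrable lborel f"
  shows "integrable lborel (\<lambda>x. green \<kappa> (t - x) * f x)"
proof -
  have "(\<lambda>x. green \<kappa> (t - x)) \<in> borel_measurable lborel" by measurable
  from integrable_bounded_mult[OF assms(2) this, of "1 / (2 * norm \<kappa>)"] norm_green_le[OF assms(1)]
  show ?thesis by (simp add: mult.commute)
qed

lemma norm_green_conv_le:
  assumes "Im \<kappa> \<ge> 0" "integrable lborel f"
  shows "norm (green_conv \<kappa> f t) \<le> (\<integral>x. norm (f x) \<partial>lborel) / (2 * norm \<kappa>)"
proof -
  have "norm (green_conv \<kappa> f t) \<le> (\<integral>x. norm (green \<kappa> (t - x) * f x) \<partial>lborel)"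
    unfolding green_conv_def by (rule integral_norm_bound)
  also have "\<dots> \<le> (\<integral>x. 1 / (2 * norm \<kappa>) * norm (f x) \<partial>lborel)"
  proof (rule Bochner_Integration.integral_mono)
    show "integrable lborel (\<lambda>x. norm (green \<kappa> (t - x) * f x))"
      by (rule integrable_norm[OF green_mult_integrable[OF assms]])
    show "integrable lborel (\<lambda>x. 1 / (2 * norm \<kappa>) * norm (f x))"
      by (rule integrable_mult_right[OF integrable_norm[OF assms(2)]])
    show "norm (green \<kappa> (t - x) * f x) \<le> 1 / (2 * norm \<kappa>) * norm (f x)" for x
      unfolding norm_mult by (rule mult_right_mono[OF norm_green_le[OF assms(1)] norm_ge_zero])
  qed
  also have "\<dots> = (\<integral>x. norm (f x) \<partial>lborel) / (2 * norm \<kappa>)"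
    by (simp only: integral_mult_right_zero) simp
  finally show ?thesis .
qed

text \<open>Fubini together with the evenness of the kernel. The kernel is bounded, so integrability
  of \<open>f\<close> and \<open>\<psi>\<close> already makes the double integral absolutely
  convergent.\<close>

lemma integral_green_conv_mult:
  assumes \<kappa>: "Im \<kappa> \<ge> 0" and f: "integrable lborel f" and \<psi>: "integrable lborel \<psi>"
  shows "(\<integral>t. green_conv \<kappa> f t * \<psi> t \<partial>lborel) = (\<integral>x. f x * (\<integral>t. green \<kappa> (x - t) * \<psi> t \<partial>lborel) \<partial>lborel)"
proof -
  have [measurable]: "f \<in> borel_measurable borel" "\<psi> \<in> borel_measurable borel" using f \<psi> by auto
  let ?K = "1 / (2 * norm \<kappa>)"
  have i: "integrable (lborel \<Otimes>\<^sub>M lborel) (\<lambda>(t, x). green \<kappa> (t - x) * f x * \<psi> t)"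
  proof (rule integrableI_bounded)
    show "(\<lambda>(t, x). green \<kappa> (t - x) * f x * \<psi> t) \<in> borel_measurable (lborel \<Otimes>\<^sub>M lborel)" by measurable
    have "(\<integral>\<^sup>+p. norm (case p of (t, x) \<Rightarrow> green \<kappa> (t - x) * f x * \<psi> t) \<partial>(lborel \<Otimes>\<^sub>M lborel))
      = (\<integral>\<^sup>+t. \<integral>\<^sup>+x. norm (green \<kappa> (t - x) * f x * \<psi> t) \<partial>lborel \<partial>lborel)"
      by (subst lborel.nn_integral_fst[symmetric]) (auto simp: case_prod_beta)
    also have "\<dots> \<le> (\<integral>\<^sup>+t. \<integral>\<^sup>+x. ennreal (?K * norm (\<psi> t)) * ennreal (norm (f x)) \<partial>lborel \<partial>lborel)"
    proof (intro nn_integral_mono)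
      fix t x
      have "norm (green \<kappa> (t - x)) * (norm (f x) * norm (\<psi> t)) \<le> ?K * (norm (f x) * norm (\<psi> t))"
        by (rule mult_right_mono[OF norm_green_le[OF \<kappa>]]) simp
      then show "ennreal (norm (green \<kappa> (t - x) * f x * \<psi> t)) \<le> ennreal (?K * norm (\<psi> t)) * ennreal (norm (f x))"
        by (subst ennreal_mult[symmetric]) (auto simp: norm_mult mult_ac intro!: ennreal_leI)
    qed
    also have "\<dots> = (\<integral>\<^sup>+t. ennreal (?K * norm (\<psi> t)) * ennreal (\<integral>x. norm (f x) \<partial>lborel) \<partial>lborel)"
      by (subst nn_integral_cmult) (use nn_integral_eq_integral[OF integrable_norm[OF f]] in auto)
    also have "\<dots> = (\<integral>\<^sup>+t. ennreal (?K * norm (\<psi> t)) \<partial>lborel) * ennreal (\<integral>x. norm (f x) \<partial>lborel)"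
      by (rule nn_integral_multc) measurable
    also have "(\<integral>\<^sup>+t. ennreal (?K * norm (\<psi> t)) \<partial>lborel) = ennreal (\<integral>t. ?K * norm (\<psi> t) \<partial>lborel)"
      by (rule nn_integral_eq_integral[OF integrable_mult_right[OF integrable_norm[OF \<psi>]]]) auto
    finally show "(\<integral>\<^sup>+p. norm (case p of (t, x) \<Rightarrow> green \<kappa> (t - x) * f x * \<psi> t) \<partial>(lborel \<Otimes>\<^sub>M lborel)) < \<infinity>"
      by (rule le_less_trans) (simp add: ennreal_mult_less_top)
  qed
  have "(\<integral>t. green_conv \<kappa> f t * \<psi> t \<partial>lborel) = (\<integral>t. \<integral>x. green \<kappa> (t - x) * f x * \<psi> t \<partial>lborel \<partial>lborel)"
    by (simp add: green_conv_def)
  also have "\<dots> = (\<integral>x. \<integral>t. green \<kappa> (t - x) * f x * \<psi> t \<partial>lborel \<partial>lborel)"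
    by (rule lborel_pair.Fubini_integral[OF i, symmetric])
  also have "\<dots> = (\<integral>x. f x * (\<integral>t. green \<kappa> (x - t) * \<psi> t \<partial>lborel) \<partial>lborel)"
  proof (rule Bochner_Integration.integral_cong[OF refl])
    fix x
    have "(\<integral>t. green \<kappa> (t - x) * f x * \<psi> t \<partial>lborel) = (\<integral>t. f x * (green \<kappa> (x - t) * \<psi> t) \<partial>lborel)"
      by (rule Bochner_Integration.integral_cong[OF refl]) (simp add: green_minus[of \<kappa> x] mult_ac)
    then show "(\<integral>t. green \<kappa> (t - x) * f x * \<psi> t \<partial>lborel) = f x * (\<integral>t. green \<kappa> (x - t) * \<psi> t \<partial>lborel)"
      by (simp only: integral_mult_right_zero)
  qed
  finally show ?thesis .
qed

text \<open>For every test function \<open>\<psi>\<close> the integral of u \<open>\<psi>\<close>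
  equals that of f (G * \<open>\<psi>\<close>), hence that of (G * f) \<open>\<psi>\<close>; the
  fundamental lemma then identifies u with G * f. The disjunction \<open>inf\<close> holds the two
  kinds of behaviour at infinity that make the commutator vanish.\<close>

lemma helmholtz_representation:
  fixes u f :: "real \<Rightarrow> complex"
  assumes \<kappa>: "\<kappa> \<noteq> 0" "Im \<kappa> \<ge> 0"
    and u: "\<And>R. set_integrable lborel {-R..R} u" and f: "integrable lborel f"
    and E: "\<And>\<psi> \<psi>' \<psi>'' r. smooth \<psi> \<Longrightarrow> r > 0 \<Longrightarrow> (\<And>x. \<bar>x\<bar> > r \<Longrightarrow> \<psi> x = 0) \<Longrightarrow>
       (\<And>x. (\<psi> has_vector_derivative \<psi>' x) (at x)) \<Longrightarrow> (\<And>x. (\<psi>' has_vector_derivative \<psi>'' x) (at x)) \<Longrightarrow>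
       (\<integral>x. u x * \<psi>'' x \<partial>lborel) + \<kappa>\<^sup>2 * (\<integral>x. u x * \<psi> x \<partial>lborel) = - (\<integral>x. f x * \<psi> x \<partial>lborel)"
    and inf: "u \<in> borel_measurable lborel \<and> integrable lborel (\<lambda>x. (norm (u x))\<^sup>2) \<or>
      (\<exists>w w'. (AE x in lborel. w x = u x) \<and> (\<forall>x. (w has_vector_derivative w' x) (at x)) \<and>
        (\<lambda>x. complex_of_real (sgn x) * w' x - \<i> * \<kappa> * w x) \<in> o[at_infinity](\<lambda>_. 1))"
  shows "AE t in lborel. u t = green_conv \<kappa> f t"
proof -
  define v where "v = green_conv \<kappa> f"
  have mv [measurable]: "v \<in> borel_measurable lborel"
    using green_conv_borel[of f \<kappa>] f by (simp add: v_def)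
  define B where "B = (\<integral>x. norm (f x) \<partial>lborel) / (2 * norm \<kappa>)"
  have vB: "norm (v t) \<le> B" for t unfolding v_def B_def by (rule norm_green_conv_le[OF \<kappa>(2) f])
  have v: "set_integrable lborel {-R..R} v" for R
    unfolding set_integrable_def
  proof (rule Bochner_Integration.integrable_bound)
    show "integrable lborel (\<lambda>x. indicator {-R..R} x *\<^sub>R B)"
      by (rule borel_integrable_compact) auto
    show "(\<lambda>x. indicator {-R..R} x *\<^sub>R v x) \<in> borel_measurable lborel" by measurable
    show "AE x in lborel. norm (indicator {-R..R} x *\<^sub>R v x) \<le> norm (indicator {-R..R} x *\<^sub>R B)"
      by (rule AE_I2) (use vB in \<open>auto simp: indicator_def intro: order_trans[OF _ abs_ge_self]\<close>)
  qed
  have "AE x in lborel. u x - v x = 0"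
  proof (rule AE_zero_of_test_integrals)
    show "set_integrable lborel {-R..R} (\<lambda>x. u x - v x)" for R
      by (rule set_integral_diff(1)[OF u v])
    fix \<psi> :: "real \<Rightarrow> complex" and r
    assume \<psi>: "smooth \<psi>" "r > 0" "\<And>x. \<bar>x\<bar> > r \<Longrightarrow> \<psi> x = 0"
    have c\<psi>: "continuous_on UNIV \<psi>" by (rule smooth_continuous_on[OF \<psi>(1)])
    have i\<psi>: "integrable lborel \<psi>"
    proof -
      have "integrable lborel (\<lambda>x. indicator {-r..r} x *\<^sub>R \<psi> x)"
        by (rule borel_integrable_compact[OF compact_Icc continuous_on_subset[OF c\<psi> subset_UNIV]])
      moreover have "indicator {-r..r} x *\<^sub>R \<psi> x = \<psi> x" for x
        using \<psi>(3)[of x] by (cases "\<bar>x\<bar> > r") (auto simp: indicator_def)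
      ultimately show ?thesis by (simp only:)
    qed
    obtain \<Phi> \<Phi>' where \<Phi>: "\<And>x. (\<Phi> has_vector_derivative \<Phi>' x) (at x)"
      "\<And>x. (\<Phi>' has_vector_derivative - \<kappa>\<^sup>2 * \<Phi> x - \<psi> x) (at x)" "smooth \<Phi>"
      "\<And>x. \<Phi> x = (\<integral>t. green \<kappa> (x - t) * \<psi> t \<partial>lborel)"
      "\<And>x. \<bar>x\<bar> \<ge> r \<Longrightarrow> \<Phi>' x = of_real (sgn x) * \<i> * \<kappa> * \<Phi> x"
    proof (rule green_potential[OF \<kappa>(1) \<psi>(1,3,2)])
      fix \<Phi> \<Phi>' assume a: "\<And>x. (\<Phi> has_vector_derivative \<Phi>' x) (at x)"
      "\<And>x. (\<Phi>' has_vector_derivative - \<kappa>\<^sup>2 * \<Phi> x - \<psi> x) (at x)" "smooth \<Phi>"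
      "\<And>x. \<Phi> x = (\<integral>t. green \<kappa> (x - t) * \<psi> t \<partial>lborel)"
      "\<And>x. \<bar>x\<bar> \<ge> r \<Longrightarrow> \<Phi>' x = of_real (sgn x) * \<i> * \<kappa> * \<Phi> x"
      show ?thesis by (rule that[OF a])
    qed
    have bd: "norm (\<Phi> x) \<le> (\<integral>x. norm (\<psi> x) \<partial>lborel) / (2 * norm \<kappa>)" for x
      using norm_green_conv_le[OF \<kappa>(2) i\<psi>, of x] unfolding green_conv_def \<Phi>(4) .
    have sm': "smooth \<Phi>'" using smooth_real_iff[OF \<Phi>(1)] \<Phi>(3) by blast
    have tail: "(\<lambda>n. \<integral>x. u x * (2 * of_real (dplateau (real n) x) * \<Phi>' x + of_real (ddplateau (real n) x) * \<Phi> x) \<partial>lborel) \<longlonglongrightarrow> 0"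
      using inf
    proof (elim disjE conjE exE)
      assume "u \<in> borel_measurable lborel" "integrable lborel (\<lambda>x. (norm (u x))\<^sup>2)"
      then show ?thesis
        by (rule tail_square_integrable[OF _ _ smooth_continuous_on[OF \<Phi>(3)] smooth_continuous_on[OF sm'] bd \<Phi>(5)])
    next
      fix w w'
      assume w: "AE x in lborel. w x = u x" "\<forall>x. (w has_vector_derivative w' x) (at x)"
        "(\<lambda>x. complex_of_real (sgn x) * w' x - \<i> * \<kappa> * w x) \<in> o[at_infinity](\<lambda>_. 1)"
      show ?thesis
        by (rule tail_outgoing[OF u w(1) w(2)[rule_format] w(3) \<Phi>(1,3) bd \<Phi>(5)])
    qed
    have "(\<integral>x. u x * \<psi> x \<partial>lborel) = (\<integral>x. f x * \<Phi> x \<partial>lborel)"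
      by (rule weak_solution_representation[OF u f E \<psi>(1,3,2) \<Phi>(1,2,3) bd tail])
    also have "\<dots> = (\<integral>x. v x * \<psi> x \<partial>lborel)"
      unfolding v_def integral_green_conv_mult[OF \<kappa>(2) f i\<psi>] \<Phi>(4) ..
    finally have eq: "(\<integral>x. u x * \<psi> x \<partial>lborel) = (\<integral>x. v x * \<psi> x \<partial>lborel)" .
    have "(\<integral>x. (u x - v x) * \<psi> x \<partial>lborel) = (\<integral>x. u x * \<psi> x - v x * \<psi> x \<partial>lborel)"
      by (simp add: algebra_simps)
    also have "\<dots> = (\<integral>x. u x * \<psi> x \<partial>lborel) - (\<integral>x. v x * \<psi> x \<partial>lborel)"
      by (rule Bochner_Integration.integral_diff[OF integrable_mult_compact_support[OF u c\<psi> \<psi>(3)]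
           integrable_mult_compact_support[OF v c\<psi> \<psi>(3)]])
    finally show "(\<integral>x. (u x - v x) * \<psi> x \<partial>lborel) = 0" using eq by simp
  qed
  then show ?thesis by (simp add: v_def)
qed

text \<open>Pointwise, |G * f| is at most the L^1 norm of f divided by 2 |\<open>\<kappa>\<close>|.
  Cauchy-Schwarz on A costs one factor |A| in the squared L^1 norm, and integrating the constant
  bound over A costs the other.\<close>

lemma nn_integral_norm_square_green_conv_le:
  fixes f :: "real \<Rightarrow> complex"
  assumes \<kappa>: "Im \<kappa> \<ge> 0" and f: "integrable lborel f"
    and A: "A \<in> sets borel" "emeasure lborel A < \<infinity>" "\<And>x. x \<notin> A \<Longrightarrow> f x = 0"
  shows "(\<integral>\<^sup>+t\<in>A. (norm (green_conv \<kappa> f t))\<^sup>2 \<partial>lborel)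
     \<le> ennreal ((measure lborel A / (2 * norm \<kappa>))\<^sup>2) * (\<integral>\<^sup>+x. (norm (f x))\<^sup>2 \<partial>lborel)"
proof -
  have [measurable]: "f \<in> borel_measurable borel" "A \<in> sets borel" using f A by auto
  let ?N = "\<integral>x. norm (f x) \<partial>lborel"
  have N0: "?N \<ge> 0" by simp
  have mA: "emeasure lborel A = ennreal (measure lborel A)"
    using A(2) by (simp add: emeasure_eq_ennreal_measure)
  have "ennreal (?N\<^sup>2) = (\<integral>\<^sup>+x. norm (f x) \<partial>lborel)\<^sup>2"
    using nn_integral_eq_integral[OF integrable_norm[OF f]] by (simp add: ennreal_power)
  also have "\<dots> = (\<integral>\<^sup>+x. indicator A x * ennreal (norm (f x)) \<partial>lborel)\<^sup>2"
    by (intro arg_cong[where f = "\<lambda>x. x\<^sup>2"] nn_integral_cong) (use A(3) in \<open>auto simp: indicator_def\<close>)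
  also have "\<dots> \<le> (\<integral>\<^sup>+x. (indicator A x)\<^sup>2 \<partial>lborel) * (\<integral>\<^sup>+x. (ennreal (norm (f x)))\<^sup>2 \<partial>lborel)"
    by (rule Cauchy_Schwarz_nn_integral) measurable
  also have "(\<integral>\<^sup>+x. (indicator A x)\<^sup>2 \<partial>lborel) = (\<integral>\<^sup>+x. indicator A x \<partial>lborel)"
    by (intro nn_integral_cong) (auto simp: indicator_def)
  also have "\<dots> = ennreal (measure lborel A)" using mA by simp
  finally have CS: "ennreal (?N\<^sup>2) \<le> ennreal (measure lborel A) * (\<integral>\<^sup>+x. (norm (f x))\<^sup>2 \<partial>lborel)"
    by (simp add: ennreal_power)
  have "(\<integral>\<^sup>+t\<in>A. (norm (green_conv \<kappa> f t))\<^sup>2 \<partial>lborel) \<le> (\<integral>\<^sup>+t. ennreal ((?N / (2 * norm \<kappa>))\<^sup>2) * indicator A t \<partial>lborel)"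
    by (intro nn_integral_mono mult_right_mono ennreal_leI power_mono norm_green_conv_le[OF \<kappa> f]) auto
  also have "\<dots> = ennreal ((?N / (2 * norm \<kappa>))\<^sup>2) * ennreal (measure lborel A)"
    using mA by (simp add: nn_integral_cmult)
  also have "\<dots> = ennreal (measure lborel A / (2 * norm \<kappa>)\<^sup>2) * ennreal (?N\<^sup>2)"
    by (subst (1 2) ennreal_mult[symmetric]) (auto simp: power_divide)
  also have "\<dots> \<le> ennreal (measure lborel A / (2 * norm \<kappa>)\<^sup>2) * (ennreal (measure lborel A) * (\<integral>\<^sup>+x. (norm (f x))\<^sup>2 \<partial>lborel))"
    by (rule mult_left_mono[OF CS]) simp
  also have "\<dots> = ennreal ((measure lborel A / (2 * norm \<kappa>))\<^sup>2) * (\<integral>\<^sup>+x. (norm (f x))\<^sup>2 \<partial>lborel)"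
    unfolding mult.assoc[symmetric]
    by (subst ennreal_mult[symmetric]) (auto simp: power_divide power2_eq_square)
  finally show ?thesis .
qed

text \<open>With \<open>\<kappa>\<close> = i l the kernel has modulus exp(-l |x|) / (2 l), and each
  half-line contributes 1 / (2 l^2).\<close>

lemma nn_integral_norm_green:
  assumes l: "l > 0"
  shows "(\<integral>\<^sup>+x. norm (green (\<i> * of_real l) x) \<partial>lborel) \<le> ennreal (1 / l\<^sup>2)"
proof -
  let ?g = "\<lambda>x. exp (- l * x) / (2 * l)"
  have half: "(\<integral>\<^sup>+x. ennreal (?g x) * indicator {0..} x \<partial>lborel) = ennreal (1 / (2 * l\<^sup>2))"
  proof -
    have lim: "((\<lambda>x. - exp (- l * x) / (2 * l\<^sup>2)) \<longlongrightarrow> - 0 / (2 * l\<^sup>2)) at_top"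
    proof (intro tendsto_divide tendsto_minus tendsto_const)
      have "filterlim (\<lambda>x. l * x) at_top at_top"
        using l by (intro filterlim_tendsto_pos_mult_at_top[OF tendsto_const] filterlim_ident)
      then show "((\<lambda>x. exp (- l * x)) \<longlongrightarrow> 0) at_top"
        by (intro filterlim_compose[OF exp_at_bot]) (simp add: filterlim_uminus_at_bot)
    qed (use l in simp)
    have "(\<integral>\<^sup>+x. ennreal (?g x) * indicator {0..} x \<partial>lborel) = ennreal (- 0 / (2 * l\<^sup>2) - (- exp (- l * 0) / (2 * l\<^sup>2)))"
      by (rule nn_integral_FTC_atLeast[OF _ _ _ lim])
        (use l in \<open>auto intro!: derivative_eq_intros simp: power2_eq_square field_simps\<close>)
    then show ?thesis by simp
  qed
  \<comment> \<open>Only an inequality, because the origin is counted in both half-lines.\<close>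
  have "(\<integral>\<^sup>+x. norm (green (\<i> * of_real l) x) \<partial>lborel)
     \<le> (\<integral>\<^sup>+x. ennreal (?g x) * indicator {0..} x + ennreal (?g (- x)) * indicator {0..} (- x) \<partial>lborel)"
    by (intro nn_integral_mono) (use l in \<open>auto simp: norm_green norm_mult indicator_def\<close>)
  also have "\<dots> = (\<integral>\<^sup>+x. ennreal (?g x) * indicator {0..} x \<partial>lborel) + (\<integral>\<^sup>+x. ennreal (?g (- x)) * indicator {0..} (- x) \<partial>lborel)"
    by (rule nn_integral_add) measurable
  also have "(\<integral>\<^sup>+x. ennreal (?g (- x)) * indicator {0..} (- x) \<partial>lborel) = (\<integral>\<^sup>+x. ennreal (?g x) * indicator {0..} x \<partial>lborel)"
    by (subst (2) nn_integral_real_affine[where c = "-1" and t = 0]) auto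
  also have "(\<integral>\<^sup>+x. ennreal (?g x) * indicator {0..} x \<partial>lborel) + (\<integral>\<^sup>+x. ennreal (?g x) * indicator {0..} x \<partial>lborel) = ennreal (1 / l\<^sup>2)"
    unfolding half by (subst ennreal_plus[symmetric]) (auto simp: field_simps)
  finally show ?thesis .
qed

text \<open>Schur's test: Cauchy--Schwarz with the kernel split into its two square roots.\<close>
lemma nn_integral_norm_square_green_conv_decay:
  fixes f :: "real \<Rightarrow> complex"
  assumes l: "l > 0" and f: "integrable lborel f"
  shows "(\<integral>\<^sup>+t. (norm (green_conv (\<i> * of_real l) f t))\<^sup>2 \<partial>lborel)
     \<le> ennreal ((1 / l\<^sup>2)\<^sup>2) * (\<integral>\<^sup>+x. (norm (f x))\<^sup>2 \<partial>lborel)"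
proof -
  have [measurable]: "f \<in> borel_measurable borel" using f by auto
  define a where "a = (\<lambda>x. ennreal (norm (green (\<i> * of_real l) x)))"
  define b where "b = (\<lambda>x. ennreal (sqrt (norm (green (\<i> * of_real l) x))))"
  have [measurable]: "a \<in> borel_measurable borel" "b \<in> borel_measurable borel"
    unfolding a_def b_def by measurable
  have bb: "b x * b x = a x" for x
    unfolding a_def b_def by (subst ennreal_mult[symmetric]) auto
  let ?A = "ennreal (1 / l\<^sup>2)"
  \<comment> \<open>Schur's test needs the kernel integrated in each of its variables:
    \<open>A1\<close> fixes the output variable t, \<open>A2\<close> the input variable x.\<close>
  have A1: "(\<integral>\<^sup>+x. a (t - x) \<partial>lborel) \<le> ?A" for t
    using nn_integral_norm_green[OF l] nn_integral_real_affine[of a "-1" t] by (simp add: a_def)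
  have A2: "(\<integral>\<^sup>+t. a (t - x) \<partial>lborel) \<le> ?A" for x
    using nn_integral_norm_green[OF l] nn_integral_real_affine[of a 1 "-x"] by (simp add: a_def)
  have pw: "ennreal ((norm (green_conv (\<i> * of_real l) f t))\<^sup>2) \<le> ?A * (\<integral>\<^sup>+x. a (t - x) * (norm (f x))\<^sup>2 \<partial>lborel)" for t
  proof -
    have "ennreal (norm (green_conv (\<i> * of_real l) f t)) \<le> (\<integral>\<^sup>+x. norm (green (\<i> * of_real l) (t - x) * f x) \<partial>lborel)"
      unfolding green_conv_def
      by (rule integral_norm_bound_ennreal[OF green_mult_integrable[OF _ f]]) (use l in simp)
    also have "\<dots> = (\<integral>\<^sup>+x. b (t - x) * (b (t - x) * norm (f x)) \<partial>lborel)"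
      by (intro nn_integral_cong) (simp add: mult.assoc[symmetric] bb a_def ennreal_mult norm_mult)
    finally have "(ennreal (norm (green_conv (\<i> * of_real l) f t)))\<^sup>2 \<le> (\<integral>\<^sup>+x. b (t - x) * (b (t - x) * norm (f x)) \<partial>lborel)\<^sup>2"
      by (rule power_mono_ennreal)
    also have "\<dots> \<le> (\<integral>\<^sup>+x. (b (t - x))\<^sup>2 \<partial>lborel) * (\<integral>\<^sup>+x. (b (t - x) * norm (f x))\<^sup>2 \<partial>lborel)"
      by (rule Cauchy_Schwarz_nn_integral) measurable
    also have "\<dots> = (\<integral>\<^sup>+x. a (t - x) \<partial>lborel) * (\<integral>\<^sup>+x. a (t - x) * (norm (f x))\<^sup>2 \<partial>lborel)"
      by (simp add: power_mult_distrib bb[folded power2_eq_square] ennreal_power)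
    also have "\<dots> \<le> ?A * (\<integral>\<^sup>+x. a (t - x) * (norm (f x))\<^sup>2 \<partial>lborel)"
      by (rule mult_right_mono[OF A1]) simp
    finally show ?thesis by (simp add: ennreal_power)
  qed
  have "(\<integral>\<^sup>+t. (norm (green_conv (\<i> * of_real l) f t))\<^sup>2 \<partial>lborel) \<le> (\<integral>\<^sup>+t. ?A * (\<integral>\<^sup>+x. a (t - x) * (norm (f x))\<^sup>2 \<partial>lborel) \<partial>lborel)"
    by (rule nn_integral_mono[OF pw])
  also have "\<dots> = ?A * (\<integral>\<^sup>+t. \<integral>\<^sup>+x. a (t - x) * (norm (f x))\<^sup>2 \<partial>lborel \<partial>lborel)"
    by (rule nn_integral_cmult) measurable
  also have "(\<integral>\<^sup>+t. \<integral>\<^sup>+x. a (t - x) * (norm (f x))\<^sup>2 \<partial>lborel \<partial>lborel) = (\<integral>\<^sup>+x. \<integral>\<^sup>+t. a (t - x) * (norm (f x))\<^sup>2 \<partial>lborel \<partial>lborel)"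
    using lborel_pair.Fubini[of "\<lambda>(t, x). a (t - x) * (norm (f x))\<^sup>2"] by simp
  also have "\<dots> = (\<integral>\<^sup>+x. (\<integral>\<^sup>+t. a (t - x) \<partial>lborel) * (norm (f x))\<^sup>2 \<partial>lborel)"
    by (intro nn_integral_cong nn_integral_multc) measurable
  also have "\<dots> \<le> (\<integral>\<^sup>+x. ?A * (norm (f x))\<^sup>2 \<partial>lborel)"
    by (intro nn_integral_mono mult_right_mono A2) simp
  also have "\<dots> = ?A * (\<integral>\<^sup>+x. (norm (f x))\<^sup>2 \<partial>lborel)"
    by (rule nn_integral_cmult) measurable
  also have "?A * (?A * (\<integral>\<^sup>+x. (norm (f x))\<^sup>2 \<partial>lborel)) = ennreal ((1 / l\<^sup>2)\<^sup>2) * (\<integral>\<^sup>+x. (norm (f x))\<^sup>2 \<partial>lborel)"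
    unfolding mult.assoc[symmetric] by (subst ennreal_mult[symmetric]) (auto simp: power2_eq_square)
  finally show ?thesis by (simp add: mult_left_mono)
qed

section \<open>Parseval's inequality for the sine system\<close>

abbreviation unit_interval :: "real measure" where
  "unit_interval \<equiv> restrict_space lborel {0<..<1}"

definition sine :: "nat \<Rightarrow> real \<Rightarrow> real" where
  "sine m y = sin (real m * pi * y)"

lemma continuous_on_sine: "continuous_on S (sine m)"
  unfolding sine_def by (intro continuous_intros)

lemma finite_measure_unit_interval: "finite_measure unit_interval"
  by (rule finite_measureI) (simp add: emeasure_restrict_space)

lemma continuous_measurable_unit_interval:
  fixes f :: "real \<Rightarrow> 'b::euclidean_space"
  shows "continuous_on UNIV f \<Longrightarrow> f \<in> borel_measurable unit_interval"
  using borel_measurable_continuous_onI[of f] by (simp add: measurable_restrict_space1)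

lemma continuous_bounded_unit_interval:
  fixes f :: "real \<Rightarrow> real"
  assumes "continuous_on UNIV f"
  obtains C where "\<And>y. y \<in> {0..1} \<Longrightarrow> \<bar>f y\<bar> \<le> C"
proof -
  have "bounded (f ` {0..1})"
    by (intro compact_imp_bounded compact_continuous_image continuous_on_subset[OF assms]) auto
  then obtain C where C: "\<forall>z \<in> f ` {0..1}. norm z \<le> C"
    unfolding bounded_iff ..
  have "\<bar>f y\<bar> \<le> C" if "y \<in> {0..1}" for y
    using C imageI[OF that, of f] by auto
  then show ?thesis by (rule that)
qed

lemma continuous_integrable_unit_interval:
  fixes f :: "real \<Rightarrow> real"
  assumes "continuous_on UNIV f"
  shows "integrable unit_interval f"
proof -
  obtain C where C: "\<And>y. y \<in> {0..1} \<Longrightarrow> \<bar>f y\<bar> \<le> C"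
    using continuous_bounded_unit_interval[OF assms] by blast
  show ?thesis
    by (rule finite_measure.integrable_const_bound[OF finite_measure_unit_interval, where B = C])
      (use C continuous_measurable_unit_interval[OF assms] in \<open>auto simp: space_restrict_space intro!: AE_I2\<close>)
qed

lemma integral_unit_interval_eq:
  fixes f :: "real \<Rightarrow> real"
  assumes "continuous_on UNIV f"
  shows "(\<integral>y. f y \<partial>unit_interval) = integral {0..1} f"
proof -
  have "set_integrable lborel {0<..<1} f"
    using continuous_integrable_unit_interval[OF assms]
    by (simp add: integrable_restrict_space set_integrable_def)
  then show ?thesis
    using set_borel_integral_eq_integral(2)[of "{0<..<1}" f]
    by (simp add: integral_restrict_space set_lebesgue_integral_def integral_open_interval_real)
qed

lemma integral_cos_int:
  fixes n :: int
  assumes "n \<noteq> 0"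
  shows "integral {0..1} (\<lambda>y. cos (of_int n * pi * y)) = 0"
proof -
  have "((\<lambda>y. cos (of_int n * pi * y)) has_integral
      sin (of_int n * pi * 1) / (of_int n * pi) - sin (of_int n * pi * 0) / (of_int n * pi)) {0..1}"
    using assms by (intro fundamental_theorem_of_calculus)
      (auto intro!: derivative_eq_intros simp flip: has_real_derivative_iff_has_vector_derivative)
  moreover have "sin (of_int n * pi) = 0"
    unfolding sin_zero_iff_int2 by blast
  ultimately show ?thesis by (simp add: integral_unique)
qed

lemma sine_orthogonal:
  assumes "m > 0" "n > 0"
  shows "(\<integral>y. sine m y * sine n y \<partial>unit_interval) = (if m = n then 1 / 2 else 0)"
proof -
  have eq: "sine m y * sine n y = (cos (of_int (int m - int n) * pi * y) - cos (of_int (int m + int n) * pi * y)) / 2" for y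
    by (simp add: sine_def sin_times_sin algebra_simps)
  have c: "(\<lambda>y. cos (of_int k * pi * y)) integrable_on {0..1}" for k :: int
    by (intro integrable_continuous_real continuous_intros)
  have "(\<integral>y. sine m y * sine n y \<partial>unit_interval) = integral {0..1} (\<lambda>y. sine m y * sine n y)"
    by (rule integral_unit_interval_eq) (intro continuous_intros continuous_on_sine)
  also have "\<dots> = (integral {0..1} (\<lambda>y. cos (of_int (int m - int n) * pi * y)) - integral {0..1} (\<lambda>y. cos (of_int (int m + int n) * pi * y))) / 2"
    unfolding eq by (simp only: Henstock_Kurzweil_Integration.integral_divide Henstock_Kurzweil_Integration.integral_diff[OF c c])
  also have "integral {0..1} (\<lambda>y. cos (of_int (int m + int n) * pi * y)) = 0"
    by (rule integral_cos_int) (use assms in auto)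
  also have "integral {0..1} (\<lambda>y. cos (of_int (int m - int n) * pi * y)) = (if m = n then 1 else 0)"
  proof (cases "m = n")
    case False
    then show ?thesis using integral_cos_int[of "int m - int n"] by auto
  qed auto
  finally show ?thesis by (cases "m = n") simp_all
qed

text \<open>The factor 2 compensates for the squared norm 1/2 of each sine and matches
  \<open>mode_coeff\<close>; it is the reason why sums of squared coefficients are halved
  below.\<close>

definition sine_coeff :: "(real \<Rightarrow> real) \<Rightarrow> nat \<Rightarrow> real" where
  "sine_coeff h m = 2 * (\<integral>y. h y * sine m y \<partial>unit_interval)"

lemma square_integrable_mult:
  fixes f g :: "'a \<Rightarrow> real"
  assumes [measurable]: "f \<in> borel_measurable M" "g \<in> borel_measurable M"
    and "integrable M (\<lambda>x. (f x)\<^sup>2)" "integrable M (\<lambda>x. (g x)\<^sup>2)"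
  shows "integrable M (\<lambda>x. f x * g x)"
proof (rule Bochner_Integration.integrable_bound[OF Bochner_Integration.integrable_add[OF assms(3,4)]])
  have "\<bar>a * b\<bar> \<le> \<bar>a\<^sup>2 + b\<^sup>2\<bar>" for a b :: real
    using zero_le_power2[of "a - b"] zero_le_power2[of "a + b"]
    by (auto simp: power2_diff power2_sum abs_if)
  then show "AE x in M. norm (f x * g x) \<le> norm ((f x)\<^sup>2 + (g x)\<^sup>2)"
    by (intro AE_I2) simp
qed measurable

text \<open>Completing the square in the coefficients. The choice c = \<open>sine_coeff h\<close>
  gives Bessel's inequality; for any other c the extra term is nonnegative, so every approximation
  by sines bounds the Parseval defect from above.\<close>

lemma sine_expansion_error:
  fixes h :: "real \<Rightarrow> real"
  assumes h: "h \<in> borel_measurable unit_interval" "integrable unit_interval (\<lambda>y. (h y)\<^sup>2)"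
    and M: "finite M" "0 \<notin> M"
  shows "(\<integral>y. (h y - (\<Sum>m\<in>M. c m * sine m y))\<^sup>2 \<partial>unit_interval)
    = (\<integral>y. (h y)\<^sup>2 \<partial>unit_interval) - (\<Sum>m\<in>M. (sine_coeff h m)\<^sup>2) / 2 + (\<Sum>m\<in>M. (c m - sine_coeff h m)\<^sup>2) / 2"
proof -
  let ?N = unit_interval
  define P where "P = (\<lambda>y. \<Sum>m\<in>M. c m * sine m y)"
  have cP: "continuous_on UNIV P" unfolding P_def by (intro continuous_intros continuous_on_sine)
  have iP: "integrable ?N (\<lambda>y. (P y)\<^sup>2)"
    by (intro continuous_integrable_unit_interval continuous_intros cP)
  have ihs: "integrable ?N (\<lambda>y. h y * sine m y)" for m
    by (intro square_integrable_mult h continuous_measurable_unit_interval continuous_on_sine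
        continuous_integrable_unit_interval continuous_intros)
  have iss: "integrable ?N (\<lambda>y. sine m y * sine n y)" for m n
    by (intro continuous_integrable_unit_interval continuous_intros continuous_on_sine)
  have ihP: "integrable ?N (\<lambda>y. h y * P y)"
    by (intro square_integrable_mult h iP continuous_measurable_unit_interval cP)
  have "(\<integral>y. h y * P y \<partial>?N) = (\<integral>y. (\<Sum>m\<in>M. c m * (h y * sine m y)) \<partial>?N)"
    by (simp add: P_def sum_distrib_left mult_ac)
  also have "\<dots> = (\<Sum>m\<in>M. c m * (\<integral>y. h y * sine m y \<partial>?N))"
    by (subst Bochner_Integration.integral_sum) (auto intro!: integrable_mult_right ihs)
  also have "\<dots> = (\<Sum>m\<in>M. c m * sine_coeff h m) / 2"
    by (simp add: sine_coeff_def sum_divide_distrib)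
  finally have hP: "(\<integral>y. h y * P y \<partial>?N) = (\<Sum>m\<in>M. c m * sine_coeff h m) / 2" .
  have "(P y)\<^sup>2 = (\<Sum>m\<in>M. \<Sum>n\<in>M. (c m * c n) * (sine m y * sine n y))" for y
    unfolding P_def power2_eq_square sum_product by (intro sum.cong refl) simp
  then have "(\<integral>y. (P y)\<^sup>2 \<partial>?N) = (\<integral>y. (\<Sum>m\<in>M. \<Sum>n\<in>M. (c m * c n) * (sine m y * sine n y)) \<partial>?N)" by simp
  also have "\<dots> = (\<Sum>m\<in>M. \<Sum>n\<in>M. (c m * c n) * (\<integral>y. sine m y * sine n y \<partial>?N))"
    by (subst Bochner_Integration.integral_sum; (subst Bochner_Integration.integral_sum)?)
      (auto intro!: integrable_mult_right iss Bochner_Integration.integrable_sum)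
  also have "\<dots> = (\<Sum>m\<in>M. \<Sum>n\<in>M. (c m * c n) * (if m = n then 1 / 2 else 0))"
    using M(2) by (intro sum.cong refl arg_cong2[where f = "(*)"] sine_orthogonal) (metis not_gr_zero)+
  also have "\<dots> = (\<Sum>m\<in>M. (c m)\<^sup>2) / 2"
    using M(1) by (simp add: if_distrib sum.delta sum_divide_distrib power2_eq_square cong: if_cong)
  finally have PP: "(\<integral>y. (P y)\<^sup>2 \<partial>?N) = (\<Sum>m\<in>M. (c m)\<^sup>2) / 2" .
  have "(\<integral>y. (h y - P y)\<^sup>2 \<partial>?N) = (\<integral>y. ((h y)\<^sup>2 - 2 * (h y * P y)) + (P y)\<^sup>2 \<partial>?N)"
    by (simp add: power2_diff algebra_simps)
  also have "\<dots> = (\<integral>y. (h y)\<^sup>2 - 2 * (h y * P y) \<partial>?N) + (\<integral>y. (P y)\<^sup>2 \<partial>?N)"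
    by (rule Bochner_Integration.integral_add[OF Bochner_Integration.integrable_diff[OF h(2) integrable_mult_right[OF ihP]] iP])
  also have "(\<integral>y. (h y)\<^sup>2 - 2 * (h y * P y) \<partial>?N) = (\<integral>y. (h y)\<^sup>2 \<partial>?N) - (\<integral>y. 2 * (h y * P y) \<partial>?N)"
    by (rule Bochner_Integration.integral_diff[OF h(2) integrable_mult_right[OF ihP]])
  also have "(\<integral>y. 2 * (h y * P y) \<partial>?N) = (\<Sum>m\<in>M. c m * sine_coeff h m)"
    using hP by simp
  finally have F: "(\<integral>y. (h y - P y)\<^sup>2 \<partial>?N) = (\<integral>y. (h y)\<^sup>2 \<partial>?N) - (\<Sum>m\<in>M. c m * sine_coeff h m) + (\<integral>y. (P y)\<^sup>2 \<partial>?N)" .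
  have "(\<Sum>m\<in>M. (c m - sine_coeff h m)\<^sup>2) = (\<Sum>m\<in>M. (c m)\<^sup>2) + (\<Sum>m\<in>M. (sine_coeff h m)\<^sup>2) - 2 * (\<Sum>m\<in>M. c m * sine_coeff h m)"
    by (simp add: power2_diff sum.distrib sum_subtractf sum_distrib_left mult.assoc)
  then show ?thesis
    using F[unfolded PP] unfolding P_def by linarith
qed

section \<open>Density of sine polynomials\<close>

inductive trig_poly :: "(real \<Rightarrow> real) \<Rightarrow> bool" where
  sine: "trig_poly (\<lambda>y. c * sine m y)"
| add: "trig_poly f \<Longrightarrow> trig_poly g \<Longrightarrow> trig_poly (\<lambda>y. f y + g y)"

lemma trig_poly_cmult: "trig_poly f \<Longrightarrow> trig_poly (\<lambda>y. c * f y)"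
proof (induction rule: trig_poly.induct)
  case (sine d m)
  then show ?case using trig_poly.sine[of "c * d" m] by (simp add: mult.assoc)
next
  case (add f g)
  then show ?case using trig_poly.add[of "\<lambda>y. c * f y" "\<lambda>y. c * g y"] by (simp add: distrib_left)
qed

text \<open>Product-to-sum formula: the frequency m goes to m + 1 and m - 1. Allowing frequency 0,
  which is the zero function, makes m = 1 an ordinary case.\<close>

lemma trig_poly_mult_cos: "trig_poly f \<Longrightarrow> trig_poly (\<lambda>y. cos (pi * y) * f y)"
proof (induction rule: trig_poly.induct)
  case (sine c m)
  show ?case
  proof (cases m)
    case 0
    then show ?thesis using trig_poly.sine[of 0 0] by (simp add: sine_def)
  next
    case (Suc n)
    have "cos (pi * y) * (c * sine m y) = c / 2 * sine (Suc m) y + c / 2 * sine n y" for y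
    proof -
      have "real m * pi * y + pi * y = real (Suc m) * pi * y" "real m * pi * y - pi * y = real n * pi * y"
        using Suc by (simp_all add: algebra_simps)
      then have *: "sin (real m * pi * y) * cos (pi * y) = (sin (real (Suc m) * pi * y) + sin (real n * pi * y)) / 2"
        using sin_times_cos[of "real m * pi * y" "pi * y"] by (simp only:)
      have "cos (pi * y) * (c * sine m y) = c * (sin (real m * pi * y) * cos (pi * y))"
        by (simp add: sine_def)
      also have "\<dots> = c / 2 * sine (Suc m) y + c / 2 * sine n y"
        unfolding * sine_def by (simp only: distrib_left times_divide_eq_right times_divide_eq_left add_divide_distrib)
      finally show ?thesis .
    qed
    then show ?thesis by (simp only:) (intro trig_poly.intros)
  qed
next
  case (add f g)
  then show ?case
    using trig_poly.add[of "\<lambda>y. cos (pi * y) * f y" "\<lambda>y. cos (pi * y) * g y"] by (simp add: distrib_left)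
qed

lemma trig_poly_sum:
  assumes "finite A" "\<And>i. i \<in> A \<Longrightarrow> trig_poly (f i)"
  shows "trig_poly (\<lambda>y. \<Sum>i\<in>A. f i y)"
  using assms
proof (induction A rule: finite_induct)
  case empty
  then show ?case using trig_poly.sine[of 0 0] by simp
qed (auto intro: trig_poly.add)

lemma trig_poly_coeffs:
  assumes "trig_poly f"
  obtains c N where "\<And>y. f y = (\<Sum>m=1..N::nat. c m * sine m y)"
proof -
  \<comment> \<open>That the coefficients vanish beyond N is added for the induction: two sums can
    then be extended to the same range and added termwise.\<close>
  have "\<exists>c N. (\<forall>m>N. c m = 0) \<and> (\<forall>y. f y = (\<Sum>m=1..N::nat. c m * sine m y))"
    using assms
  proof (induction rule: trig_poly.induct)
    case (sine c m)
    show ?case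
    proof (cases "m = 0")
      case True
      then show ?thesis by (intro exI[of _ "\<lambda>_. 0"]) (auto simp: sine_def)
    next
      case False
      then show ?thesis
        by (intro exI[of _ "\<lambda>n. if n = m then c else 0"] exI[of _ m])
          (auto simp: if_distrib if_distribR sum.delta cong: if_cong)
    qed
  next
    case (add f g)
    from add.IH(1) obtain c N where c': "\<forall>m>N. c m = 0" "\<forall>y. f y = (\<Sum>m=1..N::nat. c m * sine m y)"
      by blast
    from add.IH(2) obtain d K where d': "\<forall>m>K. d m = 0" "\<forall>y. g y = (\<Sum>m=1..K::nat. d m * sine m y)"
      by blast
    note c = c'[rule_format] and d = d'[rule_format]
    have "f y = (\<Sum>m=1..max N K. c m * sine m y)" for y
      unfolding c(2) by (rule sum.mono_neutral_left) (auto simp: c(1))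
    moreover have "g y = (\<Sum>m=1..max N K. d m * sine m y)" for y
      unfolding d(2) by (rule sum.mono_neutral_left) (auto simp: d(1))
    ultimately have "f y + g y = (\<Sum>m=1..max N K. (c m + d m) * sine m y)" for y
      by (simp only: sum.distrib distrib_right)
    moreover have "c m + d m = 0" if "m > max N K" for m using c(1)[of m] d(1)[of m] that by simp
    ultimately have "(\<forall>m>max N K. c m + d m = 0) \<and> (\<forall>y. f y + g y = (\<Sum>m=1..max N K. (c m + d m) * sine m y))"
      by simp
    then show ?case
      by - (rule exI[of _ "\<lambda>m. c m + d m"], rule exI[of _ "max N K"], assumption)
  qed
  then obtain c N where c: "\<forall>y. f y = (\<Sum>m=1..N::nat. c m * sine m y)" by (elim exE conjE)
  show ?thesis by (rule that) (rule c[rule_format])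
qed

text \<open>Divide by \<open>sin (\<pi> y)\<close> and approximate the quotient by polynomials in \<open>cos (\<pi> y)\<close>.\<close>
lemma trig_poly_uniform_approx:
  fixes G :: "real \<Rightarrow> real"
  assumes G: "continuous_on UNIV G" "\<And>y. y \<notin> {d..1 - d} \<Longrightarrow> G y = 0" "0 < d" "d < 1 / 2" and e: "e > 0"
  obtains P where "trig_poly P" "\<And>y. y \<in> {0..1} \<Longrightarrow> \<bar>G y - P y\<bar> < e"
proof -
  \<comment> \<open>The maximum with sin(pi d) keeps the denominator positive at the end points.
    Where G may be nonzero the maximum is sin(pi y) itself, so r is the true quotient there.\<close>
  define r where "r = (\<lambda>y. G y / max (sin (pi * y)) (sin (pi * d)))"
  have sd: "sin (pi * d) > 0" using G(3,4) by (intro sin_gt_zero) auto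
  have cr: "continuous_on UNIV r"
    unfolding r_def using sd by (intro continuous_intros G(1)) auto
  have Gr: "G y = sin (pi * y) * r y" for y
  proof (cases "y \<in> {d..1 - d}")
    case True
    have pos: "- (pi / 2) \<le> pi * d"
      using mult_pos_pos[OF pi_gt_zero G(3)] pi_gt_zero by linarith
    \<comment> \<open>Monotonicity of the sine on the left half of the interval, and the reflection
      y -> 1 - y for the right half.\<close>
    have "sin (pi * d) \<le> sin (pi * y)"
    proof (cases "y \<le> 1 / 2")
      case True
      then have "pi * d \<le> pi * y" "pi * y \<le> pi * (1 / 2)" using \<open>y \<in> _\<close> by (intro mult_left_mono; simp)+
      then show ?thesis using pos by (intro sin_monotone_2pi_le) simp_all
    next
      case False
      then have "pi * d \<le> pi * (1 - y)" "pi * (1 - y) \<le> pi * (1 / 2)" using \<open>y \<in> _\<close> by (intro mult_left_mono; simp)+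
      then have "sin (pi * d) \<le> sin (pi * (1 - y))" using pos by (intro sin_monotone_2pi_le) simp_all
      also have "\<dots> = sin (pi * y)" by (simp add: right_diff_distrib sin_diff)
      finally show ?thesis .
    qed
    then show ?thesis using sd by (simp add: r_def max_def)
  qed (simp add: r_def G(2))
  \<comment> \<open>The substitution t = cos(pi y) turns r into a continuous function on [-1, 1], to
    which the Weierstrass theorem applies.\<close>
  have "continuous_on {-1..1} (\<lambda>t. r (arccos t / pi))"
    by (rule continuous_on_compose2[OF cr]) (auto intro!: continuous_intros)
  then obtain p where p: "real_polynomial_function p" "\<And>t. t \<in> {-1..1} \<Longrightarrow> \<bar>r (arccos t / pi) - p t\<bar> < e"
    using Stone_Weierstrass_real_polynomial_function[of "{-1..1::real}" "\<lambda>t. r (arccos t / pi)" e] e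
    by auto
  obtain a n where pa: "p = (\<lambda>x. \<Sum>i\<le>n. a i * x ^ i)"
    using p(1) unfolding real_polynomial_function_iff_sum by blast
  define P where "P = (\<lambda>y. sin (pi * y) * p (cos (pi * y)))"
  have "trig_poly (\<lambda>y. sin (pi * y) * cos (pi * y) ^ i)" for i
  proof (induction i)
    case 0
    then show ?case using trig_poly.sine[of 1 1] by (simp add: sine_def[abs_def])
  next
    case (Suc i)
    from trig_poly_mult_cos[OF this] show ?case by (simp add: mult_ac)
  qed
  then have "trig_poly (\<lambda>y. \<Sum>i\<le>n. a i * (sin (pi * y) * cos (pi * y) ^ i))"
    by (intro trig_poly_sum trig_poly_cmult) auto
  then have "trig_poly P"
    by (simp add: P_def pa sum_distrib_left mult_ac)
  moreover have "\<bar>G y - P y\<bar> < e" if y: "y \<in> {0..1}" for y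
  proof -
    have "arccos (cos (pi * y)) / pi = y" using y by (subst arccos_cos) (auto simp: mult_left_le)
    then have "\<bar>r y - p (cos (pi * y))\<bar> < e" using p(2)[of "cos (pi * y)"] by simp
    \<comment> \<open>Multiplying by the sine again does not enlarge the error, since |sin| <=
      1.\<close>
    moreover have "\<bar>G y - P y\<bar> \<le> 1 * \<bar>r y - p (cos (pi * y))\<bar>"
      unfolding Gr P_def right_diff_distrib[symmetric] abs_mult by (intro mult_right_mono) auto
    ultimately show ?thesis by simp
  qed
  ultimately show ?thesis by (rule that)
qed

lemma AE_lebesgue_unit_interval:
  "AE y in lebesgue. P y \<Longrightarrow> AE y in unit_interval. P y"
  by (auto simp: AE_restrict_space_iff AE_completion_iff elim: eventually_mono)

lemma clamp_diff_le:
  fixes K a b :: real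
  assumes "K \<ge> 0"
  shows "\<bar>max (- K) (min K a)\<bar> \<le> K" "\<bar>a - max (- K) (min K a)\<bar> \<le> \<bar>a\<bar>"
  using assms by (auto simp: max_def min_def)

text \<open>Three reductions: h is truncated at a height k, the truncation is approximated almost
  everywhere by continuous functions, and these are clamped to the same height and cut off near the
  end points. Clamping makes a constant a dominating function.\<close>

lemma continuous_dense_unit_interval:
  fixes h :: "real \<Rightarrow> real"
  assumes h: "h \<in> borel_measurable borel" "integrable unit_interval (\<lambda>y. (h y)\<^sup>2)" and e: "e > 0"
  obtains G d where "continuous_on UNIV G" "\<And>y. y \<notin> {d..1 - d} \<Longrightarrow> G y = 0" "0 < d" "d < 1 / 2"
    "(\<integral>y. (h y - G y)\<^sup>2 \<partial>unit_interval) < e"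
proof -
  let ?N = unit_interval
  have [measurable]: "h \<in> borel_measurable ?N" using h(1) by (simp add: measurable_restrict_space1)
  define t where "t = (\<lambda>k::nat. \<lambda>y. max (- real k) (min (real k) (h y)))"
  have tm: "t k \<in> borel_measurable borel" for k unfolding t_def using h(1) by measurable
  have tN [measurable]: "t k \<in> borel_measurable ?N" for k using tm by (simp add: measurable_restrict_space1)
  have dh: "\<bar>h y - t k y\<bar> \<le> \<bar>h y\<bar>" for k y unfolding t_def by (rule clamp_diff_le) simp
  have "(\<lambda>k. \<integral>y. (h y - t k y)\<^sup>2 \<partial>?N) \<longlonglongrightarrow> (\<integral>y. 0 \<partial>?N)"
  proof (rule integral_dominated_convergence[where w = "\<lambda>y. (h y)\<^sup>2"])
    show "AE y in ?N. (\<lambda>k. (h y - t k y)\<^sup>2) \<longlonglongrightarrow> 0"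
    proof (rule AE_I2, rule tendsto_eventually)
      fix y
      obtain K :: nat where "\<bar>h y\<bar> < real K" using reals_Archimedean2 by blast
      then show "\<forall>\<^sub>F k in sequentially. (h y - t k y)\<^sup>2 = 0"
        by (intro eventually_sequentiallyI[of K]) (auto simp: t_def max_def min_def)
    qed
    show "AE y in ?N. norm ((h y - t k y)\<^sup>2) \<le> (h y)\<^sup>2" for k
      using dh by (intro AE_I2) (simp add: abs_le_square_iff)
  qed (use h(2) in auto)
  \<comment> \<open>The inequality (a + b)^2 <= 2 a^2 + 2 b^2 doubles each of the two errors, whence
    e / 4 for each.\<close>
  then have "\<forall>\<^sub>F k in sequentially. (\<integral>y. (h y - t k y)\<^sup>2 \<partial>?N) < e / 4"
    using e by (intro order_tendstoD(2)[where y = 0]) auto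
  then obtain k where k: "(\<integral>y. (h y - t k y)\<^sup>2 \<partial>?N) < e / 4"
    by (auto simp: eventually_sequentially)
  have ik: "integrable ?N (\<lambda>y. (h y - t k y)\<^sup>2)"
    by (rule Bochner_Integration.integrable_bound[OF h(2)])
      (use dh in \<open>auto simp: abs_le_square_iff\<close>)
  have "t k \<in> borel_measurable lebesgue" using tm by (simp add: measurable_completion)
  \<comment> \<open>Measurability in the sense of \<open>measurable_on\<close> provides continuous
    functions that converge to \<open>t k\<close> off a negligible set.\<close>
  then have "t k measurable_on UNIV" by (rule lebesgue_measurable_imp_measurable_on) simp
  then obtain Z g where Z: "negligible Z" and g: "\<And>n. continuous_on UNIV (g n)"
    and gl: "\<And>x. x \<notin> Z \<Longrightarrow> (\<lambda>n. g n x) \<longlonglongrightarrow> t k x"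
    unfolding measurable_on_def by auto
  define c where "c = (\<lambda>n y. max (- real k) (min (real k) (g n y)))"
  define G where "G = (\<lambda>n y. cutoff n y * c n y)"
  have tb: "\<bar>t k y\<bar> \<le> real k" for y unfolding t_def by (rule clamp_diff_le) simp
  have cb: "\<bar>c n y\<bar> \<le> real k" for n y unfolding c_def by (rule clamp_diff_le) simp
  have Gb: "\<bar>G n y\<bar> \<le> real k" for n y
    using mult_mono[OF abs_cutoff_le[of n y] cb[of n y]] by (simp add: G_def abs_mult)
  have cc: "continuous_on UNIV (cutoff n)" for n
    using cutoff_has_derivative by (meson DERIV_isCont continuous_at_imp_continuous_on)
  have cG: "continuous_on UNIV (G n)" for n
    unfolding G_def c_def by (intro continuous_intros g cc)
  have [measurable]: "G n \<in> borel_measurable ?N" for n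
    by (rule continuous_measurable_unit_interval[OF cG])
  have bd: "(t k y - G n y)\<^sup>2 \<le> (2 * real k)\<^sup>2" for n y
    using tb[of y] Gb[of n y] by (intro power2_le_iff_abs_le[THEN iffD2]) auto
  have kint: "integrable ?N (\<lambda>_. (2 * real k)\<^sup>2)"
    by (rule finite_measure.integrable_const[OF finite_measure_unit_interval])
  have iG: "integrable ?N (\<lambda>y. (t k y - G n y)\<^sup>2)" for n
    by (rule Bochner_Integration.integrable_bound[OF kint]) (use bd in auto)
  have "(\<lambda>n. \<integral>y. (t k y - G n y)\<^sup>2 \<partial>?N) \<longlonglongrightarrow> (\<integral>y. 0 \<partial>?N)"
  proof (rule integral_dominated_convergence[OF _ _ kint])
    have "AE y in lebesgue. y \<notin> Z" using Z by (simp add: negligible_iff_null_sets AE_not_in)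
    then have "AE y in ?N. y \<notin> Z" by (rule AE_lebesgue_unit_interval)
    then show "AE y in ?N. (\<lambda>n. (t k y - G n y)\<^sup>2) \<longlonglongrightarrow> 0"
    proof (rule AE_mp, intro AE_I2 impI)
      fix y assume y: "y \<in> space ?N" "y \<notin> Z"
      then have "0 < y" "y < 1" by (auto simp: space_restrict_space)
      then have "(\<lambda>n. cutoff n y) \<longlonglongrightarrow> 1" using eventually_cutoff(1) by (intro tendsto_eventually) auto
      moreover have "(\<lambda>n. c n y) \<longlonglongrightarrow> max (- real k) (min (real k) (t k y))"
        unfolding c_def by (intro tendsto_intros gl y)
      moreover have "max (- real k) (min (real k) (t k y)) = t k y" using tb[of y] by (auto simp: max_def min_def)
      ultimately have "(\<lambda>n. G n y) \<longlonglongrightarrow> 1 * t k y" unfolding G_def by (intro tendsto_mult) auto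
      then have "(\<lambda>n. (t k y - G n y)\<^sup>2) \<longlonglongrightarrow> (t k y - 1 * t k y)\<^sup>2" by (intro tendsto_intros)
      then show "(\<lambda>n. (t k y - G n y)\<^sup>2) \<longlonglongrightarrow> 0" by simp
    qed
    show "AE y in ?N. norm ((t k y - G n y)\<^sup>2) \<le> (2 * real k)\<^sup>2" for n using bd by auto
  qed auto
  then have "\<forall>\<^sub>F n in sequentially. (\<integral>y. (t k y - G n y)\<^sup>2 \<partial>?N) < e / 4"
    using e by (intro order_tendstoD(2)[where y = 0]) auto
  then obtain n0 where "\<And>n. n \<ge> n0 \<Longrightarrow> (\<integral>y. (t k y - G n y)\<^sup>2 \<partial>?N) < e / 4"
    by (auto simp: eventually_sequentially)
  \<comment> \<open>n >= 2 ensures that the margin 1/(n+1) is smaller than 1/2.\<close>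
  then obtain n where n: "(\<integral>y. (t k y - G n y)\<^sup>2 \<partial>?N) < e / 4" "n \<ge> 2"
    using max.cobounded1 max.cobounded2 by metis
  have le: "(h y - G n y)\<^sup>2 \<le> 2 * (h y - t k y)\<^sup>2 + 2 * (t k y - G n y)\<^sup>2" for y
    using square_sum_le[of "h y - t k y" "t k y - G n y"] by simp
  have "(\<integral>y. (h y - G n y)\<^sup>2 \<partial>?N) \<le> (\<integral>y. 2 * (h y - t k y)\<^sup>2 + 2 * (t k y - G n y)\<^sup>2 \<partial>?N)"
  proof (rule Bochner_Integration.integral_mono)
    show i: "integrable ?N (\<lambda>y. 2 * (h y - t k y)\<^sup>2 + 2 * (t k y - G n y)\<^sup>2)"
      using ik iG by auto
    show "integrable ?N (\<lambda>y. (h y - G n y)\<^sup>2)"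
      by (rule Bochner_Integration.integrable_bound[OF i]) (use le order_trans[OF le abs_ge_self] in auto)
  qed (rule le)
  also have "\<dots> = 2 * (\<integral>y. (h y - t k y)\<^sup>2 \<partial>?N) + 2 * (\<integral>y. (t k y - G n y)\<^sup>2 \<partial>?N)"
    using ik iG[of n] by (subst Bochner_Integration.integral_add) auto
  also have "\<dots> < e" using k n(1) by linarith
  finally have fin: "(\<integral>y. (h y - G n y)\<^sup>2 \<partial>?N) < e" .
  show ?thesis
  proof (rule that[OF cG _ _ _ fin])
    show "G n y = 0" if "y \<notin> {1 / (real n + 1)..1 - 1 / (real n + 1)}" for y
      using cutoff_eq_0[OF that] by (simp add: G_def)
    show "0 < 1 / (real n + 1)" "1 / (real n + 1) < 1 / 2" using n(2) by (auto simp: field_simps)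
  qed
qed

lemma sine_bessel:
  fixes h :: "real \<Rightarrow> real"
  assumes h: "h \<in> borel_measurable borel" "integrable unit_interval (\<lambda>y. (h y)\<^sup>2)"
  shows "(\<Sum>m=1..N. (sine_coeff h m)\<^sup>2) / 2 \<le> (\<integral>y. (h y)\<^sup>2 \<partial>unit_interval)"
proof -
  have "0 \<le> (\<integral>y. (h y - (\<Sum>m=1..N. sine_coeff h m * sine m y))\<^sup>2 \<partial>unit_interval)" by simp
  then show ?thesis
    by (subst (asm) sine_expansion_error) (use h in \<open>auto simp: measurable_restrict_space1\<close>)
qed

text \<open>h is close to some G, and G to a sine polynomial P. By
  \<open>sine_expansion_error\<close> the squared distance from h to P is at least the Parseval
  defect up to the degree of P, whatever the coefficients of P are.\<close>

lemma sine_parseval: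
  fixes h :: "real \<Rightarrow> real"
  assumes h: "h \<in> borel_measurable borel" "integrable unit_interval (\<lambda>y. (h y)\<^sup>2)" and e: "e > 0"
  obtains N where "(\<integral>y. (h y)\<^sup>2 \<partial>unit_interval) \<le> (\<Sum>m=1..N. (sine_coeff h m)\<^sup>2) / 2 + e"
proof -
  let ?N = unit_interval
  have hN [measurable]: "h \<in> borel_measurable ?N" using h(1) by (simp add: measurable_restrict_space1)
  obtain G d where G: "continuous_on UNIV G" "\<And>y. y \<notin> {d..1 - d} \<Longrightarrow> G y = 0" "0 < d" "d < 1 / 2"
    and hG: "(\<integral>y. (h y - G y)\<^sup>2 \<partial>?N) < e / 4"
    by (rule continuous_dense_unit_interval[OF h, of "e / 4"]) (use e in auto)
  \<comment> \<open>The interval has length 1, so a uniform error r amounts to a squared L^2 error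
    of at most e / 4.\<close>
  define r where "r = sqrt (e / 4)"
  have r: "r > 0" "r\<^sup>2 = e / 4" using e by (auto simp: r_def)
  obtain P where P: "trig_poly P" "\<And>y. y \<in> {0..1} \<Longrightarrow> \<bar>G y - P y\<bar> < r"
    using trig_poly_uniform_approx[OF G r(1)] by blast
  obtain c N where c: "\<And>y. P y = (\<Sum>m=1..N::nat. c m * sine m y)"
  proof (rule trig_poly_coeffs[OF P(1)])
    fix c and N :: nat
    assume a: "\<And>y. P y = (\<Sum>m=1..N. c m * sine m y)"
    show ?thesis by (rule that[OF a])
  qed
  then have Pc: "P = (\<lambda>y. \<Sum>m=1..N::nat. c m * sine m y)" by (intro ext)
  have cP: "continuous_on UNIV P" unfolding Pc by (intro continuous_intros continuous_on_sine)
  have [measurable]: "P \<in> borel_measurable ?N" "G \<in> borel_measurable ?N"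
    by (rule continuous_measurable_unit_interval; fact)+
  have iG: "integrable ?N (\<lambda>y. (G y - P y)\<^sup>2)"
    by (intro continuous_integrable_unit_interval continuous_intros G cP)
  have ihG: "integrable ?N (\<lambda>y. (h y - G y)\<^sup>2)"
  proof (rule Bochner_Integration.integrable_bound)
    show "integrable ?N (\<lambda>y. 2 * (h y)\<^sup>2 + 2 * (G y)\<^sup>2)"
      using h(2) continuous_integrable_unit_interval[OF continuous_on_power[OF G(1), of 2]] by auto
    show "AE y in ?N. norm ((h y - G y)\<^sup>2) \<le> norm (2 * (h y)\<^sup>2 + 2 * (G y)\<^sup>2)"
      using square_sum_le[of "h _" "- G _"] by (intro AE_I2) simp
  qed measurable
  have GP: "(\<integral>y. (G y - P y)\<^sup>2 \<partial>?N) \<le> e / 4"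
  proof -
    have "(\<integral>y. (G y - P y)\<^sup>2 \<partial>?N) \<le> (\<integral>y. e / 4 \<partial>?N)"
    proof (rule Bochner_Integration.integral_mono[OF iG finite_measure.integrable_const[OF finite_measure_unit_interval]])
      fix y assume "y \<in> space ?N"
      then have "\<bar>G y - P y\<bar> < r" by (intro P(2)) (auto simp: space_restrict_space)
      then show "(G y - P y)\<^sup>2 \<le> e / 4" unfolding r(2)[symmetric] by (intro power2_le_iff_abs_le[THEN iffD2]) (use r in auto)
    qed
    then show ?thesis by (simp add: measure_restrict_space space_restrict_space)
  qed
  have le: "(h y - P y)\<^sup>2 \<le> 2 * (h y - G y)\<^sup>2 + 2 * (G y - P y)\<^sup>2" for y
    using square_sum_le[of "h y - G y" "G y - P y"] by simp
  have "(\<integral>y. (h y - P y)\<^sup>2 \<partial>?N) \<le> (\<integral>y. 2 * (h y - G y)\<^sup>2 + 2 * (G y - P y)\<^sup>2 \<partial>?N)"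
  proof (rule Bochner_Integration.integral_mono)
    show i: "integrable ?N (\<lambda>y. 2 * (h y - G y)\<^sup>2 + 2 * (G y - P y)\<^sup>2)"
      using ihG iG by auto
    show "integrable ?N (\<lambda>y. (h y - P y)\<^sup>2)"
      by (rule Bochner_Integration.integrable_bound[OF i]) (use le order_trans[OF le abs_ge_self] in auto)
  qed (rule le)
  also have "\<dots> = 2 * (\<integral>y. (h y - G y)\<^sup>2 \<partial>?N) + 2 * (\<integral>y. (G y - P y)\<^sup>2 \<partial>?N)"
    using ihG iG by (subst Bochner_Integration.integral_add) auto
  also have "\<dots> \<le> e" using hG GP by linarith
  finally have "(\<integral>y. (h y - (\<Sum>m=1..N. c m * sine m y))\<^sup>2 \<partial>?N) \<le> e" unfolding Pc .
  moreover have "0 \<le> (\<Sum>m=1..N. (c m - sine_coeff h m)\<^sup>2)" by (intro sum_nonneg) simp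
  ultimately show ?thesis
    by (intro that[of N]) (subst (asm) sine_expansion_error[OF hN h(2)]; simp)
qed

section \<open>Sine coefficients of complex functions and their series\<close>

definition csine_coeff :: "(real \<Rightarrow> complex) \<Rightarrow> nat \<Rightarrow> complex" where
  "csine_coeff h m = 2 * (\<integral>y. h y * of_real (sine m y) \<partial>unit_interval)"

lemma csine_coeff_Re_Im:
  assumes "h \<in> borel_measurable borel" "integrable unit_interval (\<lambda>y. (norm (h y))\<^sup>2)"
  shows "(norm (csine_coeff h m))\<^sup>2 = (sine_coeff (\<lambda>y. Re (h y)) m)\<^sup>2 + (sine_coeff (\<lambda>y. Im (h y)) m)\<^sup>2"
proof -
  have "integrable unit_interval (\<lambda>y. h y * of_real (sine m y))"
  proof (rule cauchy_schwarz_integral(1)[OF _ _ assms(2)])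
    show "h \<in> borel_measurable unit_interval" using assms(1) by (simp add: measurable_restrict_space1)
    show "(\<lambda>y. complex_of_real (sine m y)) \<in> borel_measurable unit_interval"
      by (intro continuous_measurable_unit_interval continuous_intros continuous_on_sine)
    show "integrable unit_interval (\<lambda>y. (norm (complex_of_real (sine m y)))\<^sup>2)"
      by (intro continuous_integrable_unit_interval continuous_intros continuous_on_sine)
  qed
  then show ?thesis
    by (simp add: csine_coeff_def sine_coeff_def cmod_power2 power_mult_distrib flip: integral_Re integral_Im)
qed

lemma csine_square_integrable:
  assumes "h \<in> borel_measurable borel" "integrable unit_interval (\<lambda>y. (norm (h y))\<^sup>2)"
  shows "integrable unit_interval (\<lambda>y. (Re (h y))\<^sup>2)" "integrable unit_interval (\<lambda>y. (Im (h y))\<^sup>2)"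
    "(\<integral>y. (norm (h y))\<^sup>2 \<partial>unit_interval) = (\<integral>y. (Re (h y))\<^sup>2 \<partial>unit_interval) + (\<integral>y. (Im (h y))\<^sup>2 \<partial>unit_interval)"
proof -
  have [measurable]: "h \<in> borel_measurable unit_interval" using assms(1) by (simp add: measurable_restrict_space1)
  show 1: "integrable unit_interval (\<lambda>y. (Re (h y))\<^sup>2)"
    by (rule Bochner_Integration.integrable_bound[OF assms(2)]) (auto simp: cmod_power2)
  show 2: "integrable unit_interval (\<lambda>y. (Im (h y))\<^sup>2)"
    by (rule Bochner_Integration.integrable_bound[OF assms(2)]) (auto simp: cmod_power2)
  show "(\<integral>y. (norm (h y))\<^sup>2 \<partial>unit_interval) = (\<integral>y. (Re (h y))\<^sup>2 \<partial>unit_interval) + (\<integral>y. (Im (h y))\<^sup>2 \<partial>unit_interval)"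
    using 1 2 by (simp add: cmod_power2)
qed

lemma csine_bessel:
  assumes h: "h \<in> borel_measurable borel" "integrable unit_interval (\<lambda>y. (norm (h y))\<^sup>2)"
  shows "(\<Sum>m=1..N. (norm (csine_coeff h m))\<^sup>2) / 2 \<le> (\<integral>y. (norm (h y))\<^sup>2 \<partial>unit_interval)"
  using sine_bessel[OF _ csine_square_integrable(1)[OF h], of N] sine_bessel[OF _ csine_square_integrable(2)[OF h], of N] h(1)
  by (simp add: csine_coeff_Re_Im[OF h] csine_square_integrable(3)[OF h] sum.distrib add_divide_distrib)

lemma csine_parseval:
  assumes h: "h \<in> borel_measurable borel" "integrable unit_interval (\<lambda>y. (norm (h y))\<^sup>2)" and e: "e > 0"
  obtains N where "(\<integral>y. (norm (h y))\<^sup>2 \<partial>unit_interval) \<le> (\<Sum>m=1..N. (norm (csine_coeff h m))\<^sup>2) / 2 + e"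
proof -
  note i = csine_square_integrable[OF h]
  have [measurable]: "h \<in> borel_measurable borel" by fact
  have m: "(\<lambda>y. Re (h y)) \<in> borel_measurable borel" "(\<lambda>y. Im (h y)) \<in> borel_measurable borel" by measurable
  have e2: "e / 2 > 0" using e by simp
  obtain A where A: "(\<integral>y. (Re (h y))\<^sup>2 \<partial>unit_interval) \<le> (\<Sum>m=1..A. (sine_coeff (\<lambda>y. Re (h y)) m)\<^sup>2) / 2 + e / 2"
    using sine_parseval[OF m(1) i(1) e2] by blast
  obtain B where B: "(\<integral>y. (Im (h y))\<^sup>2 \<partial>unit_interval) \<le> (\<Sum>m=1..B. (sine_coeff (\<lambda>y. Im (h y)) m)\<^sup>2) / 2 + e / 2"
    using sine_parseval[OF m(2) i(2) e2] by blast
  have "(\<Sum>m=1..A. (sine_coeff (\<lambda>y. Re (h y)) m)\<^sup>2) \<le> (\<Sum>m=1..max A B. (sine_coeff (\<lambda>y. Re (h y)) m)\<^sup>2)"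
    by (rule sum_mono2) auto
  moreover have "(\<Sum>m=1..B. (sine_coeff (\<lambda>y. Im (h y)) m)\<^sup>2) \<le> (\<Sum>m=1..max A B. (sine_coeff (\<lambda>y. Im (h y)) m)\<^sup>2)"
    by (rule sum_mono2) auto
  ultimately show ?thesis
    using A B by (intro that[of "max A B"]) (simp add: csine_coeff_Re_Im[OF h] i(3) sum.distrib add_divide_distrib)
qed

text \<open>If the right-hand side is infinite there is nothing to show, so the nonnegative form
  needs no integrability. The index starts at \<open>Suc m\<close> because the modes start at
  1.\<close>

lemma nn_csine_bessel:
  assumes h: "h \<in> borel_measurable borel"
  shows "(\<Sum>m. ennreal ((norm (csine_coeff h (Suc m)))\<^sup>2 / 2)) \<le> (\<integral>\<^sup>+y. (norm (h y))\<^sup>2 \<partial>unit_interval)"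
proof (cases "(\<integral>\<^sup>+y. (norm (h y))\<^sup>2 \<partial>unit_interval) = \<infinity>")
  case False
  have "h \<in> borel_measurable unit_interval" using h by (simp add: measurable_restrict_space1)
  with False have i: "integrable unit_interval (\<lambda>y. (norm (h y))\<^sup>2)"
    by (intro integrableI_bounded) (auto simp: less_top)
  have "(\<Sum>m<N. ennreal ((norm (csine_coeff h (Suc m)))\<^sup>2 / 2)) \<le> ennreal (\<integral>y. (norm (h y))\<^sup>2 \<partial>unit_interval)" for N
  proof -
    have "(\<Sum>m<N. ennreal ((norm (csine_coeff h (Suc m)))\<^sup>2 / 2)) = ennreal ((\<Sum>m<N. (norm (csine_coeff h (Suc m)))\<^sup>2) / 2)"
      by (simp add: sum_ennreal sum_divide_distrib)
    also have "(\<Sum>m<N. (norm (csine_coeff h (Suc m)))\<^sup>2) = (\<Sum>m=1..N. (norm (csine_coeff h m))\<^sup>2)"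
      by (simp add: sum.atLeast1_atMost_eq)
    finally show ?thesis using csine_bessel[OF h i, of N] by (simp add: ennreal_leI)
  qed
  then show ?thesis
    using nn_integral_eq_integral[OF i] by (auto intro!: suminf_le_const)
qed simp

text \<open>Finiteness matters in this direction: for h outside L^2 the products with sines may fail
  to be integrable, the coefficients then default to 0, and the inequality can fail.\<close>

lemma nn_csine_parseval:
  assumes h: "h \<in> borel_measurable borel" and fin: "(\<integral>\<^sup>+y. (norm (h y))\<^sup>2 \<partial>unit_interval) < \<infinity>"
  shows "(\<integral>\<^sup>+y. (norm (h y))\<^sup>2 \<partial>unit_interval) \<le> (\<Sum>m. ennreal ((norm (csine_coeff h (Suc m)))\<^sup>2 / 2))"
proof (rule ennreal_le_epsilon)
  fix e :: real assume e: "e > 0"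
  have "h \<in> borel_measurable unit_interval" using h by (simp add: measurable_restrict_space1)
  with fin have i: "integrable unit_interval (\<lambda>y. (norm (h y))\<^sup>2)"
    by (intro integrableI_bounded) auto
  obtain N where N: "(\<integral>y. (norm (h y))\<^sup>2 \<partial>unit_interval) \<le> (\<Sum>m=1..N. (norm (csine_coeff h m))\<^sup>2) / 2 + e"
    using csine_parseval[OF h i e] by blast
  have "(\<integral>\<^sup>+y. (norm (h y))\<^sup>2 \<partial>unit_interval) = ennreal (\<integral>y. (norm (h y))\<^sup>2 \<partial>unit_interval)"
    using nn_integral_eq_integral[OF i] by simp
  also have "\<dots> \<le> ennreal ((\<Sum>m=1..N. (norm (csine_coeff h m))\<^sup>2) / 2 + e)" by (rule ennreal_leI[OF N])
  also have "(\<Sum>m=1..N. (norm (csine_coeff h m))\<^sup>2) / 2 = (\<Sum>m<N. (norm (csine_coeff h (Suc m)))\<^sup>2 / 2)"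
    by (simp add: sum.atLeast1_atMost_eq sum_divide_distrib)
  also have "ennreal (\<dots> + e) = (\<Sum>m<N. ennreal ((norm (csine_coeff h (Suc m)))\<^sup>2 / 2)) + ennreal e"
    using e by (subst ennreal_plus) (auto simp: sum_ennreal intro!: sum_nonneg)
  also have "\<dots> \<le> (\<Sum>m. ennreal ((norm (csine_coeff h (Suc m)))\<^sup>2 / 2)) + ennreal e"
    by (intro add_right_mono sum_le_suminf) auto
  finally show "(\<integral>\<^sup>+y. (norm (h y))\<^sup>2 \<partial>unit_interval) \<le> (\<Sum>m. ennreal ((norm (csine_coeff h (Suc m)))\<^sup>2 / 2)) + ennreal e" .
qed

section \<open>Borel representatives and Fubini\<close>

text \<open>Fubini is used for the product of two copies of \<open>lborel\<close>, which is not
  complete, so Lebesgue measurable functions are exchanged for Borel ones beforehand.\<close>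

lemma lebesgue_borel_representative:
  fixes w :: "'a::euclidean_space \<Rightarrow> complex"
  assumes "w \<in> borel_measurable lebesgue"
  obtains w0 where "w0 \<in> borel_measurable borel" "AE p in lborel. w p = w0 p"
proof -
  have "(\<lambda>p. Re (w p)) \<in> borel_measurable lebesgue" "(\<lambda>p. Im (w p)) \<in> borel_measurable lebesgue"
    using assms by measurable
  from this[THEN completion_ex_borel_measurable_real]
  obtain a b where a: "a \<in> borel_measurable lborel" "AE p in lborel. Re (w p) = a p"
    and b: "b \<in> borel_measurable lborel" "AE p in lborel. Im (w p) = b p" by blast
  show ?thesis
  proof (rule that)
    show "(\<lambda>p. Complex (a p) (b p)) \<in> borel_measurable borel"
      using a(1) b(1) by (simp add: borel_measurable_complex_iff)
    show "AE p in lborel. w p = Complex (a p) (b p)"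
      using a(2) b(2) by eventually_elim (simp add: complex_eq_iff)
  qed
qed

lemma integral_lebesgue_AE_borel:
  fixes F G :: "'a::euclidean_space \<Rightarrow> complex"
  assumes G: "G \<in> borel_measurable borel" and FG: "AE p in lborel. F p = G p"
  shows "integral\<^sup>L lebesgue F = integral\<^sup>L lborel G"
proof -
  have Gl: "G \<in> borel_measurable lebesgue" using G by (simp add: measurable_completion)
  have ae: "AE p in lebesgue. G p = F p" using FG by (auto simp: AE_completion_iff elim: eventually_mono)
  have Fl: "F \<in> borel_measurable lebesgue" by (rule borel_measurable_AE[OF Gl ae])
  have "integral\<^sup>L lebesgue F = integral\<^sup>L lebesgue G"
    by (rule integral_cong_AE[OF Fl Gl]) (use ae in \<open>auto elim: eventually_mono\<close>)
  also have "\<dots> = integral\<^sup>L lborel G" using G by (simp add: integral_completion)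
  finally show ?thesis .
qed

lemma integral_lebesgue_on_AE_borel:
  fixes F G :: "'a::euclidean_space \<Rightarrow> complex"
  assumes G: "G \<in> borel_measurable borel" and FG: "AE p in lborel. p \<in> S \<longrightarrow> F p = G p"
    and G0: "\<And>p. p \<notin> S \<Longrightarrow> G p = 0" and S: "S \<in> sets lebesgue"
  shows "integral\<^sup>L (lebesgue_on S) F = integral\<^sup>L lborel G"
proof -
  have "integral\<^sup>L (lebesgue_on S) F = integral\<^sup>L lebesgue (\<lambda>p. indicator S p *\<^sub>R F p)"
    using S by (intro integral_restrict_space) auto
  also have "\<dots> = integral\<^sup>L lborel G"
    by (rule integral_lebesgue_AE_borel[OF G]) (use FG G0 in \<open>auto simp: indicator_def elim: eventually_mono\<close>)
  finally show ?thesis .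
qed

lemma AE_fst:
  assumes "AE x in lborel. P x"
  shows "AE p in (lborel :: (real \<times> real) measure). P (fst p)"
proof -
  obtain N where N: "{x \<in> space lborel. \<not> P x} \<subseteq> N" "N \<in> null_sets lborel"
    using assms by (auto simp: eventually_ae_filter)
  have [measurable]: "N \<in> sets borel" using N(2) by auto
  have "AE p in lborel \<Otimes>\<^sub>M lborel. fst p \<notin> N"
  proof (rule lborel_pair.AE_pair_measure)
    show "{p \<in> space (lborel \<Otimes>\<^sub>M lborel). fst p \<notin> N} \<in> sets (lborel \<Otimes>\<^sub>M lborel)" by measurable
    show "AE x in lborel. AE y in lborel. fst (x, y) \<notin> N"
      using AE_not_in[OF N(2)] by eventually_elim simp
  qed
  then have "AE p in (lborel :: (real \<times> real) measure). fst p \<notin> N" unfolding lborel_prod .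
  then show ?thesis using N(1) by (auto elim!: eventually_mono)
qed

lemma csine_coeff_lborel:
  assumes "\<And>y. y \<notin> {0<..<1} \<Longrightarrow> h y = 0"
  shows "csine_coeff h m = 2 * (\<integral>y. h y * of_real (sine m y) \<partial>lborel)"
proof -
  have "indicator {0<..<1} y *\<^sub>R (h y * complex_of_real (sine m y)) = h y * of_real (sine m y)" for y
    using assms[of y] by (auto simp: indicator_def)
  then show ?thesis by (simp add: csine_coeff_def integral_restrict_space)
qed

text \<open>Almost every slice of a null set of the plane is a null set of the line, so for almost
  every x the two integrands agree almost everywhere in y.\<close>

lemma mode_coeff_AE:
  fixes u u0 :: "real \<times> real \<Rightarrow> complex"
  assumes u0: "u0 \<in> borel_measurable borel" and ae: "AE p in lborel. p \<in> strip \<longrightarrow> u p = u0 p"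
  shows "AE x in lborel. mode_coeff u m x = csine_coeff (\<lambda>y. u0 (x, y)) m"
proof -
  have "AE p in lborel \<Otimes>\<^sub>M lborel. p \<in> strip \<longrightarrow> u p = u0 p" using ae unfolding lborel_prod .
  from lborel_pair.AE_pair[OF this] show ?thesis
  proof eventually_elim
    case (elim x)
    let ?G = "\<lambda>y. indicator {0<..<1} y *\<^sub>R (u0 (x, y) * complex_of_real (sine m y))"
    have "u0 \<in> borel_measurable (borel \<Otimes>\<^sub>M borel)" using u0 by (simp add: borel_prod)
    then have [measurable]: "(\<lambda>y. u0 (x, y)) \<in> borel_measurable borel" by measurable
    have [measurable]: "sine m \<in> borel_measurable borel" by (rule borel_measurable_continuous_onI[OF continuous_on_sine])
    have G: "?G \<in> borel_measurable borel" by measurable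
    have "(\<integral>y. u (x, y) * complex_of_real (sin (real m * pi * y)) \<partial>lebesgue_on {0<..<1}) = integral\<^sup>L lborel ?G"
    proof (rule integral_lebesgue_on_AE_borel[OF G])
      show "AE y in lborel. y \<in> {0<..<1} \<longrightarrow> u (x, y) * complex_of_real (sin (real m * pi * y)) = ?G y"
        using elim by eventually_elim (auto simp: strip_def sine_def)
    qed auto
    then show ?case by (simp add: mode_coeff_def csine_coeff_def integral_restrict_space)
  qed
qed

section \<open>Fubini between functions on the strip and their modes\<close>

context
  fixes w :: "real \<times> real \<Rightarrow> complex"
  assumes w [measurable]: "w \<in> borel_measurable borel" and w0: "\<And>p. p \<notin> strip \<Longrightarrow> w p = 0"
    and wloc: "\<And>R. integrable lborel (\<lambda>p. indicator (slab R) p *\<^sub>R w p)"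
begin

lemma csine_coeff_section: "csine_coeff (\<lambda>y. w (x, y)) m = 2 * (\<integral>y. w (x, y) * of_real (sine m y) \<partial>lborel)"
  by (rule csine_coeff_lborel) (auto intro: w0 simp: strip_def)

lemma slab_mult_integrable:
  assumes "continuous_on UNIV a" "\<And>x. norm (a x) \<le> C"
  shows "integrable (lborel \<Otimes>\<^sub>M lborel) (\<lambda>p. (indicator (slab R) p *\<^sub>R w p) * (a (fst p) * complex_of_real (sine m (snd p))))"
  unfolding lborel_prod
proof (rule integrable_bounded_mult[OF wloc, where C = C])
  have "continuous_on UNIV (\<lambda>p. a (fst p) * complex_of_real (sine m (snd p)))"
    by (intro continuous_intros continuous_on_compose2[OF assms(1)] continuous_on_compose2[OF continuous_on_sine]) auto
  then show "(\<lambda>p. a (fst p) * complex_of_real (sine m (snd p))) \<in> borel_measurable lborel"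
    using borel_measurable_continuous_onI by simp
  have C0: "0 \<le> C" using norm_ge_zero[of "a 0"] assms(2)[of 0] by linarith
  show "norm (a (fst p) * complex_of_real (sine m (snd p))) \<le> C" for p
    using mult_mono[OF assms(2)[of "fst p"], of "\<bar>sine m (snd p)\<bar>" 1] C0 by (simp add: norm_mult sine_def)
qed

lemma csine_coeff_locally_integrable: "set_integrable lborel {-R..R} (\<lambda>x. csine_coeff (\<lambda>y. w (x, y)) m)"
proof -
  have "integrable lborel (\<lambda>x. \<integral>y. (indicator (slab (R + 1)) (x, y) *\<^sub>R w (x, y)) * (1 * complex_of_real (sine m y)) \<partial>lborel)"
    using lborel_pair.integrable_fst'[OF slab_mult_integrable[of "\<lambda>_. 1" 1 "R + 1" m]] by simp
  then have "integrable lborel (\<lambda>x. indicator {-R..R} x *\<^sub>R (2 * (\<integral>y. (indicator (slab (R + 1)) (x, y) *\<^sub>R w (x, y)) * (1 * complex_of_real (sine m y)) \<partial>lborel)))"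
    by (intro integrable_mult_indicator integrable_mult_right) auto
  moreover have "indicator {-R..R} x *\<^sub>R (2 * (\<integral>y. (indicator (slab (R + 1)) (x, y) *\<^sub>R w (x, y)) * (1 * complex_of_real (sine m y)) \<partial>lborel))
     = indicator {-R..R} x *\<^sub>R csine_coeff (\<lambda>y. w (x, y)) m" for x
  proof (cases "x \<in> {-R..R}")
    case True
    then have "indicator (slab (R + 1)) (x, y) *\<^sub>R w (x, y) = w (x, y)" for y
      using w0[of "(x, y)"] by (auto simp: slab_def strip_def indicator_def)
    then show ?thesis by (simp add: csine_coeff_section)
  qed simp
  ultimately show ?thesis unfolding set_integrable_def by (simp only:)
qed

text \<open>The y-integral of a slice against the sine is half of the coefficient, hence the
  division by 2.\<close>

lemma integral_mode_fubini:
  assumes a: "continuous_on UNIV a" "\<And>x. \<bar>x\<bar> > r \<Longrightarrow> a x = 0"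
  shows "(\<integral>p. w p * a (fst p) * complex_of_real (sine m (snd p)) \<partial>lborel) = (\<integral>x. csine_coeff (\<lambda>y. w (x, y)) m * a x \<partial>lborel) / 2"
proof -
  obtain C where C: "\<And>x. norm (a x) \<le> C" using compact_support_bounded[OF a] by blast
  have eq: "(indicator (slab (r + 1)) p *\<^sub>R w p) * (a (fst p) * complex_of_real (sine m (snd p)))
     = w p * a (fst p) * complex_of_real (sine m (snd p))" for p
  proof (cases "p \<in> slab (r + 1)")
    case False
    then have "p \<notin> strip \<or> \<bar>fst p\<bar> > r" by (cases p) (auto simp: slab_def strip_def)
    then show ?thesis using w0[of p] a(2)[of "fst p"] by auto
  qed simp
  have i: "integrable (lborel \<Otimes>\<^sub>M lborel) (\<lambda>p. w p * a (fst p) * complex_of_real (sine m (snd p)))"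
    using slab_mult_integrable[OF a(1) C, of "r + 1" m] unfolding eq .
  have "(\<integral>p. w p * a (fst p) * complex_of_real (sine m (snd p)) \<partial>lborel) = (\<integral>x. \<integral>y. w (x, y) * a x * complex_of_real (sine m y) \<partial>lborel \<partial>lborel)"
    using lborel_pair.integral_fst'[OF i] by (simp add: lborel_prod)
  also have "\<dots> = (\<integral>x. csine_coeff (\<lambda>y. w (x, y)) m * a x / 2 \<partial>lborel)"
  proof (rule Bochner_Integration.integral_cong[OF refl])
    fix x
    have "(\<integral>y. w (x, y) * a x * complex_of_real (sine m y) \<partial>lborel) = (\<integral>y. a x * (w (x, y) * complex_of_real (sine m y)) \<partial>lborel)"
      by (simp add: mult_ac)
    then show "(\<integral>y. w (x, y) * a x * complex_of_real (sine m y) \<partial>lborel) = csine_coeff (\<lambda>y. w (x, y)) m * a x / 2"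
      by (simp add: csine_coeff_section)
  qed
  also have "\<dots> = (\<integral>x. csine_coeff (\<lambda>y. w (x, y)) m * a x \<partial>lborel) / 2" by simp
  finally show ?thesis .
qed

end

lemma csine_coeff_borel:
  assumes "w \<in> borel_measurable (borel :: (real \<times> real) measure)"
  shows "(\<lambda>x. csine_coeff (\<lambda>y. w (x, y)) m) \<in> borel_measurable borel"
proof -
  have [measurable]: "w \<in> borel_measurable (borel \<Otimes>\<^sub>M borel)" using assms by (simp add: borel_prod)
  have [measurable]: "sine m \<in> borel_measurable borel" by (rule borel_measurable_continuous_onI[OF continuous_on_sine])
  have "(\<lambda>x. \<integral>y. indicator {0<..<1} y *\<^sub>R (w (x, y) * complex_of_real (sine m y)) \<partial>lborel) \<in> borel_measurable borel"
    by measurable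
  then show ?thesis by (simp add: csine_coeff_def integral_restrict_space)
qed

lemma csine_coeff_integrable:
  assumes w: "w \<in> borel_measurable borel" "integrable lborel w" "\<And>p. p \<notin> strip \<Longrightarrow> w p = 0"
  shows "integrable lborel (\<lambda>x. csine_coeff (\<lambda>y. w (x, y)) m)"
proof -
  have "continuous_on UNIV (\<lambda>p. complex_of_real (sine m (snd p)))"
    by (intro continuous_intros continuous_on_compose2[OF continuous_on_sine]) auto
  from borel_measurable_continuous_onI[OF this]
  have "(\<lambda>p. complex_of_real (sine m (snd p))) \<in> borel_measurable lborel" by simp
  then have "integrable lborel (\<lambda>p. w p * complex_of_real (sine m (snd p)))"
    by (rule integrable_bounded_mult[OF w(2), where C = 1]) (simp add: sine_def)
  then have "integrable (lborel \<Otimes>\<^sub>M lborel) (\<lambda>p. w p * complex_of_real (sine m (snd p)))" unfolding lborel_prod .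
  from lborel_pair.integrable_fst'[OF this]
  have "integrable lborel (\<lambda>x. 2 * (\<integral>y. w (x, y) * complex_of_real (sine m y) \<partial>lborel))" by simp
  moreover have "csine_coeff (\<lambda>y. w (x, y)) m = 2 * (\<integral>y. w (x, y) * of_real (sine m y) \<partial>lborel)" for x
    by (rule csine_coeff_lborel) (auto intro: w(3) simp: strip_def)
  ultimately show ?thesis by (simp only:)
qed

section \<open>The constants\<close>

lemma mode_k_square: "(mode_k k m)\<^sup>2 = of_real (k - (real m * pi)\<^sup>2)"
proof (cases "(real m)\<^sup>2 * pi\<^sup>2 < k")
  case True
  then show ?thesis
    by (simp add: mode_k_def power_mult_distrib flip: of_real_power of_real_diff of_real_mult)
next
  case False
  then have "(complex_of_real (sqrt ((real m)\<^sup>2 * pi\<^sup>2 - k)))\<^sup>2 = of_real ((real m)\<^sup>2 * pi\<^sup>2 - k)"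
    by (simp flip: of_real_power)
  then show ?thesis using False by (simp add: mode_k_def power_mult_distrib)
qed

lemma mode_k_nonzero:
  assumes "k \<notin> thresholds" "m \<ge> 1"
  shows "mode_k k m \<noteq> 0"
proof -
  have "(real m)\<^sup>2 * pi\<^sup>2 \<noteq> k" using assms unfolding thresholds_def by blast
  then show ?thesis by (auto simp: mode_k_def)
qed

lemma Im_mode_k: "Im (mode_k k m) \<ge> 0"
  by (auto simp: mode_k_def)

text \<open>Only the finitely many indices with a value not above that at m0 compete, so the infimum
  is a minimum of positive reals. This makes both \<open>delta_plus\<close> and a nontrivial
  \<open>delta_minus\<close> real and positive.\<close>

lemma Inf_ereal_pos:
  fixes g :: "nat \<Rightarrow> real"
  assumes "\<And>m. m \<in> A \<Longrightarrow> g m > 0" and fin: "\<And>c. finite {m \<in> A. g m \<le> c}" and "m0 \<in> A"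
  obtains d where "Inf {ereal (g m) | m. m \<in> A} = ereal d" "d > 0" "\<And>m. m \<in> A \<Longrightarrow> d \<le> g m"
proof -
  let ?F = "{m \<in> A. g m \<le> g m0}"
  have ne: "finite (g ` ?F)" "g ` ?F \<noteq> {}" using fin assms(3) by auto
  define d where "d = Min (g ` ?F)"
  have "d \<in> g ` ?F" unfolding d_def using ne by (rule Min_in)
  then obtain m1 where m1: "m1 \<in> A" "d = g m1" by auto
  have le: "d \<le> g m" if "m \<in> A" for m
  proof (cases "g m \<le> g m0")
    case True
    then show ?thesis unfolding d_def using ne that by (intro Min_le) auto
  next
    case False
    moreover have "d \<le> g m0" unfolding d_def using ne assms(3) by (intro Min_le) auto
    ultimately show ?thesis by linarith
  qed
  have "Inf {ereal (g m) | m. m \<in> A} = ereal d"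
    by (rule Inf_eqI) (use le m1 in auto)
  then show ?thesis using that m1 assms(1) le by blast
qed

text \<open>The constant enters the proof only through this disjunction. A propagating mode is
  governed by the \<open>delta_minus\<close> term and satisfies the first alternative; for an
  evanescent mode the term attaining the minimum decides which alternative holds, since
  |\<open>mode_k k m\<close>| >= \<open>delta_plus k\<close>.\<close>

lemma bound_const_dominates:
  assumes k: "k \<notin> thresholds"
  obtains b where "bound_const k D = ereal b" "b \<ge> 0"
    "\<And>m. m \<ge> 1 \<Longrightarrow> measure lebesgue D / (2 * norm (mode_k k m)) \<le> b \<or>
       ((real m)\<^sup>2 * pi\<^sup>2 > k \<and> 1 / (norm (mode_k k m))\<^sup>2 \<le> b)"
proof -
  let ?M = "measure lebesgue D" and ?g = "\<lambda>m. norm (mode_k k m)"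
  let ?P = "{m. m \<ge> 1 \<and> (real m)\<^sup>2 * pi\<^sup>2 > k}" and ?Q = "{m. m \<ge> 1 \<and> (real m)\<^sup>2 * pi\<^sup>2 < k}"
  have M0: "?M \<ge> 0" by simp
  \<comment> \<open>A crude growth bound showing that only finitely many thresholds lie below a
    given level.\<close>
  have bnd: "real m \<le> (real m)\<^sup>2 * pi\<^sup>2" if "m \<ge> 1" for m
  proof -
    have "real m * 1 \<le> real m * (real m * pi\<^sup>2)"
    proof (rule mult_left_mono)
      have "1 * 1 \<le> real m * pi\<^sup>2" using that pi_gt3 by (intro mult_mono) (auto intro: one_le_power)
      then show "1 \<le> real m * pi\<^sup>2" by simp
    qed simp
    then show ?thesis by (simp add: power2_eq_square mult.assoc)
  qed
  have fin: "finite {m. m \<ge> 1 \<and> (real m)\<^sup>2 * pi\<^sup>2 \<le> c}" for c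
    by (rule finite_subset[of _ "{..nat \<lceil>c\<rceil>}"]) (use bnd in \<open>force simp: le_nat_iff le_ceiling_iff intro: order_trans\<close>)+
  have gpos: "?g m > 0" if "m \<ge> 1" for m using mode_k_nonzero[OF k that] by simp
  obtain dp where dp: "delta_plus k = ereal dp" "dp > 0" "\<And>m. m \<in> ?P \<Longrightarrow> dp \<le> ?g m"
  proof -
    define m0 where "m0 = Suc (nat \<lceil>k\<rceil>)"
    have "k < real m0" unfolding m0_def by linarith
    then have "m0 \<in> ?P" using bnd[of m0] by (auto simp: m0_def)
    moreover have "finite {m \<in> ?P. ?g m \<le> c}" for c
    proof (rule finite_subset[OF _ fin[of "k + c\<^sup>2"]], safe)
      fix m assume m: "(real m)\<^sup>2 * pi\<^sup>2 > k" "?g m \<le> c"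
      then have "sqrt ((real m)\<^sup>2 * pi\<^sup>2 - k) \<le> c" by (auto simp: mode_k_def norm_mult)
      from sqrt_le_D[OF this] show "(real m)\<^sup>2 * pi\<^sup>2 \<le> k + c\<^sup>2" by linarith
    qed
    moreover have "delta_plus k = Inf {ereal (?g m) | m. m \<in> ?P}" by (simp add: delta_plus_def)
    ultimately show ?thesis using Inf_ereal_pos[of ?P ?g m0] gpos that by (smt (verit, best) mem_Collect_eq)
  qed
  obtain qm where qm: "ereal ?M / (2 * delta_minus k) = ereal qm" "qm \<ge> 0" "\<And>m. m \<in> ?Q \<Longrightarrow> ?M / (2 * ?g m) \<le> qm"
  proof (cases "?Q = {}")
    case True
    then have e: "{ereal (?g m) | m. m \<ge> 1 \<and> (real m)\<^sup>2 * pi\<^sup>2 < k} = {}" by blast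
    \<comment> \<open>Without propagating modes the infimum over the empty set is infinite, and the
      quotient is 0.\<close>
    have "delta_minus k = \<infinity>" unfolding delta_minus_def e by (simp add: top_ereal_def)
    then show ?thesis using that[of 0] True by auto
  next
    case False
    then obtain m0 where m0: "m0 \<in> ?Q" by blast
    have f: "finite {m \<in> ?Q. ?g m \<le> c}" for c
      by (rule finite_subset[OF _ fin[of k]]) auto
    obtain dm where dm: "Inf {ereal (?g m) | m. m \<in> ?Q} = ereal dm" "dm > 0" "\<And>m. m \<in> ?Q \<Longrightarrow> dm \<le> ?g m"
      by (rule Inf_ereal_pos[OF _ f m0]) (use gpos in auto)
    have "delta_minus k = ereal dm" using dm(1) by (simp add: delta_minus_def)
    then have "ereal ?M / (2 * delta_minus k) = ereal (?M / (2 * dm))" using dm(2) by simp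
    moreover have "?M / (2 * ?g m) \<le> ?M / (2 * dm)" if "m \<in> ?Q" for m
      using dm(2) dm(3)[OF that] gpos[of m] that by (intro divide_left_mono mult_pos_pos) simp_all
    ultimately show ?thesis using that[of "?M / (2 * dm)"] dm(2) by simp
  qed
  define b where "b = max qm (min (?M / (2 * dp)) (1 / dp\<^sup>2))"
  have "bound_const k D = ereal b"
    unfolding bound_const_def qm(1) dp(1) b_def using dp(2)
    by (simp add: ereal_max ereal_min power2_eq_square one_ereal_def)
  moreover have "b \<ge> 0" using qm(2) by (simp add: b_def)
  moreover have "?M / (2 * ?g m) \<le> b \<or> ((real m)\<^sup>2 * pi\<^sup>2 > k \<and> 1 / (?g m)\<^sup>2 \<le> b)" if m: "m \<ge> 1" for m
  proof (cases "(real m)\<^sup>2 * pi\<^sup>2 < k")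
    case True
    then show ?thesis using qm(3)[of m] m by (auto simp: b_def)
  next
    case False
    moreover have "(real m)\<^sup>2 * pi\<^sup>2 \<noteq> k" using k m unfolding thresholds_def by blast
    ultimately have P: "(real m)\<^sup>2 * pi\<^sup>2 > k" by linarith
    then have d: "dp \<le> ?g m" using dp(3) m by simp
    have "?M / (2 * ?g m) \<le> ?M / (2 * dp)" using d dp(2) gpos[OF m] by (intro divide_left_mono mult_pos_pos) simp_all
    moreover have "1 / (?g m)\<^sup>2 \<le> 1 / dp\<^sup>2" using d dp(2) gpos[OF m] by (intro divide_left_mono power_mono mult_pos_pos zero_less_power) simp_all
    ultimately show ?thesis using P by (auto simp: b_def max_def min_def)
  qed
  ultimately show ?thesis by (rule that)
qed

section \<open>Conclusion\<close>

text \<open>Parseval is used for u and Bessel for f, slice by slice, so each expansion is needed in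
  one direction only. The exchange of sums and integrals is free because all terms are
  nonnegative.\<close>

lemma AE_zero_of_contraction:
  fixes u0 f0 :: "real \<times> real \<Rightarrow> complex" and \<kappa> :: "nat \<Rightarrow> complex"
  assumes u0: "u0 \<in> borel_measurable borel" "\<And>p. p \<notin> strip \<Longrightarrow> u0 p = 0"
    and uloc: "\<And>n::nat. (\<integral>\<^sup>+p. indicator (slab (real n)) p * ennreal ((norm (u0 p))\<^sup>2) \<partial>lborel) < \<infinity>"
    and f0: "f0 \<in> borel_measurable borel" "\<And>p. norm (f0 p) \<le> \<beta> * norm (u0 p)" "\<And>p. fst p \<notin> J \<Longrightarrow> f0 p = 0"
    and J: "J \<in> sets borel" and Ufin: "(\<integral>\<^sup>+p. indicator (J \<times> UNIV) p * ennreal ((norm (u0 p))\<^sup>2) \<partial>lborel) < \<infinity>"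
    and b: "b \<ge> 0" "\<beta> \<ge> 0" "b * \<beta> < 1"
    and rep: "\<And>m. m \<ge> 1 \<Longrightarrow> AE x in lborel. csine_coeff (\<lambda>y. u0 (x, y)) m = green_conv (\<kappa> m) (\<lambda>x. csine_coeff (\<lambda>y. f0 (x, y)) m) x"
    and bnd: "\<And>m. m \<ge> 1 \<Longrightarrow> (\<integral>\<^sup>+x\<in>J. (norm (green_conv (\<kappa> m) (\<lambda>x. csine_coeff (\<lambda>y. f0 (x, y)) m) x))\<^sup>2 \<partial>lborel)
        \<le> ennreal (b\<^sup>2) * (\<integral>\<^sup>+x. (norm (csine_coeff (\<lambda>y. f0 (x, y)) m))\<^sup>2 \<partial>lborel)"
  shows "AE p in lborel. u0 p = 0"
proof -
  define um where "um = (\<lambda>m x. csine_coeff (\<lambda>y. u0 (x, y)) m)"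
  define fm where "fm = (\<lambda>m x. csine_coeff (\<lambda>y. f0 (x, y)) m)"
  have [measurable]: "u0 \<in> borel_measurable (borel \<Otimes>\<^sub>M borel)" "f0 \<in> borel_measurable (borel \<Otimes>\<^sub>M borel)"
    "J \<in> sets borel" using u0(1) f0(1) J by (simp_all add: borel_prod)
  have [measurable]: "um m \<in> borel_measurable borel" "fm m \<in> borel_measurable borel" for m
    unfolding um_def fm_def by (rule csine_coeff_borel[OF u0(1)] csine_coeff_borel[OF f0(1)])+
  have sec: "(\<lambda>y. u0 (x, y)) \<in> borel_measurable borel" "(\<lambda>y. f0 (x, y)) \<in> borel_measurable borel" for x
    by measurable
  define Su where "Su = (\<lambda>x. \<integral>\<^sup>+y. (norm (u0 (x, y)))\<^sup>2 \<partial>lborel)"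
  define Sf where "Sf = (\<lambda>x. \<integral>\<^sup>+y. (norm (f0 (x, y)))\<^sup>2 \<partial>lborel)"
  have [measurable]: "Su \<in> borel_measurable borel" "Sf \<in> borel_measurable borel" unfolding Su_def Sf_def by measurable
  have ui: "(\<integral>\<^sup>+y. (norm (h y))\<^sup>2 \<partial>unit_interval) = (\<integral>\<^sup>+y. (norm (h y))\<^sup>2 \<partial>lborel)"
    if "\<And>y. y \<notin> {0<..<1} \<Longrightarrow> h y = 0" for h :: "real \<Rightarrow> complex"
  proof -
    have "ennreal ((norm (h y))\<^sup>2) * indicator {0<..<1} y = ennreal ((norm (h y))\<^sup>2)" for y
      using that[of y] by (auto simp: indicator_def)
    then show ?thesis by (simp add: nn_integral_restrict_space)
  qed
  have u00: "u0 (x, y) = 0" if "y \<notin> {0<..<1}" for x y using u0(2)[of "(x, y)"] that by (auto simp: strip_def)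
  have f00: "f0 (x, y) = 0" if "y \<notin> {0<..<1}" for x y using f0(2)[of "(x, y)"] u00[OF that, of x] by simp
  have uiu: "(\<integral>\<^sup>+y. (norm (u0 (x, y)))\<^sup>2 \<partial>unit_interval) = Su x" for x
    unfolding Su_def by (rule ui) (rule u00)
  have uif: "(\<integral>\<^sup>+y. (norm (f0 (x, y)))\<^sup>2 \<partial>unit_interval) = Sf x" for x
    unfolding Sf_def by (rule ui) (rule f00)
  have pars: "Su x \<le> (\<Sum>m. ennreal ((norm (um (Suc m) x))\<^sup>2 / 2))" if "Su x < \<infinity>" for x
    using nn_csine_parseval[OF sec(1)[of x]] that unfolding uiu um_def by blast
  have bess: "(\<Sum>m. ennreal ((norm (fm (Suc m) x))\<^sup>2 / 2)) \<le> Sf x" for x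
    using nn_csine_bessel[OF sec(2)[of x]] unfolding uif fm_def .
  \<comment> \<open>Parseval requires square integrable slices; local square integrability on the
    slabs provides them for almost every x.\<close>
  have Sufin: "AE x in lborel. Su x < \<infinity>"
  proof -
    have "AE x in lborel. \<bar>x\<bar> < real n \<longrightarrow> Su x < \<infinity>" for n
    proof -
      have "(\<integral>\<^sup>+x. \<integral>\<^sup>+y. indicator (slab (real n)) (x, y) * ennreal ((norm (u0 (x, y)))\<^sup>2) \<partial>lborel \<partial>lborel) < \<infinity>"
      proof -
        have [measurable]: "slab (real n) \<in> sets borel"
          unfolding slab_def by (intro borel_open open_Times) auto
        have m: "(\<lambda>p. indicator (slab (real n)) p * ennreal ((norm (u0 p))\<^sup>2)) \<in> borel_measurable (lborel \<Otimes>\<^sub>M lborel)"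
          unfolding lborel_prod using u0(1) by measurable
        have "(\<integral>\<^sup>+x. \<integral>\<^sup>+y. indicator (slab (real n)) (x, y) * ennreal ((norm (u0 (x, y)))\<^sup>2) \<partial>lborel \<partial>lborel)
           = (\<integral>\<^sup>+p. indicator (slab (real n)) p * ennreal ((norm (u0 p))\<^sup>2) \<partial>(lborel \<Otimes>\<^sub>M lborel))"
          by (rule lborel.nn_integral_fst[OF m])
        then show ?thesis using uloc[of n] by (simp only: lborel_prod)
      qed
      moreover have "(\<integral>\<^sup>+y. indicator (slab (real n)) (x, y) * ennreal ((norm (u0 (x, y)))\<^sup>2) \<partial>lborel) = indicator {-real n<..<real n} x * Su x" for x
      proof -
        have "indicator (slab (real n)) (x, y) * ennreal ((norm (u0 (x, y)))\<^sup>2) = indicator {-real n<..<real n} x * ennreal ((norm (u0 (x, y)))\<^sup>2)" for y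
          using u00[of y x] by (auto simp: slab_def indicator_def)
        then show ?thesis by (simp add: Su_def nn_integral_cmult)
      qed
      ultimately have "(\<integral>\<^sup>+x. indicator {-real n<..<real n} x * Su x \<partial>lborel) < \<infinity>" by simp
      then have "AE x in lborel. indicator {-real n<..<real n} x * Su x \<noteq> \<infinity>"
        by (intro nn_integral_PInf_AE) auto
      then show ?thesis by eventually_elim (auto simp: indicator_def less_top abs_less_iff)
    qed
    then have "AE x in lborel. \<forall>n. \<bar>x\<bar> < real n \<longrightarrow> Su x < \<infinity>" unfolding AE_all_countable by blast
    then show ?thesis by eventually_elim (use reals_Archimedean2 in blast)
  qed
  define U where "U = (\<integral>\<^sup>+p. indicator (J \<times> UNIV) p * ennreal ((norm (u0 p))\<^sup>2) \<partial>lborel)"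
  have "J \<times> (UNIV :: real set) \<in> sets (borel \<Otimes>\<^sub>M borel)" by measurable
  then have [measurable]: "J \<times> (UNIV :: real set) \<in> sets borel" unfolding borel_prod .
  have JU: "(\<lambda>p. indicator (J \<times> UNIV) p * ennreal ((norm (u0 p))\<^sup>2)) \<in> borel_measurable (lborel \<Otimes>\<^sub>M lborel)"
    unfolding lborel_prod using u0(1) by measurable
  have mf: "(\<lambda>p. ennreal ((norm (f0 p))\<^sup>2)) \<in> borel_measurable (lborel \<Otimes>\<^sub>M lborel)"
    and mu: "(\<lambda>p. ennreal ((norm (u0 p))\<^sup>2)) \<in> borel_measurable (lborel \<Otimes>\<^sub>M lborel)"
    unfolding lborel_prod using u0(1) f0(1) by measurable
  have U_eq: "U = (\<integral>\<^sup>+x. indicator J x * Su x \<partial>lborel)"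
  proof -
    have "U = (\<integral>\<^sup>+p. indicator (J \<times> UNIV) p * ennreal ((norm (u0 p))\<^sup>2) \<partial>(lborel \<Otimes>\<^sub>M lborel))"
      unfolding U_def lborel_prod ..
    also have "\<dots> = (\<integral>\<^sup>+x. \<integral>\<^sup>+y. indicator (J \<times> UNIV) (x, y) * ennreal ((norm (u0 (x, y)))\<^sup>2) \<partial>lborel \<partial>lborel)"
      by (rule lborel.nn_integral_fst[OF JU, symmetric])
    also have "\<dots> = (\<integral>\<^sup>+x. indicator J x * Su x \<partial>lborel)"
    proof (rule nn_integral_cong)
      fix x
      have "indicator (J \<times> UNIV) (x, y) = (indicator J x :: ennreal)" for y :: real by (simp add: indicator_def)
      then show "(\<integral>\<^sup>+y. indicator (J \<times> UNIV) (x, y) * ennreal ((norm (u0 (x, y)))\<^sup>2) \<partial>lborel) = indicator J x * Su x"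
        by (simp add: Su_def nn_integral_cmult)
    qed
    finally show ?thesis .
  qed
  have Sf_eq: "(\<integral>\<^sup>+x. Sf x \<partial>lborel) = (\<integral>\<^sup>+p. (norm (f0 p))\<^sup>2 \<partial>lborel)"
    unfolding Sf_def using lborel.nn_integral_fst[OF mf] unfolding lborel_prod .
  have fU: "(\<integral>\<^sup>+p. (norm (f0 p))\<^sup>2 \<partial>lborel) \<le> ennreal (\<beta>\<^sup>2) * U"
  proof -
    have "ennreal ((norm (f0 p))\<^sup>2) \<le> ennreal (\<beta>\<^sup>2) * (indicator (J \<times> UNIV) p * ennreal ((norm (u0 p))\<^sup>2))" for p
    proof (cases "fst p \<in> J")
      case True
      have "(norm (f0 p))\<^sup>2 \<le> (\<beta> * norm (u0 p))\<^sup>2" by (rule power_mono[OF f0(2)]) simp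
      then have "ennreal ((norm (f0 p))\<^sup>2) \<le> ennreal (\<beta>\<^sup>2 * (norm (u0 p))\<^sup>2)" by (simp add: power_mult_distrib ennreal_leI)
      moreover have "indicator (J \<times> UNIV) p = (1::ennreal)" using True by (cases p) auto
      ultimately show ?thesis by (simp add: ennreal_mult)
    qed (simp add: f0(3))
    then have "(\<integral>\<^sup>+p. (norm (f0 p))\<^sup>2 \<partial>lborel) \<le> (\<integral>\<^sup>+p. ennreal (\<beta>\<^sup>2) * (indicator (J \<times> UNIV) p * ennreal ((norm (u0 p))\<^sup>2)) \<partial>lborel)"
      by (intro nn_integral_mono)
    also have "\<dots> = ennreal (\<beta>\<^sup>2) * U"
      unfolding U_def using JU[unfolded lborel_prod] by (intro nn_integral_cmult)
    finally show ?thesis .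
  qed
  have umb: "(\<integral>\<^sup>+x. indicator J x * ennreal ((norm (um (Suc m) x))\<^sup>2 / 2) \<partial>lborel) \<le> ennreal (b\<^sup>2) * (\<integral>\<^sup>+x. ennreal ((norm (fm (Suc m) x))\<^sup>2 / 2) \<partial>lborel)" for m
  proof -
    have half: "ennreal (r / 2) = ennreal (1 / 2) * ennreal r" if "r \<ge> 0" for r
      using that by (subst ennreal_mult[symmetric]) auto
    have "(\<integral>\<^sup>+x. indicator J x * ennreal ((norm (um (Suc m) x))\<^sup>2 / 2) \<partial>lborel) = (\<integral>\<^sup>+x. ennreal (1 / 2) * (ennreal ((norm (green_conv (\<kappa> (Suc m)) (fm (Suc m)) x))\<^sup>2) * indicator J x) \<partial>lborel)"
      using rep[of "Suc m"] by (intro nn_integral_cong_AE) (auto simp: um_def fm_def half mult_ac elim!: eventually_mono)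
    also have "\<dots> = ennreal (1 / 2) * (\<integral>\<^sup>+x\<in>J. (norm (green_conv (\<kappa> (Suc m)) (fm (Suc m)) x))\<^sup>2 \<partial>lborel)"
      by (rule nn_integral_cmult) measurable
    also have "\<dots> \<le> ennreal (1 / 2) * (ennreal (b\<^sup>2) * (\<integral>\<^sup>+x. (norm (fm (Suc m) x))\<^sup>2 \<partial>lborel))"
      by (rule mult_left_mono[OF bnd[of "Suc m", folded fm_def[THEN fun_cong, THEN fun_cong]]]) (auto simp: fm_def)
    also have "\<dots> = ennreal (b\<^sup>2) * (ennreal (1 / 2) * (\<integral>\<^sup>+x. (norm (fm (Suc m) x))\<^sup>2 \<partial>lborel))" by (simp add: mult_ac)
    also have "ennreal (1 / 2) * (\<integral>\<^sup>+x. (norm (fm (Suc m) x))\<^sup>2 \<partial>lborel) = (\<integral>\<^sup>+x. ennreal ((norm (fm (Suc m) x))\<^sup>2 / 2) \<partial>lborel)"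
      by (subst nn_integral_cmult[symmetric]) (auto simp: half)
    finally show ?thesis .
  qed
  have "U \<le> (\<integral>\<^sup>+x. (\<Sum>m. indicator J x * ennreal ((norm (um (Suc m) x))\<^sup>2 / 2)) \<partial>lborel)"
    unfolding U_eq
  proof (rule nn_integral_mono_AE)
    show "AE x in lborel. indicator J x * Su x \<le> (\<Sum>m. indicator J x * ennreal ((norm (um (Suc m) x))\<^sup>2 / 2))"
      using Sufin
    proof eventually_elim
      case (elim x)
      from mult_left_mono[OF pars[OF elim], of "indicator J x"] show ?case
        by (simp only: ennreal_suminf_cmult zero_le)
    qed
  qed
  also have "\<dots> = (\<Sum>m. \<integral>\<^sup>+x. indicator J x * ennreal ((norm (um (Suc m) x))\<^sup>2 / 2) \<partial>lborel)"
    by (rule nn_integral_suminf) measurable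
  also have "\<dots> \<le> (\<Sum>m. ennreal (b\<^sup>2) * (\<integral>\<^sup>+x. ennreal ((norm (fm (Suc m) x))\<^sup>2 / 2) \<partial>lborel))"
    by (intro suminf_le umb) auto
  also have "\<dots> = ennreal (b\<^sup>2) * (\<integral>\<^sup>+x. (\<Sum>m. ennreal ((norm (fm (Suc m) x))\<^sup>2 / 2)) \<partial>lborel)"
    by (subst nn_integral_suminf) (auto simp: ennreal_suminf_cmult)
  also have "\<dots> \<le> ennreal (b\<^sup>2) * (\<integral>\<^sup>+x. Sf x \<partial>lborel)"
    by (intro mult_left_mono nn_integral_mono bess) simp
  also have "\<dots> \<le> ennreal (b\<^sup>2) * (ennreal (\<beta>\<^sup>2) * U)"
    unfolding Sf_eq by (rule mult_left_mono[OF fU]) simp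
  finally have contr: "U \<le> ennreal ((b * \<beta>)\<^sup>2) * U"
    by (simp add: mult.assoc[symmetric] ennreal_mult[symmetric] power_mult_distrib)
  \<comment> \<open>Here the finiteness of \<open>U\<close> is decisive: for infinite
    \<open>U\<close> the inequality \<open>contr\<close> would say nothing unless its factor were
    0.\<close>
  have "U = 0"
  proof -
    obtain r where r: "U = ennreal r" "r \<ge> 0" using Ufin unfolding U_def[symmetric] by (cases U) auto
    have "r \<le> (b * \<beta>)\<^sup>2 * r" using contr r by (simp add: ennreal_mult[symmetric])
    moreover have "(b * \<beta>)\<^sup>2 < 1" using b by (simp add: power_less_one_iff abs_square_less_1 mult_nonneg_nonneg)
    ultimately have "r = 0" using r(2) by (smt (verit) mult_less_cancel_right2)
    then show ?thesis using r by simp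
  qed
  then have "(\<integral>\<^sup>+p. (norm (f0 p))\<^sup>2 \<partial>lborel) = 0" using fU by simp
  then have "AE p in lborel. f0 p = 0"
    using f0(1) by (subst (asm) nn_integral_0_iff_AE) auto
  then have "AE p in lborel \<Otimes>\<^sub>M lborel. f0 p = 0" unfolding lborel_prod .
  from lborel_pair.AE_pair[OF this] have fz: "AE x in lborel. fm m x = 0" for m
  proof eventually_elim
    case (elim x)
    have e: "fm m x = 2 * (\<integral>y. f0 (x, y) * of_real (sine m y) \<partial>lborel)"
      unfolding fm_def by (rule csine_coeff_lborel[OF f00])
    have "(\<integral>y. f0 (x, y) * of_real (sine m y) \<partial>lborel) = 0"
      by (rule integral_eq_zero_AE) (use elim in \<open>auto elim: eventually_mono\<close>)
    then show ?case using e by simp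
  qed
  \<comment> \<open>The convolution representation holds on the whole line, so a vanishing source
    kills the modes outside J as well.\<close>
  have gz: "green_conv \<kappa>' (fm m) t = 0" for m t \<kappa>'
    unfolding green_conv_def by (rule integral_eq_zero_AE) (use fz[of m] in \<open>auto elim: eventually_mono\<close>)
  have uz: "AE x in lborel. um (Suc m) x = 0" for m
    using rep[of "Suc m"] gz[of "\<kappa> (Suc m)" "Suc m"] by (simp add: um_def fm_def)
  then have "AE x in lborel. \<forall>m. um (Suc m) x = 0" unfolding AE_all_countable by blast
  with Sufin have Sz: "AE x in lborel. Su x = 0"
  proof eventually_elim
    case (elim x)
    then show ?case using pars[of x] by simp
  qed
  have "(\<integral>\<^sup>+p. (norm (u0 p))\<^sup>2 \<partial>lborel) = (\<integral>\<^sup>+x. Su x \<partial>lborel)"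
    unfolding Su_def using lborel.nn_integral_fst[OF mu] unfolding lborel_prod by simp
  also have "\<dots> = 0" using Sz by (subst nn_integral_0_iff_AE) auto
  finally show ?thesis using u0(1) by (subst (asm) nn_integral_0_iff_AE) auto
qed


section \<open>From the Lebesgue formulation to Borel representatives\<close>

lemma integrable_lebesgue_AE_borel:
  fixes F G :: "'a::euclidean_space \<Rightarrow> 'b::euclidean_space"
  assumes F: "integrable lebesgue F" and G: "G \<in> borel_measurable borel" and FG: "AE p in lborel. F p = G p"
  shows "integrable lborel G"
proof -
  have Gl: "G \<in> borel_measurable lebesgue" using G by (simp add: measurable_completion)
  have ae: "AE p in lebesgue. F p = G p" using FG by (simp add: AE_completion_iff)
  have "integrable lebesgue G"
    using F integrable_cong_AE[OF borel_measurable_integrable[OF F] Gl ae] by simp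
  then show ?thesis using G by (simp add: integrable_completion)
qed

lemma integrable_lebesgue_on_AE_borel:
  fixes F G :: "'a::euclidean_space \<Rightarrow> 'b::euclidean_space"
  assumes F: "integrable (lebesgue_on S) F" and S: "S \<in> sets lebesgue" and G: "G \<in> borel_measurable borel"
    and FG: "AE p in lborel. indicator S p *\<^sub>R F p = G p"
  shows "integrable lborel G"
  using integrable_lebesgue_AE_borel[OF _ G FG] F S by (simp add: integrable_restrict_space)

lemma AE_lebesgue_on_iff: "S \<in> sets lebesgue \<Longrightarrow> (AE p in lebesgue_on S. P p) \<longleftrightarrow> (AE p in lborel. p \<in> S \<longrightarrow> P p)"
  by (simp add: AE_restrict_space_iff AE_completion_iff)

text \<open>The first alternative uses the sup bound of the kernel, which needs source and target
  restricted to J. The second, available for evanescent modes, uses Schur's test on the whole line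
  and then discards the complement of J.\<close>

lemma mode_bound:
  fixes f :: "real \<Rightarrow> complex"
  assumes f: "integrable lborel f" and J: "J \<in> sets borel" "emeasure lborel J < \<infinity>" "\<And>x. x \<notin> J \<Longrightarrow> f x = 0"
    and b: "b \<ge> 0" "measure lborel J / (2 * norm (mode_k k m)) \<le> b \<or>
       ((real m)\<^sup>2 * pi\<^sup>2 > k \<and> 1 / (norm (mode_k k m))\<^sup>2 \<le> b)"
  shows "(\<integral>\<^sup>+x\<in>J. (norm (green_conv (mode_k k m) f x))\<^sup>2 \<partial>lborel) \<le> ennreal (b\<^sup>2) * (\<integral>\<^sup>+x. (norm (f x))\<^sup>2 \<partial>lborel)"
  using b(2)
proof (elim disjE conjE)
  assume le: "measure lborel J / (2 * norm (mode_k k m)) \<le> b"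
  have "(\<integral>\<^sup>+x\<in>J. (norm (green_conv (mode_k k m) f x))\<^sup>2 \<partial>lborel)
     \<le> ennreal ((measure lborel J / (2 * norm (mode_k k m)))\<^sup>2) * (\<integral>\<^sup>+x. (norm (f x))\<^sup>2 \<partial>lborel)"
    by (rule nn_integral_norm_square_green_conv_le[OF Im_mode_k f J])
  also have "\<dots> \<le> ennreal (b\<^sup>2) * (\<integral>\<^sup>+x. (norm (f x))\<^sup>2 \<partial>lborel)"
    by (intro mult_right_mono ennreal_leI power_mono le) auto
  finally show ?thesis .
next
  assume k: "(real m)\<^sup>2 * pi\<^sup>2 > k" and le: "1 / (norm (mode_k k m))\<^sup>2 \<le> b"
  define l where "l = sqrt ((real m)\<^sup>2 * pi\<^sup>2 - k)"
  have l: "l > 0" "mode_k k m = \<i> * of_real l" "norm (mode_k k m) = l" using k by (auto simp: l_def mode_k_def norm_mult)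
  have "(\<integral>\<^sup>+x\<in>J. (norm (green_conv (mode_k k m) f x))\<^sup>2 \<partial>lborel) \<le> (\<integral>\<^sup>+x. (norm (green_conv (mode_k k m) f x))\<^sup>2 \<partial>lborel)"
    by (intro nn_integral_mono) (auto simp: indicator_def)
  also have "\<dots> \<le> ennreal ((1 / l\<^sup>2)\<^sup>2) * (\<integral>\<^sup>+x. (norm (f x))\<^sup>2 \<partial>lborel)"
    unfolding l(2) by (rule nn_integral_norm_square_green_conv_decay[OF l(1) f])
  also have "\<dots> \<le> ennreal (b\<^sup>2) * (\<integral>\<^sup>+x. (norm (f x))\<^sup>2 \<partial>lborel)"
    using le l by (intro mult_right_mono ennreal_leI power_mono) auto
  finally show ?thesis .
qed

text \<open>Rewrites the mode equation on the strip by Fubini as a weak equation on the line.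
  Admissibility supplies the matching alternative at infinity: the radiation condition of the
  representative w for propagating modes, square integrability for the others.\<close>

lemma admissible_mode_representation:
  fixes V u u0 f0 :: "real \<times> real \<Rightarrow> complex"
  assumes k: "k \<notin> thresholds" and adm: "admissible k V u" and m: "m \<ge> 1"
    and V: "V \<in> borel_measurable (lebesgue_on strip)" "AE p in lebesgue_on strip. norm (V p) \<le> B"
    and u0: "u0 \<in> borel_measurable borel" "\<And>p. p \<notin> strip \<Longrightarrow> u0 p = 0" "AE p in lborel. p \<in> strip \<longrightarrow> u p = u0 p"
    and uloc: "\<And>R. integrable lborel (\<lambda>p. indicator (slab R) p *\<^sub>R u0 p)"
    and f0: "f0 \<in> borel_measurable borel" "\<And>p. p \<notin> strip \<Longrightarrow> f0 p = 0" "AE p in lborel. p \<in> strip \<longrightarrow> V p * u p = f0 p"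
      "integrable lborel f0"
  shows "AE x in lborel. csine_coeff (\<lambda>y. u0 (x, y)) m = green_conv (mode_k k m) (\<lambda>x. csine_coeff (\<lambda>y. f0 (x, y)) m) x"
proof -
  have sol: "weak_solution k V u" using adm by (simp add: admissible_def)
  have floc: "integrable lborel (\<lambda>p. indicator (slab R) p *\<^sub>R f0 p)" for R
    by (rule integrable_mult_indicator[OF _ f0(4)]) (simp add: slab_def borel_open open_Times)
  let ?um = "\<lambda>x. csine_coeff (\<lambda>y. u0 (x, y)) m" and ?fm = "\<lambda>x. csine_coeff (\<lambda>y. f0 (x, y)) m"
  have ae: "AE x in lborel. mode_coeff u m x = ?um x" by (rule mode_coeff_AE[OF u0(1,3)])
  have conv: "(\<integral>p. W p * a (fst p) * complex_of_real (sin (real m * pi * snd p)) \<partial>lebesgue_on strip)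
      = (\<integral>x. csine_coeff (\<lambda>y. W0 (x, y)) m * a x \<partial>lborel) / 2"
    if W0: "W0 \<in> borel_measurable borel" "\<And>p. p \<notin> strip \<Longrightarrow> W0 p = 0" "AE p in lborel. p \<in> strip \<longrightarrow> W p = W0 p"
       "\<And>R. integrable lborel (\<lambda>p. indicator (slab R) p *\<^sub>R W0 p)"
      and a: "continuous_on UNIV a" "\<And>x. \<bar>x\<bar> > r \<Longrightarrow> a x = 0" for W W0 :: "real \<times> real \<Rightarrow> complex" and a r
  proof -
    have "(\<integral>p. W p * a (fst p) * complex_of_real (sin (real m * pi * snd p)) \<partial>lebesgue_on strip)
       = (\<integral>p. W0 p * a (fst p) * complex_of_real (sine m (snd p)) \<partial>lborel)"
    proof (rule integral_lebesgue_on_AE_borel[OF _ _ _ strip_lebesgue])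
      have "continuous_on UNIV (\<lambda>p. a (fst p) * complex_of_real (sine m (snd p)))"
        by (intro continuous_intros continuous_on_compose2[OF a(1)] continuous_on_compose2[OF continuous_on_sine]) auto
      from borel_measurable_times[OF W0(1) borel_measurable_continuous_onI[OF this]]
      show "(\<lambda>p. W0 p * a (fst p) * complex_of_real (sine m (snd p))) \<in> borel_measurable borel"
        by (simp add: mult.assoc)
    qed (use W0(2,3) in \<open>auto simp: sine_def elim: eventually_mono\<close>)
    also have "\<dots> = (\<integral>x. csine_coeff (\<lambda>y. W0 (x, y)) m * a x \<partial>lborel) / 2"
      by (rule integral_mode_fubini[OF W0(1,2,4) a])
    finally show ?thesis .
  qed
  show ?thesis
  proof (rule helmholtz_representation[OF mode_k_nonzero[OF k m] Im_mode_k])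
    show "set_integrable lborel {-R..R} ?um" for R
      by (rule csine_coeff_locally_integrable[OF u0(1,2) uloc])
    show "integrable lborel ?fm" by (rule csine_coeff_integrable[OF f0(1,4,2)])
  next
    fix \<psi> \<psi>' \<psi>'' :: "real \<Rightarrow> complex" and r :: real
    assume \<psi>: "smooth \<psi>" "r > 0" "\<And>x. \<bar>x\<bar> > r \<Longrightarrow> \<psi> x = 0"
      and \<psi>': "\<And>x. (\<psi> has_vector_derivative \<psi>' x) (at x)" and \<psi>'': "\<And>x. (\<psi>' has_vector_derivative \<psi>'' x) (at x)"
    have sm: "smooth \<psi>''" using smooth_real_iff[OF \<psi>'] smooth_real_iff[OF \<psi>''] \<psi>(1) by auto
    have v1: "\<psi>' x = 0" if "\<bar>x\<bar> > r" for x by (rule has_vector_derivative_vanishing[OF \<psi>' \<psi>(3) that])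
    have v2: "\<psi>'' x = 0" if "\<bar>x\<bar> > r" for x by (rule has_vector_derivative_vanishing[OF \<psi>'' v1 that])
    have A: "(\<integral>p. u p * \<psi>'' (fst p) * complex_of_real (sin (real m * pi * snd p)) \<partial>lebesgue_on strip) = (\<integral>x. ?um x * \<psi>'' x \<partial>lborel) / 2"
      by (rule conv[OF u0 uloc smooth_continuous_on[OF sm] v2])
    have B: "(\<integral>p. u p * \<psi> (fst p) * complex_of_real (sin (real m * pi * snd p)) \<partial>lebesgue_on strip) = (\<integral>x. ?um x * \<psi> x \<partial>lborel) / 2"
      by (rule conv[OF u0 uloc smooth_continuous_on[OF \<psi>(1)] \<psi>(3)])
    have C: "(\<integral>p. V p * u p * \<psi> (fst p) * complex_of_real (sin (real m * pi * snd p)) \<partial>lebesgue_on strip) = (\<integral>x. ?fm x * \<psi> x \<partial>lborel) / 2"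
      by (rule conv[OF f0(1,2,3) floc smooth_continuous_on[OF \<psi>(1)] \<psi>(3)])
    \<comment> \<open>Each of the three integrals carries the factor 1/2 coming from
      \<open>conv\<close>, which cancels.\<close>
    from weak_mode_equation[OF sol V \<psi>(1,3,2) \<psi>' \<psi>'', of m, unfolded A B C]
    have "((\<integral>x. ?um x * \<psi>'' x \<partial>lborel) + (mode_k k m)\<^sup>2 * (\<integral>x. ?um x * \<psi> x \<partial>lborel)) / 2 = (- (\<integral>x. ?fm x * \<psi> x \<partial>lborel)) / 2"
      by (simp add: mode_k_square add_divide_distrib)
    then show "(\<integral>x. ?um x * \<psi>'' x \<partial>lborel) + (mode_k k m)\<^sup>2 * (\<integral>x. ?um x * \<psi> x \<partial>lborel) = - (\<integral>x. ?fm x * \<psi> x \<partial>lborel)"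
      by simp
  next
    show "?um \<in> borel_measurable lborel \<and> integrable lborel (\<lambda>x. (norm (?um x))\<^sup>2) \<or>
      (\<exists>w w'. (AE x in lborel. w x = ?um x) \<and> (\<forall>x. (w has_vector_derivative w' x) (at x)) \<and>
        (\<lambda>x. complex_of_real (sgn x) * w' x - \<i> * mode_k k m * w x) \<in> o[at_infinity](\<lambda>_. 1))"
    proof (cases "(real m)\<^sup>2 * pi\<^sup>2 < k")
      case True
      then have "outgoing (mode_k k m) (mode_coeff u m)" using adm m by (simp add: admissible_def)
      then obtain w w' where w: "AE x in lebesgue. w x = mode_coeff u m x" "\<forall>x. (w has_vector_derivative w' x) (at x)"
        "(\<lambda>x. complex_of_real (sgn x) * w' x - \<i> * mode_k k m * w x) \<in> o[at_infinity](\<lambda>_. 1)"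
        unfolding outgoing_def by blast
      have "AE x in lborel. w x = mode_coeff u m x" using w(1) by (simp add: AE_completion_iff)
      with ae have "AE x in lborel. w x = ?um x" by eventually_elim simp
      then show ?thesis using w(2,3) by blast
    next
      case False
      then have "mode_coeff u m \<in> H1_on UNIV" using adm m by (simp add: admissible_def)
      then have i: "integrable lebesgue (\<lambda>x. (norm (mode_coeff u m x))\<^sup>2)"
        by (auto simp: H1_on_def H1_grad_def L2_on_def lebesgue_on_UNIV_eq)
      have mu: "?um \<in> borel_measurable borel" by (rule csine_coeff_borel[OF u0(1)])
      have "integrable lborel (\<lambda>x. (norm (?um x))\<^sup>2)"
        by (rule integrable_lebesgue_AE_borel[OF i]) (use mu ae in \<open>auto elim: eventually_mono\<close>)
      then show ?thesis using mu by simp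
    qed
  qed
qed

text \<open>The second hypothesis says that S is not a null set. Over a null set the essential
  supremum would be minus infinity and could not serve as a nonnegative real bound.\<close>

lemma Linf_norm_bound:
  assumes "V \<in> Linf_on S" "\<not> (AE p in lebesgue_on S. False)"
  obtains B where "Linf_norm S V = ereal B" "B \<ge> 0" "AE p in lebesgue_on S. norm (V p) \<le> B"
proof -
  have ae: "AE p in lebesgue_on S. ereal (norm (V p)) \<le> Linf_norm S V"
    unfolding Linf_norm_def by (rule esssup_AE)
  have "0 \<le> Linf_norm S V"
  proof (rule ccontr)
    assume neg: "\<not> 0 \<le> Linf_norm S V"
    from ae have "AE p in lebesgue_on S. False"
    proof eventually_elim
      case (elim p)
      have "(0::ereal) \<le> ereal (norm (V p))" by simp
      then show False using elim neg order_trans by blast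
    qed
    then show False using assms(2) by blast
  qed
  moreover have "Linf_norm S V < \<infinity>" using assms(1) by (simp add: Linf_on_def)
  ultimately obtain B where B: "Linf_norm S V = ereal B" "B \<ge> 0" by (cases "Linf_norm S V") auto
  show ?thesis by (rule that[OF B]) (use ae B in auto)
qed

lemma lmeasurable_borel_representative:
  fixes A :: "real set"
  assumes "A \<in> lmeasurable"
  obtains B where "B \<in> sets borel" "AE x in lborel. x \<in> A \<longleftrightarrow> x \<in> B" "emeasure lborel B < \<infinity>"
proof -
  have A: "A \<in> sets lebesgue" using assms by (rule fmeasurableD)
  then have "(indicator A :: real \<Rightarrow> real) \<in> borel_measurable lebesgue" by simp
  from completion_ex_borel_measurable_real[OF this]
  obtain g :: "real \<Rightarrow> real" where g: "g \<in> borel_measurable lborel" "AE x in lborel. indicator A x = g x" by blast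
  define B where "B = {x. g x = 1}"
  have B: "B \<in> sets borel" unfolding B_def using g(1) by measurable
  have ae: "AE x in lborel. x \<in> A \<longleftrightarrow> x \<in> B"
    using g(2) by eventually_elim (auto simp: B_def indicator_def split: if_splits)
  have "emeasure lebesgue A = emeasure lebesgue B"
    by (rule emeasure_eq_AE) (use ae A B in \<open>auto simp: AE_completion_iff\<close>)
  also have "\<dots> = emeasure lborel B" using B by simp
  finally have eq: "emeasure lebesgue A = emeasure lborel B" .
  have "emeasure lebesgue A < \<infinity>" using assms unfolding fmeasurable_def by blast
  then have "emeasure lborel B < \<infinity>" unfolding eq .
  with B ae show ?thesis by (rule that)
qed

text \<open>The last hypothesis is vacuous for bounded \<open>I\<close>, where D lies in some slab.
  For unbounded \<open>I\<close> of finite measure, H^1 regularity on every slab does not bound the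
  norm of \<open>u\<close> over D, and the contraction argument can only absorb a finite
  norm.\<close>

theorem theorem3p4:
  fixes k :: real and I :: "real set" and D :: "(real \<times> real) set"
    and V u :: "real \<times> real \<Rightarrow> complex"
  assumes "k \<notin> thresholds"
    and "I \<in> lmeasurable"
    and "D = I \<times> {0<..<1}"
    and "V \<in> Linf_on strip"
    and "AE p in lebesgue_on strip. p \<notin> D \<longrightarrow> V p = 0"
    and "admissible k V u"
    and "\<not> (AE p in lebesgue_on strip. u p = 0)"
    and "\<not> bounded I \<Longrightarrow> u \<in> L2_on D"
  shows "bound_const k D * Linf_norm strip V \<ge> 1"
proof (rule ccontr)
  assume small: "\<not> bound_const k D * Linf_norm strip V \<ge> 1"
  have sol: "weak_solution k V u" using assms(6) by (simp add: admissible_def)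
  obtain g where "\<And>R. R > 0 \<Longrightarrow> H1_grad (slab R) u g"
    using sol unfolding weak_solution_def by blast
  then have u2: "u \<in> L2_on (slab R)" if "R > 0" for R using that by (simp add: H1_grad_def)
  have slab_leb: "slab R \<in> sets lebesgue" for R by (rule fmeasurableD[OF slab_lmeasurable])
  have slab_bor [measurable]: "slab R \<in> sets borel" for R
    unfolding slab_def by (intro borel_open open_Times) auto
  note [measurable] = strip_borel
  have "\<not> (AE p in lebesgue_on strip. False)"
  proof
    assume "AE p in lebesgue_on strip. False"
    then have "AE p in lebesgue_on strip. u p = 0" by eventually_elim simp
    then show False using assms(7) by contradiction
  qed
  from Linf_norm_bound[OF assms(4) this]
  obtain \<beta> where \<beta>: "Linf_norm strip V = ereal \<beta>" "\<beta> \<ge> 0" and VB: "AE p in lebesgue_on strip. norm (V p) \<le> \<beta>"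
    by blast
  have Vm: "V \<in> borel_measurable (lebesgue_on strip)" using assms(4) by (simp add: Linf_on_def)

  \<comment> \<open>The solution is given as measurable on each slab separately; the strip is
    reached as the limit of growing slabs.\<close>
  have "(\<lambda>p. indicator strip p *\<^sub>R u p) \<in> borel_measurable lebesgue"
  proof (rule borel_measurable_LIMSEQ_metric)
    fix n :: nat
    have "u \<in> borel_measurable (lebesgue_on (slab (real (Suc n))))" using u2[of "real (Suc n)"] by (simp add: L2_on_def)
    then show "(\<lambda>p. indicator (slab (real (Suc n))) p *\<^sub>R u p) \<in> borel_measurable lebesgue"
      using slab_leb by (subst (asm) borel_measurable_restrict_space_iff) simp_all
  next
    fix p :: "real \<times> real"
    obtain N :: nat where N: "\<bar>fst p\<bar> < real N" using reals_Archimedean2 by blast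
    show "(\<lambda>n. indicator (slab (real (Suc n))) p *\<^sub>R u p) \<longlonglongrightarrow> indicator strip p *\<^sub>R u p"
      by (rule tendsto_eventually, rule eventually_sequentiallyI[of N])
        (use N in \<open>cases p; auto simp: slab_def strip_def indicator_def\<close>)
  qed
  then obtain v where v: "v \<in> borel_measurable borel" "AE p in lborel. indicator strip p *\<^sub>R u p = v p"
    by (rule lebesgue_borel_representative)
  have "(\<lambda>p. indicator strip p *\<^sub>R V p) \<in> borel_measurable lebesgue"
    using Vm strip_lebesgue by (subst (asm) borel_measurable_restrict_space_iff) simp_all
  then obtain V0 where V0: "V0 \<in> borel_measurable borel" "AE p in lborel. indicator strip p *\<^sub>R V p = V0 p"
    by (rule lebesgue_borel_representative)
  obtain J where J: "J \<in> sets borel" "AE x in lborel. x \<in> I \<longleftrightarrow> x \<in> J" "emeasure lborel J < \<infinity>"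
    by (rule lmeasurable_borel_representative[OF assms(2)])
  note [measurable] = v(1) V0(1) J(1)
  define D0 where "D0 = J \<times> {0<..<1::real}"
  have D0_bor [measurable]: "D0 \<in> sets borel"
  proof -
    have "D0 \<in> sets (borel \<Otimes>\<^sub>M borel)" unfolding D0_def by measurable
    then show ?thesis unfolding borel_prod .
  qed
  have fstJ: "AE p in (lborel :: (real \<times> real) measure). fst p \<in> I \<longleftrightarrow> fst p \<in> J" by (rule AE_fst[OF J(2)])
  have DD0: "AE p in lborel. p \<in> D \<longleftrightarrow> p \<in> D0"
    using fstJ by eventually_elim (auto simp: assms(3) D0_def)

  define u0 where "u0 = (\<lambda>p. indicator strip p *\<^sub>R v p)"
  \<comment> \<open>A representative of V u. The conditions in the definition make the bound by
    \<open>\<beta>\<close> and the support in J hold at every point instead of almost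
    everywhere.\<close>
  define f0 where "f0 = (\<lambda>p. if norm (V0 p) \<le> \<beta> \<and> p \<in> D0 then V0 p * u0 p else 0)"
  have u0m [measurable]: "u0 \<in> borel_measurable borel" unfolding u0_def by measurable
  have f0m [measurable]: "f0 \<in> borel_measurable borel" unfolding f0_def by measurable
  have u00: "u0 p = 0" if "p \<notin> strip" for p using that by (simp add: u0_def)
  have f00: "f0 p = 0" if "p \<notin> strip" for p using u00[OF that] by (simp add: f0_def)
  have f0J: "f0 p = 0" if "fst p \<notin> J" for p using that by (auto simp: f0_def D0_def)
  have f0le: "norm (f0 p) \<le> \<beta> * norm (u0 p)" for p
    using \<beta>(2) by (auto simp: f0_def norm_mult intro: mult_right_mono)
  have u_ae: "AE p in lborel. p \<in> strip \<longrightarrow> u p = u0 p"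
    using v(2) by eventually_elim (auto simp: u0_def)
  have f_ae: "AE p in lborel. p \<in> strip \<longrightarrow> V p * u p = f0 p"
    using u_ae V0(2) DD0 VB[unfolded AE_lebesgue_on_iff[OF strip_lebesgue]] assms(5)[unfolded AE_lebesgue_on_iff[OF strip_lebesgue]]
    by eventually_elim (auto simp: f0_def)

  have Dleb: "D \<in> sets lebesgue"
  proof -
    have "(indicator D0 :: _ \<Rightarrow> real) \<in> borel_measurable lebesgue" by (simp add: measurable_completion)
    moreover have "AE p in lebesgue. (indicator D0 p :: real) = indicator D p"
      using DD0 by (auto simp: AE_completion_iff indicator_def elim: eventually_mono)
    ultimately have "(indicator D :: _ \<Rightarrow> real) \<in> borel_measurable lebesgue" by (rule borel_measurable_AE)
    then show ?thesis by (simp add: borel_measurable_indicator_iff)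
  qed
  have emD0: "emeasure lborel D0 = emeasure lborel J"
  proof -
    have "emeasure (lborel \<Otimes>\<^sub>M lborel) (J \<times> {0<..<1::real}) = emeasure lborel J * emeasure lborel {0<..<1::real}"
      using J(1) by (intro lborel.emeasure_pair_measure_Times) auto
    then show ?thesis by (simp add: D0_def lborel_prod)
  qed
  \<comment> \<open>The cross section has length 1, so the area |D| in the constant is the length of
    J that occurs in the one-dimensional estimates.\<close>
  have mD: "measure lebesgue D = measure lborel J"
  proof -
    have "emeasure lebesgue D = emeasure lebesgue D0"
      by (rule emeasure_eq_AE) (use DD0 Dleb in \<open>auto simp: AE_completion_iff\<close>)
    also have "\<dots> = emeasure lborel D0" by simp
    finally show ?thesis unfolding measure_def emD0 by (simp only:)
  qed

  \<comment> \<open>For bounded \<open>I\<close> the set D lies in a slab, on which \<open>u\<close>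
    is square integrable; the other case is the last hypothesis.\<close>
  have uD: "u \<in> L2_on D"
  proof (cases "bounded I")
    case True
    then obtain a where a: "\<And>x. x \<in> I \<Longrightarrow> \<bar>x\<bar> \<le> a" by (auto simp: bounded_iff)
    have sub: "D \<subseteq> slab (\<bar>a\<bar> + 1)" using a by (force simp: assms(3) slab_def)
    show ?thesis by (rule L2_on_subset[OF u2 sub Dleb slab_leb]) simp
  qed (rule assms(8))
  have isq: "integrable lborel (\<lambda>p. indicator S0 p *\<^sub>R (norm (u0 p))\<^sup>2)"
    if "u \<in> L2_on S" "S \<in> sets lebesgue" "S \<subseteq> strip" "S0 \<in> sets borel" "AE p in lborel. p \<in> S \<longleftrightarrow> p \<in> S0" for S S0
  proof (rule integrable_lebesgue_on_AE_borel[of S "\<lambda>p. (norm (u p))\<^sup>2"])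
    show "integrable (lebesgue_on S) (\<lambda>p. (norm (u p))\<^sup>2)" using that(1) by (simp add: L2_on_def)
    note [measurable] = that(4)
    show "(\<lambda>p. indicator S0 p *\<^sub>R (norm (u0 p))\<^sup>2) \<in> borel_measurable borel" by measurable
    show "AE p in lborel. indicator S p *\<^sub>R (norm (u p))\<^sup>2 = indicator S0 p *\<^sub>R (norm (u0 p))\<^sup>2"
      using u_ae that(5) by eventually_elim (use that(3) in \<open>auto simp: indicator_def\<close>)
  qed (rule that(2))
  have iD0: "integrable lborel (\<lambda>p. indicator D0 p *\<^sub>R (norm (u0 p))\<^sup>2)"
    by (rule isq[OF uD Dleb _ D0_bor DD0]) (auto simp: assms(3) strip_def)
  have islab2: "integrable lborel (\<lambda>p. indicator (slab R) p *\<^sub>R (norm (u0 p))\<^sup>2)" if "R > 0" for R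
    by (rule isq[OF u2[OF that] slab_leb slab_subset_strip slab_bor]) simp
  have uloc: "integrable lborel (\<lambda>p. indicator (slab R) p *\<^sub>R u0 p)" for R
  proof (cases "R > 0")
    case True
    show ?thesis
    proof (rule integrable_lebesgue_on_AE_borel[of "slab R" u])
      show "integrable (lebesgue_on (slab R)) u" by (rule L2_on_imp_integrable[OF slab_lmeasurable u2[OF True]])
      show "AE p in lborel. indicator (slab R) p *\<^sub>R u p = indicator (slab R) p *\<^sub>R u0 p"
        using u_ae by eventually_elim (use slab_subset_strip[of R] in \<open>auto simp: indicator_def\<close>)
    qed (use slab_leb in auto)
  next
    case False
    then have "slab R = {}" by (auto simp: slab_def)
    then show ?thesis by simp
  qed
  have nn: "(\<integral>\<^sup>+p. indicator S p * ennreal ((norm (u0 p))\<^sup>2) \<partial>lborel) < \<infinity>"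
    if "integrable lborel (\<lambda>p. indicator S p *\<^sub>R (norm (u0 p))\<^sup>2)" for S
  proof -
    have "(\<integral>\<^sup>+p. indicator S p * ennreal ((norm (u0 p))\<^sup>2) \<partial>lborel) = (\<integral>\<^sup>+p. ennreal (indicator S p *\<^sub>R (norm (u0 p))\<^sup>2) \<partial>lborel)"
      by (intro nn_integral_cong) (auto simp: indicator_def)
    also have "\<dots> = ennreal (\<integral>p. indicator S p *\<^sub>R (norm (u0 p))\<^sup>2 \<partial>lborel)"
      by (rule nn_integral_eq_integral[OF that]) simp
    finally show ?thesis by simp
  qed
  \<comment> \<open>\<open>D0\<close> has finite measure, so t <= 1 + t^2 with t =
    \<open>\<beta>\<close> |u0| turns square integrability on \<open>D0\<close> into
    integrability.\<close>
  have if0: "integrable lborel f0"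
  proof (rule Bochner_Integration.integrable_bound[of _ "\<lambda>p. indicator D0 p + \<beta>\<^sup>2 * (indicator D0 p *\<^sub>R (norm (u0 p))\<^sup>2)"])
    have "integrable lborel (indicator D0 :: _ \<Rightarrow> real)" using emD0 J(3) by simp
    then show "integrable lborel (\<lambda>p. indicator D0 p + \<beta>\<^sup>2 * (indicator D0 p *\<^sub>R (norm (u0 p))\<^sup>2))"
      using iD0 by (intro Bochner_Integration.integrable_add integrable_mult_right)
    show "AE p in lborel. norm (f0 p) \<le> norm (indicator D0 p + \<beta>\<^sup>2 * (indicator D0 p *\<^sub>R (norm (u0 p))\<^sup>2))"
    proof (rule AE_I2)
      fix p
      show "norm (f0 p) \<le> norm (indicator D0 p + \<beta>\<^sup>2 * (indicator D0 p *\<^sub>R (norm (u0 p))\<^sup>2))"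
      proof (cases "p \<in> D0")
        case True
        then show ?thesis
          using order_trans[OF f0le[of p] le_one_plus_square[of "\<beta> * norm (u0 p)"]] by (simp add: power_mult_distrib)
      qed (simp add: f0_def)
    qed
  qed simp

  obtain b where b: "bound_const k D = ereal b" "b \<ge> 0"
    "\<And>m. m \<ge> 1 \<Longrightarrow> measure lebesgue D / (2 * norm (mode_k k m)) \<le> b \<or>
       ((real m)\<^sup>2 * pi\<^sup>2 > k \<and> 1 / (norm (mode_k k m))\<^sup>2 \<le> b)"
  proof (rule bound_const_dominates[OF assms(1), of D])
    fix b assume "bound_const k D = ereal b" "b \<ge> 0"
      "\<And>m. m \<ge> 1 \<Longrightarrow> measure lebesgue D / (2 * norm (mode_k k m)) \<le> b \<or>
         ((real m)\<^sup>2 * pi\<^sup>2 > k \<and> 1 / (norm (mode_k k m))\<^sup>2 \<le> b)"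
    then show ?thesis by (rule that)
  qed
  have b\<beta>: "b * \<beta> < 1" using small unfolding b(1) \<beta>(1) by (simp add: one_ereal_def not_le)
  have "AE p in lborel. u0 p = 0"
  proof (rule AE_zero_of_contraction[OF u0m u00 _ f0m f0le f0J J(1) _ b(2) \<beta>(2) b\<beta>])
    show "(\<integral>\<^sup>+p. indicator (slab (real n)) p * ennreal ((norm (u0 p))\<^sup>2) \<partial>lborel) < \<infinity>" for n :: nat
    proof (cases "n = 0")
      case True
      then show ?thesis by (simp add: slab_def)
    qed (intro nn islab2, simp)
    have "indicator (J \<times> UNIV) p * ennreal ((norm (u0 p))\<^sup>2) = indicator D0 p * ennreal ((norm (u0 p))\<^sup>2)" for p
      using u00[of p] by (cases p) (auto simp: D0_def strip_def indicator_def)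
    then show "(\<integral>\<^sup>+p. indicator (J \<times> UNIV) p * ennreal ((norm (u0 p))\<^sup>2) \<partial>lborel) < \<infinity>"
      using nn[OF iD0] by simp
  next
    fix m :: nat assume m: "m \<ge> 1"
    show "AE x in lborel. csine_coeff (\<lambda>y. u0 (x, y)) m = green_conv (mode_k k m) (\<lambda>x. csine_coeff (\<lambda>y. f0 (x, y)) m) x"
      by (rule admissible_mode_representation[OF assms(1,6) m Vm VB u0m u00 u_ae uloc f0m f00 f_ae if0])
    show "(\<integral>\<^sup>+x\<in>J. (norm (green_conv (mode_k k m) (\<lambda>x. csine_coeff (\<lambda>y. f0 (x, y)) m) x))\<^sup>2 \<partial>lborel)
        \<le> ennreal (b\<^sup>2) * (\<integral>\<^sup>+x. (norm (csine_coeff (\<lambda>y. f0 (x, y)) m))\<^sup>2 \<partial>lborel)"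
    proof (rule mode_bound[OF csine_coeff_integrable[OF f0m if0 f00] J(1,3) _ b(2)])
      show "csine_coeff (\<lambda>y. f0 (x, y)) m = 0" if "x \<notin> J" for x
        using f0J[of "(x, _)"] that by (simp add: csine_coeff_def)
      show "measure lborel J / (2 * norm (mode_k k m)) \<le> b \<or> ((real m)\<^sup>2 * pi\<^sup>2 > k \<and> 1 / (norm (mode_k k m))\<^sup>2 \<le> b)"
        using b(3)[OF m] unfolding mD .
    qed
  qed
  with u_ae have "AE p in lborel. p \<in> strip \<longrightarrow> u p = 0" by eventually_elim simp
  then have "AE p in lebesgue_on strip. u p = 0" by (simp add: AE_lebesgue_on_iff[OF strip_lebesgue])
  then show False using assms(7) by contradiction
qed

end
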